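(* Let $U\subset\mathbb{R}^m$ be open, let $X,Y$ be real separable Hilbert spaces, and let $F:U\to\mathcal{L}(X,Y)$ be real analytic in the operator norm. Let $R:U\to\mathbb{R}^r$ be $C^1$. Assume that for all $p,q\in U$, $$F(p)=F(q)\quad\Longrightarrow\quad R(p)=R(q).$$ Let $(x_i)_{i\ge1}$ be a countable dense family in $X$ and $(y_j)_{j\ge1}$ a countable dense family in $Y$, and put $$m_{ij}(p)=(F(p)x_i,y_j)_Y,\qquad p\in U.$$ Then for every compact set $K\subset U$ there exist finitely many index pairs $(i_\ell,j_\ell)$, $\ell=1,\ldots,M$, and constants $C>0$, $\theta\in(0,1]$, such that $$|R(p)-R(q)|\le C\left(\sum_{\ell=1}^M|m_{i_\ell j_\ell}(p)-m_{i_\ell j_\ell}(q)|^2\right)^{\theta/2}\qquad\text{for all }p,q\in K.$$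
   Context: $\mathcal{L}(X,Y)$ denotes the Banach space of bounded linear operators $X\to Y$ with the operator norm, and $(\cdot,\cdot)_Y$ is the inner product of $Y$. For a real Banach space $B$ and an open set $U\subset\mathbb{R}^m$, a map $F:U\to B$ is real analytic if for every $p_0\in U$ there are continuous symmetric multilinear maps $A_k:(\mathbb{R}^m)^k\to B$, $k\ge 0$, such that $F(p_0+h)=\sum_{k=0}^\infty A_k(h,\ldots,h)$ for all sufficiently small $h$, with convergence in the norm of $B$. "Real analytic in the operator norm" means this with $B=\mathcal{L}(X,Y)$. *)

theory Defs
  imports "HOL-Analysis.Analysis"
begin

(* A k-linear map on 'a^k is encoded as a function of an infinite sequence of arguments that
   depends only on the arguments number 0, ..., k - 1. *)
definition multilinear_form ::
  "nat \<Rightarrow> ((nat \<Rightarrow> 'a::real_vector) \<Rightarrow> 'b::real_vector) \<Rightarrow> bool" where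
  "multilinear_form k A \<longleftrightarrow>
     (\<forall>v w. (\<forall>i<k. v i = w i) \<longrightarrow> A v = A w) \<and>
     (\<forall>i<k. \<forall>v. linear (\<lambda>x. A (v(i := x))))"

definition symmetric_form ::
  "nat \<Rightarrow> ((nat \<Rightarrow> 'a) \<Rightarrow> 'b) \<Rightarrow> bool" where
  "symmetric_form k A \<longleftrightarrow> (\<forall>\<pi> v. \<pi> permutes {..<k} \<longrightarrow> A (v \<circ> \<pi>) = A v)"

(* Continuity of A k refers to the product topology on sequences; as A k depends on its first k
   arguments only, this is continuity on the k-fold product. For open U, p + h lies in U for all
   small h, so values of F outside U are irrelevant. *)
definition real_analytic_on ::
  "('a::real_normed_vector \<Rightarrow> 'b::real_normed_vector) \<Rightarrow> 'a set \<Rightarrow> bool" where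
  "real_analytic_on F U \<longleftrightarrow>
     (\<forall>p\<in>U. \<exists>A :: nat \<Rightarrow> (nat \<Rightarrow> 'a) \<Rightarrow> 'b.
        (\<forall>k. multilinear_form k (A k) \<and> symmetric_form k (A k) \<and> continuous_on UNIV (A k)) \<and>
        (\<forall>\<^sub>F h in nhds 0. (\<lambda>k. A k (\<lambda>_. h)) sums F (p + h)))"

definition continuously_differentiable_on ::
  "('a::real_normed_vector \<Rightarrow> 'b::real_normed_vector) \<Rightarrow> 'a set \<Rightarrow> bool" where
  "continuously_differentiable_on R U \<longleftrightarrow>
     (\<exists>R' :: 'a \<Rightarrow> 'a \<Rightarrow>\<^sub>L 'b.
        (\<forall>p\<in>U. (R has_derivative blinfun_apply (R' p)) (at p)) \<and> continuous_on U R')"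

definition matrix_entry ::
  "('p \<Rightarrow> 'x::real_inner \<Rightarrow>\<^sub>L 'y::real_inner) \<Rightarrow> (nat \<Rightarrow> 'x) \<Rightarrow> (nat \<Rightarrow> 'y) \<Rightarrow>
     nat \<Rightarrow> nat \<Rightarrow> 'p \<Rightarrow> real" where
  "matrix_entry F x y i j p = blinfun_apply (F p) (x i) \<bullet> y j"

end

theory Submission
  imports Defs "HOL-Complex_Analysis.Complex_Analysis"
begin

text \<open>Near a point of \<open>K \<times> K\<close> all the functions \<open>m\<^sub>i\<^sub>j(p) - m\<^sub>i\<^sub>j(q)\<close> extend holomorphically to one
  complex ball, and \<open>R\<close> is locally Lipschitz. So it suffices to find, for such a family, finitely many
  members whose smallness at a real point \<open>x\<close> forces a real common zero of the whole family at a
  distance bounded by a power of their size.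

  This goes by induction on the dimension. Choose a member \<open>f0\<close> and a real direction \<open>v\<close> along which
  \<open>f0\<close> does not vanish identically, and consider the finitely many complex roots \<open>t\<close> of \<open>f0(x + t v)\<close>
  for \<open>x\<close> orthogonal to \<open>v\<close>. Stratify these \<open>x\<close> by the number of distinct roots and by the
  number of roots that are not common zeros of the family. By the argument principle the strata are
  cut out by holomorphic symmetric functions of the roots. If a root is non-real but close to the
  real line, then so is its conjugate, and if it is not a common zero while finitely many members
  are small there, then a product of values is small; in both cases the symmetric function defining
  the stratum is small at \<open>x\<close>. By the induction hypothesis \<open>x\<close> can be moved slightly to a
  lower stratum, and the root moves only slightly. In the lowest stratum the root is
  unique, real, and a common zero.\<close>

section \<open>Holomorphic functions on a complexified Euclidean space\<close>

text \<open>The obstacle is finiteness. The weight that makes a discriminant nonzero depends on the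
  point, so the functions cutting out a stratum form a family indexed by all linear combinations of
  the given functions. An induction restricted to finite families would not apply to it. The
  inequality is therefore proved for arbitrary families, and the finite subset is produced by the
  same induction as the exponent, without appeal to a Noetherian property of rings of germs.

  The induction hypothesis requires functions that vanish at the origin. The discriminants do,
  because \<open>v\<close> is chosen such that 0 is an isolated root of \<open>f0\<close> over the
  origin: the origin then lies in the lowest stratum, where all the discriminants in use vanish.

  Powers enter through one estimate in one variable: a function with at most \<open>deg\<close>
  zeros in a disc, bounded below on its circle, can be smaller than a constant times
  \<open>\<kappa> ^ deg\<close> only within \<open>\<kappa>\<close> of a zero.\<close>

text \<open>A pair \<open>(u, v)\<close> stands for the point \<open>u + i v\<close> of the complexification, and \<open>cscale s d\<close> for
  \<open>s d\<close> with \<open>d\<close> real. Holomorphy is only required along complex lines with real direction, which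
  keeps it stable under restriction to lines in any direction without Osgood's theorem.\<close>

definition cscale :: "complex \<Rightarrow> 'a::real_vector \<Rightarrow> 'a \<times> 'a" where
  "cscale s d = (Re s *\<^sub>R d, Im s *\<^sub>R d)"

lemma cscale_add: "cscale (s + t) d = cscale s d + cscale t d"
  by (simp add: cscale_def scaleR_add_left)

lemma cscale_0 [simp]: "cscale 0 d = 0"
  by (simp add: cscale_def zero_prod_def)

lemma cscale_of_real: "cscale (of_real t) d = (t *\<^sub>R d, 0)"
  by (simp add: cscale_def)

lemma cscale_scaleR: "cscale (t *\<^sub>R s) d = t *\<^sub>R cscale s d"
  by (simp add: cscale_def)

lemma norm_cscale: "norm (cscale s d) = cmod s * norm (d :: 'a::real_normed_vector)"
proof -
  have "(Re s * norm d)\<^sup>2 + (Im s * norm d)\<^sup>2 = (cmod s * norm d)\<^sup>2"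
    by (simp add: power_mult_distrib cmod_power2 algebra_simps)
  then have "norm (cscale s d) = sqrt ((cmod s * norm d)\<^sup>2)"
    by (simp add: cscale_def norm_Pair power_mult_distrib)
  then show ?thesis by (simp del: real_sqrt_mult)
qed

lemma continuous_on_cscale [continuous_intros]:
  fixes d :: "'a::real_normed_vector"
  assumes "continuous_on A f"
  shows "continuous_on A (\<lambda>x. cscale (f x) d)"
  unfolding cscale_def by (intro continuous_intros assms)

definition gateaux_holo :: "real \<Rightarrow> ('a::euclidean_space \<times> 'a \<Rightarrow> complex) \<Rightarrow> bool" where
  "gateaux_holo r f \<longleftrightarrow> continuous_on (ball 0 r) f \<and>
     (\<forall>z d. (\<lambda>s. f (z + cscale s d)) holomorphic_on {s. z + cscale s d \<in> ball 0 r})"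

lemma gateaux_holoI:
  assumes "continuous_on (ball 0 r) f"
    and "\<And>z d. (\<lambda>s. f (z + cscale s d)) holomorphic_on {s. z + cscale s d \<in> ball 0 r}"
  shows "gateaux_holo r f"
  using assms by (auto simp: gateaux_holo_def)

lemma gateaux_holo_cont: "gateaux_holo r f \<Longrightarrow> continuous_on (ball 0 r) f"
  by (auto simp: gateaux_holo_def)

lemma gateaux_holo_line:
  "gateaux_holo r f \<Longrightarrow> (\<And>s. s \<in> A \<Longrightarrow> z + cscale s d \<in> ball 0 r) \<Longrightarrow>
    (\<lambda>s. f (z + cscale s d)) holomorphic_on A"
  unfolding gateaux_holo_def by (blast intro: holomorphic_on_subset)

lemma open_cscale_line: "open {s. z + cscale s d \<in> ball (0 :: 'a::real_normed_vector \<times> 'a) r}"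
proof -
  have "open ((\<lambda>s. z + cscale s d) -` ball 0 r)"
    by (intro open_vimage) (auto intro!: continuous_intros)
  then show ?thesis by (simp add: vimage_def)
qed

lemma convex_cscale_line: "convex {s. z + cscale s d \<in> ball (0 :: 'a::real_normed_vector \<times> 'a) r}"
proof (rule convexI)
  fix s t :: complex and u v :: real
  assume *: "s \<in> {s. z + cscale s d \<in> ball 0 r}" "t \<in> {s. z + cscale s d \<in> ball 0 r}"
    and uv: "0 \<le> u" "0 \<le> v" "u + v = 1"
  have "z = u *\<^sub>R z + v *\<^sub>R z"
    using uv by (simp flip: scaleR_add_left)
  then have eq: "z + cscale (u *\<^sub>R s + v *\<^sub>R t) d = u *\<^sub>R (z + cscale s d) + v *\<^sub>R (z + cscale t d)"
    by (simp add: cscale_add cscale_scaleR scaleR_add_right)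
  show "u *\<^sub>R s + v *\<^sub>R t \<in> {s. z + cscale s d \<in> ball 0 r}"
    using convexD[OF convex_ball, of "z + cscale s d" 0 r "z + cscale t d" u v] * uv
    by (simp only: eq mem_Collect_eq)
qed

lemma gateaux_holo_mono: "gateaux_holo r f \<Longrightarrow> r' \<le> r \<Longrightarrow> gateaux_holo r' f"
  unfolding gateaux_holo_def
  by (meson continuous_on_subset holomorphic_on_subset subset_ball Collect_mono subsetD)

lemma gateaux_holo_const [simp]: "gateaux_holo r (\<lambda>z. c)"
  by (simp add: gateaux_holo_def)

lemma gateaux_holo_add: "gateaux_holo r f \<Longrightarrow> gateaux_holo r g \<Longrightarrow> gateaux_holo r (\<lambda>z. f z + g z)"
  by (auto simp: gateaux_holo_def intro!: continuous_intros holomorphic_intros)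

lemma gateaux_holo_diff: "gateaux_holo r f \<Longrightarrow> gateaux_holo r g \<Longrightarrow> gateaux_holo r (\<lambda>z. f z - g z)"
  by (auto simp: gateaux_holo_def intro!: continuous_intros holomorphic_intros)

lemma gateaux_holo_mult: "gateaux_holo r f \<Longrightarrow> gateaux_holo r g \<Longrightarrow> gateaux_holo r (\<lambda>z. f z * g z)"
  by (auto simp: gateaux_holo_def intro!: continuous_intros holomorphic_intros)

lemma gateaux_holo_sum: "(\<And>i. i \<in> I \<Longrightarrow> gateaux_holo r (f i)) \<Longrightarrow> gateaux_holo r (\<lambda>z. \<Sum>i\<in>I. f i z)"
  by (induction I rule: infinite_finite_induct) (auto intro!: gateaux_holo_add)

lemma gateaux_holo_prod: "(\<And>i. i \<in> I \<Longrightarrow> gateaux_holo r (f i)) \<Longrightarrow> gateaux_holo r (\<lambda>z. \<Prod>i\<in>I. f i z)"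
  by (induction I rule: infinite_finite_induct) (auto intro!: gateaux_holo_mult)

definition ccoord :: "'a::real_inner \<Rightarrow> 'a \<times> 'a \<Rightarrow> complex" where
  "ccoord b z = Complex (fst z \<bullet> b) (snd z \<bullet> b)"

lemma ccoord_add_cscale: "ccoord b (z + cscale s d) = ccoord b z + s * of_real (d \<bullet> b)"
  by (simp add: ccoord_def cscale_def complex_eq_iff inner_add_left)

lemma gateaux_holo_ccoord: "gateaux_holo r (ccoord b)"
proof (rule gateaux_holoI)
  show "continuous_on (ball 0 r) (ccoord b)"
    unfolding ccoord_def Complex_eq by (intro continuous_intros)
qed (auto simp: ccoord_add_cscale intro!: holomorphic_intros)

definition cconj :: "'a::real_vector \<times> 'a \<Rightarrow> 'a \<times> 'a" where
  "cconj z = (fst z, - snd z)"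

lemma norm_cconj [simp]: "norm (cconj z) = norm (z :: 'a::real_normed_vector \<times> 'a)"
  by (cases z) (simp add: cconj_def norm_Pair)

lemma cconj_cconj [simp]: "cconj (cconj z) = z"
  by (cases z) (simp add: cconj_def)

lemma cconj_add_cscale: "cconj (z + cscale s d) = cconj z + cscale (cnj s) d"
  by (cases z) (simp add: cconj_def cscale_def)

text \<open>On real points \<open>star f\<close> is the conjugate of \<open>f\<close>, so adjoining \<open>star f\<close> to a family changes
  neither its real zeros nor its size there, but at a common zero it makes the roots of \<open>f\<close> along
  a real line symmetric under conjugation.\<close>

definition star :: "('a::real_vector \<times> 'a \<Rightarrow> complex) \<Rightarrow> 'a \<times> 'a \<Rightarrow> complex" where
  "star f z = cnj (f (cconj z))"

lemma star_star [simp]: "star (star f) = f"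
  by (auto simp: star_def)

lemma norm_star_real [simp]: "cmod (star f (x, 0)) = cmod (f (x, 0))"
  by (simp add: star_def cconj_def)

lemma gateaux_holo_star:
  assumes "gateaux_holo r f"
  shows "gateaux_holo r (star f)"
proof (rule gateaux_holoI)
  show "continuous_on (ball 0 r) (star f)"
    unfolding star_def
  proof (intro continuous_intros)
    have "continuous_on (ball 0 r) (f \<circ> cconj)"
    proof (rule continuous_on_compose)
      show "continuous_on (ball 0 r) (cconj :: 'a \<times> 'a \<Rightarrow> _)"
        unfolding cconj_def by (intro continuous_intros)
      show "continuous_on (cconj ` ball 0 r) f"
        by (rule continuous_on_subset[OF gateaux_holo_cont[OF assms]]) auto
    qed
    then show "continuous_on (ball 0 r) (\<lambda>z. f (cconj z))" by (simp add: o_def)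
  qed
next
  fix z :: "'a \<times> 'a" and d
  have *: "z + cscale (cnj x) d \<in> ball 0 r \<longleftrightarrow> cconj z + cscale x d \<in> ball 0 r" for x
    by (metis cconj_add_cscale complex_cnj_cnj mem_ball_0 norm_cconj)
  have "(cnj \<circ> (\<lambda>s. f (cconj z + cscale s d)) \<circ> cnj) holomorphic_on {s. z + cscale s d \<in> ball 0 r}"
  proof (rule holomorphic_on_compose_cnj_cnj[OF _ open_cscale_line])
    show "(\<lambda>s. f (cconj z + cscale s d)) holomorphic_on cnj ` {s. z + cscale s d \<in> ball 0 r}"
      by (rule gateaux_holo_line[OF assms])
         (metis (no_types, lifting) * complex_cnj_cnj imageE mem_Collect_eq)
  qed
  then show "(\<lambda>s. star f (z + cscale s d)) holomorphic_on {s. z + cscale s d \<in> ball 0 r}"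
    by (simp add: star_def cconj_add_cscale o_def)
qed

section \<open>Circle integrals depending on a parameter\<close>

lemma continuous_on_contour_integral_param:
  assumes cont: "continuous_on (U \<times> path_image g) (\<lambda>(z, w). h z w)"
    and g: "path g" "continuous_on {0..1} (\<lambda>t. vector_derivative g (at t))"
  shows "continuous_on U (\<lambda>z. contour_integral g (h z))"
proof -
  have "continuous_on (U \<times> cbox (0::real) 1) (\<lambda>(z, t). h z (g t) * vector_derivative g (at t))"
  proof -
    have "continuous_on (U \<times> {0..1::real}) ((\<lambda>(z, w). h z w) \<circ> (\<lambda>(z, t). (z, g t)))"
    proof (rule continuous_on_compose)
      show "continuous_on (U \<times> {0..1}) (\<lambda>(z, t). (z, g t))"
        unfolding case_prod_unfold
        by (intro continuous_intros continuous_on_compose2[OF g(1)[unfolded path_def]]) auto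
      show "continuous_on ((\<lambda>(z, t). (z, g t)) ` (U \<times> {0..1})) (\<lambda>(z, w). h z w)"
        by (rule continuous_on_subset[OF cont]) (auto simp: path_image_def)
    qed
    moreover have "continuous_on (U \<times> {0..1::real}) (\<lambda>x. vector_derivative g (at (snd x)))"
      by (intro continuous_on_compose2[OF g(2)] continuous_intros) auto
    ultimately show ?thesis
      by (auto simp: o_def case_prod_unfold intro!: continuous_on_mult)
  qed
  from integral_continuous_on_param[OF this] show ?thesis
    by (simp add: contour_integral_integral)
qed

lemma continuous_on_vector_derivative_circlepath:
  "continuous_on A (\<lambda>t. vector_derivative (circlepath z r) (at t))"
  by (auto simp: vector_derivative_circlepath intro!: continuous_intros)

text \<open>Morera's theorem along each line: the integral over a triangle can be taken inside the
  circle integral, where it vanishes for each fixed \<open>w\<close> by Cauchy's theorem.\<close>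

lemma gateaux_holo_circle_integral:
  fixes h :: "'a::euclidean_space \<times> 'a \<Rightarrow> complex \<Rightarrow> complex"
  assumes "\<delta> > 0"
    and cont: "continuous_on (ball 0 r \<times> sphere 0 \<delta>) (\<lambda>(z, w). h z w)"
    and hol: "\<And>w z d. cmod w = \<delta> \<Longrightarrow>
      (\<lambda>s. h (z + cscale s d) w) holomorphic_on {s. z + cscale s d \<in> ball 0 r}"
  shows "gateaux_holo r (\<lambda>z. contour_integral (circlepath 0 \<delta>) (h z))"
proof (rule gateaux_holoI)
  have img: "path_image (circlepath 0 \<delta>) = sphere 0 \<delta>"
    using \<open>\<delta> > 0\<close> by simp
  show c: "continuous_on (ball 0 r) (\<lambda>z. contour_integral (circlepath 0 \<delta>) (h z))"
    by (rule continuous_on_contour_integral_param)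
       (use cont img in \<open>simp_all add: continuous_on_vector_derivative_circlepath\<close>)
  fix z :: "'a \<times> 'a" and d
  define A where "A = {s. z + cscale s d \<in> ball 0 r}"
  have contA: "continuous_on (A \<times> sphere 0 \<delta>) (\<lambda>(s, w). h (z + cscale s d) w)"
  proof -
    have "continuous_on (A \<times> sphere 0 \<delta>) ((\<lambda>(z, w). h z w) \<circ> (\<lambda>(s, w). (z + cscale s d, w)))"
      unfolding case_prod_unfold
      by (intro continuous_on_compose continuous_intros
           continuous_on_subset[OF cont[unfolded case_prod_unfold]]) (auto simp: A_def)
    then show ?thesis by (simp add: o_def case_prod_unfold)
  qed
  have "(\<lambda>s. contour_integral (circlepath 0 \<delta>) (h (z + cscale s d))) analytic_on A"
  proof (rule Morera_triangle)
    show "open A" unfolding A_def by (rule open_cscale_line)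
    show "continuous_on A (\<lambda>s. contour_integral (circlepath 0 \<delta>) (h (z + cscale s d)))"
      by (rule continuous_on_compose2[OF c]) (auto simp: A_def intro!: continuous_intros)
    fix a b c :: complex
    show "convex hull {a, b, c} \<subseteq> A \<longrightarrow>
      contour_integral (linepath a b) (\<lambda>s. contour_integral (circlepath 0 \<delta>) (h (z + cscale s d))) +
      contour_integral (linepath b c) (\<lambda>s. contour_integral (circlepath 0 \<delta>) (h (z + cscale s d))) +
      contour_integral (linepath c a) (\<lambda>s. contour_integral (circlepath 0 \<delta>) (h (z + cscale s d))) = 0"
    proof
      assume sub: "convex hull {a, b, c} \<subseteq> A"
      define J where "J u v = (\<lambda>w. contour_integral (linepath u v) (\<lambda>s. h (z + cscale s d) w))" for u v
      have seg: "closed_segment u v \<subseteq> A" if "u \<in> {a, b, c}" "v \<in> {a, b, c}" for u v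
        using sub that hull_mono[of "{u,v}" "{a,b,c}" convex] by (auto simp: segment_convex_hull)
      have swap: "contour_integral (linepath u v) (\<lambda>s. contour_integral (circlepath 0 \<delta>) (h (z + cscale s d)))
          = contour_integral (circlepath 0 \<delta>) (J u v)" if "u \<in> {a, b, c}" "v \<in> {a, b, c}" for u v
        unfolding J_def
      proof (rule contour_integral_swap)
        show "continuous_on (path_image (linepath u v) \<times> path_image (circlepath 0 \<delta>))
            (\<lambda>(y1, y2). h (z + cscale y1 d) y2)"
          by (rule continuous_on_subset[OF contA]) (use seg[OF that] img in auto)
      qed (auto simp: continuous_on_vector_derivative_circlepath)
      have int: "J u v contour_integrable_on circlepath 0 \<delta>" if "u \<in> {a, b, c}" "v \<in> {a, b, c}" for u v
      proof (rule contour_integrable_continuous_circlepath)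
        have "continuous_on (sphere 0 \<delta> \<times> path_image (linepath u v)) (\<lambda>(w, s). h (z + cscale s d) w)"
          using continuous_on_subset[OF contA, of "path_image (linepath u v) \<times> sphere 0 \<delta>"] seg[OF that]
          by (subst continuous_on_swap_args) auto
        then show "continuous_on (path_image (circlepath 0 \<delta>)) (J u v)"
          unfolding img J_def
          by (rule continuous_on_contour_integral_param) auto
      qed
      have "J a b w + J b c w + J c a w = 0" if "cmod w = \<delta>" for w
      proof -
        have holw: "(\<lambda>s. h (z + cscale s d) w) holomorphic_on A"
          using hol[OF that] by (simp add: A_def)
        have "((\<lambda>s. h (z + cscale s d) w) has_contour_integral 0)
            (linepath a b +++ linepath b c +++ linepath c a)"
          by (rule Cauchy_theorem_triangle) (rule holomorphic_on_subset[OF holw sub])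
        moreover have "(\<lambda>s. h (z + cscale s d) w) contour_integrable_on linepath u v"
          if "u \<in> {a, b, c}" "v \<in> {a, b, c}" for u v
          by (intro contour_integrable_continuous_linepath holomorphic_on_imp_continuous_on
               holomorphic_on_subset[OF holw] seg that)
        ultimately show ?thesis
          unfolding J_def
          by (auto dest!: contour_integral_unique simp: contour_integral_join contour_integrable_join add.assoc)
      qed
      then have "contour_integral (circlepath 0 \<delta>) (\<lambda>w. J a b w + J b c w + J c a w) =
          contour_integral (circlepath 0 \<delta>) (\<lambda>w. 0)"
        by (intro contour_integral_eq) (use \<open>\<delta> > 0\<close> in auto)
      then show "contour_integral (linepath a b) (\<lambda>s. contour_integral (circlepath 0 \<delta>) (h (z + cscale s d))) +
        contour_integral (linepath b c) (\<lambda>s. contour_integral (circlepath 0 \<delta>) (h (z + cscale s d))) +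
        contour_integral (linepath c a) (\<lambda>s. contour_integral (circlepath 0 \<delta>) (h (z + cscale s d))) = 0"
        by (simp add: swap int contour_integral_add contour_integrable_add)
    qed
  qed
  then show "(\<lambda>s. contour_integral (circlepath 0 \<delta>) (h (z + cscale s d))) holomorphic_on
      {s. z + cscale s d \<in> ball 0 r}"
    by (auto simp: A_def intro: analytic_imp_holomorphic)
qed

lemma gateaux_holo_cong:
  assumes "gateaux_holo r f" "\<And>z. z \<in> ball 0 r \<Longrightarrow> f z = g z"
  shows "gateaux_holo r g"
proof (rule gateaux_holoI)
  show "continuous_on (ball 0 r) g"
    using gateaux_holo_cont[OF assms(1)] assms(2)
    by (rule continuous_on_eq)
  fix z :: "'a \<times> 'a" and d
  show "(\<lambda>s. g (z + cscale s d)) holomorphic_on {s. z + cscale s d \<in> ball 0 r}"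
    by (rule holomorphic_transform[OF gateaux_holo_line[OF assms(1)]]) (auto intro!: assms(2))
qed

lemma add_cscale_in_ball:
  fixes v :: "'a::real_normed_vector"
  assumes "norm v = 1" "norm z < a" "cmod t \<le> b" "a + b \<le> c"
  shows "z + cscale t v \<in> ball 0 c"
proof -
  have "norm (z + cscale t v) \<le> norm z + cmod t"
    by (metis assms(1) mult.right_neutral norm_cscale norm_triangle_ineq)
  then show ?thesis using assms by simp
qed

definition dirderiv :: "'a::real_vector \<Rightarrow> ('a \<times> 'a \<Rightarrow> complex) \<Rightarrow> 'a \<times> 'a \<Rightarrow> complex" where
  "dirderiv v f z = deriv (\<lambda>s. f (z + cscale s v)) 0"

text \<open>Cauchy's formula on a circle of radius \<open>\<eta>\<close> writes the derivative as a
  circle integral of \<open>f\<close>, which is why the ball shrinks. This derivative is the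
  numerator of the logarithmic derivative in the argument principle.\<close>

lemma gateaux_holo_dirderiv:
  fixes v :: "'a::euclidean_space"
  assumes f: "gateaux_holo r f" and "r' < r" and v: "norm v = 1"
  shows "gateaux_holo r' (dirderiv v f)"
proof -
  define \<eta> where "\<eta> = (r - r') / 2"
  have \<eta>: "\<eta> > 0" "r' + \<eta> < r"
    using \<open>r' < r\<close> by (auto simp: \<eta>_def field_simps)
  have inb: "z + cscale w v \<in> ball 0 r" if "z \<in> ball 0 r'" "cmod w \<le> \<eta>" for z w
    using add_cscale_in_ball[OF v, of z r' w \<eta> r] that \<eta> by simp
  define h where "h = (\<lambda>z w. f (z + cscale w v) / w\<^sup>2)"
  have "gateaux_holo r' (\<lambda>z. contour_integral (circlepath 0 \<eta>) (h z))"
  proof (rule gateaux_holo_circle_integral[OF \<eta>(1)])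
    show "continuous_on (ball 0 r' \<times> sphere 0 \<eta>) (\<lambda>(z, w). h z w)"
      unfolding h_def case_prod_unfold
      by (intro continuous_intros continuous_on_compose2[OF gateaux_holo_cont[OF f]])
         (use \<eta> inb in \<open>auto simp del: mem_ball_0\<close>)
    fix w :: complex and z :: "'a \<times> 'a" and d
    assume w: "cmod w = \<eta>"
    have "(\<lambda>s. f ((z + cscale w v) + cscale s d)) holomorphic_on {s. z + cscale s d \<in> ball 0 r'}"
    proof (rule gateaux_holo_line[OF f])
      fix s assume "s \<in> {s. z + cscale s d \<in> ball 0 r'}"
      then have "(z + cscale s d) + cscale w v \<in> ball 0 r" using inb w by auto
      then show "z + cscale w v + cscale s d \<in> ball 0 r" by (simp add: ac_simps)
    qed
    then show "(\<lambda>s. h (z + cscale s d) w) holomorphic_on {s. z + cscale s d \<in> ball 0 r'}"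
      unfolding h_def using w \<eta> by (auto intro!: holomorphic_intros simp: ac_simps)
  qed
  then have "gateaux_holo r' (\<lambda>z. contour_integral (circlepath 0 \<eta>) (h z) * (1 / (2 * pi * \<i>)))"
    by (intro gateaux_holo_mult) auto
  then show ?thesis
  proof (rule gateaux_holo_cong)
    fix z assume z: "z \<in> ball (0 :: 'a \<times> 'a) r'"
    have hol: "(\<lambda>s. f (z + cscale s v)) holomorphic_on cball 0 \<eta>"
      by (rule gateaux_holo_line[OF f]) (use inb[OF z] in auto)
    have "continuous_on (cball 0 \<eta>) (\<lambda>s. f (z + cscale s v))"
      "(\<lambda>s. f (z + cscale s v)) holomorphic_on ball 0 \<eta>" "0 \<in> ball (0 :: complex) \<eta>"
      using hol \<eta> by (auto intro: holomorphic_on_imp_continuous_on holomorphic_on_subset)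
    note Cauchy_has_contour_integral_higher_derivative_circlepath[OF this, of 1]
    then have "contour_integral (circlepath 0 \<eta>) (h z) = 2 * of_real pi * \<i> * dirderiv v f z"
      by (simp add: h_def dirderiv_def contour_integral_unique power2_eq_square)
    then show "contour_integral (circlepath 0 \<eta>) (h z) * (1 / (2 * pi * \<i>)) = dirderiv v f z"
      by simp
  qed
qed

section \<open>Bounds, Lipschitz estimates and minimum modulus\<close>

lemma gateaux_holo_bounded:
  fixes f :: "'a::euclidean_space \<times> 'a \<Rightarrow> complex"
  assumes "gateaux_holo r f" "r' < r"
  obtains B where "B > 0" "\<And>z. norm z \<le> r' \<Longrightarrow> cmod (f z) \<le> B"
proof -
  have "compact (f ` cball 0 r')"
    by (intro compact_continuous_image continuous_on_subset[OF gateaux_holo_cont[OF assms(1)]])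
       (use assms(2) in auto)
  then obtain B where "B > 0" "\<forall>y \<in> f ` cball 0 r'. cmod y \<le> B"
    using bounded_pos compact_imp_bounded by blast
  then show ?thesis using that by auto
qed

text \<open>Cauchy's estimate along the line in direction \<open>d\<close>: a parameter disc of
  radius \<open>(m - r') / norm d\<close> moves the point by at most \<open>m - r'\<close> and stays
  in the larger ball. Displacements \<open>cscale s d\<close> suffice, since later a base point
  moves by a real vector and a root by a complex multiple of \<open>v\<close>.\<close>

lemma gateaux_holo_Lipschitz:
  fixes f :: "'a::euclidean_space \<times> 'a \<Rightarrow> complex"
  assumes f: "gateaux_holo r f" and "r' < r"
  obtains L where "L > 0"
    "\<And>z s d. z \<in> ball 0 r' \<Longrightarrow> z + cscale s d \<in> ball 0 r' \<Longrightarrow>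
       cmod (f (z + cscale s d) - f z) \<le> L * (cmod s * norm d)"
proof -
  define m where "m = (r' + r) / 2"
  have m: "r' < m" "m < r"
    using \<open>r' < r\<close> by (auto simp: m_def)
  obtain B where B: "B > 0" "\<And>z. norm z \<le> m \<Longrightarrow> cmod (f z) \<le> B"
    using gateaux_holo_bounded[OF f m(2)] by blast
  show ?thesis
  proof (rule that)
    show "B / (m - r') > 0" using B m by simp
    fix z :: "'a \<times> 'a" and s d
    assume z: "z \<in> ball 0 r'" and zs: "z + cscale s d \<in> ball 0 r'"
    show "cmod (f (z + cscale s d) - f z) \<le> B / (m - r') * (cmod s * norm d)"
    proof (cases "d = 0")
      case True
      then have "cscale s d = 0" by (simp add: cscale_def zero_prod_def)
      then show ?thesis using True by simp
    next
      case False
      define \<rho> where "\<rho> = (m - r') / norm d"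
      have \<rho>: "\<rho> > 0" using False m by (simp add: \<rho>_def)
      define g where "g = (\<lambda>s. f (z + cscale s d))"
      define A where "A = {s. z + cscale s d \<in> ball 0 r'}"
      have inm: "norm (z + cscale w d) \<le> m" if "u \<in> A" "w \<in> cball u \<rho>" for u w
      proof -
        have "z + cscale w d = (z + cscale u d) + cscale (w - u) d"
          by (simp add: add.assoc flip: cscale_add)
        then have "norm (z + cscale w d) \<le> norm (z + cscale u d) + cmod (w - u) * norm d"
          by (metis norm_cscale norm_triangle_ineq)
        also have "cmod (w - u) * norm d \<le> \<rho> * norm d"
          using that by (intro mult_right_mono) (auto simp: dist_norm norm_minus_commute)
        also have "\<rho> * norm d = m - r'" using False by (simp add: \<rho>_def)
        finally show ?thesis using that(1) by (simp add: A_def)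
      qed
      have holg: "g holomorphic_on cball u \<rho>" if "u \<in> A" for u
        unfolding g_def by (rule gateaux_holo_line[OF f]) (use inm[OF that] m in fastforce)
      have "cmod (g s - g 0) \<le> B / \<rho> * cmod (s - 0)"
      proof (rule field_differentiable_bound)
        show "convex A" unfolding A_def by (rule convex_cscale_line)
        show "(g has_field_derivative deriv g u) (at u within A)" if "u \<in> A" for u
          using holomorphic_derivI[OF holomorphic_on_subset[OF holg[OF that] ball_subset_cball] open_ball, of u] \<rho>
          by (auto intro: has_field_derivative_at_within)
        show "cmod (deriv g u) \<le> B / \<rho>" if "u \<in> A" for u
        proof -
          have "cmod ((deriv ^^ 1) g u) \<le> fact 1 * B / \<rho> ^ 1"
          proof (rule Cauchy_inequality)
            show "g holomorphic_on ball u \<rho>" "continuous_on (cball u \<rho>) g"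
              using holg[OF that]
              by (auto intro: holomorphic_on_subset holomorphic_on_imp_continuous_on)
            show "cmod (g x) \<le> B" if "cmod (u - x) = \<rho>" for x
              unfolding g_def using inm[OF \<open>u \<in> A\<close>, of x] that by (intro B(2)) (simp add: dist_norm)
          qed (use \<rho> in auto)
          then show ?thesis by simp
        qed
        show "s \<in> A" "0 \<in> A" using z zs by (auto simp: A_def)
      qed
      then show ?thesis
        by (simp add: g_def \<rho>_def mult_ac)
    qed
  qed
qed

text \<open>Dividing \<open>f\<close> by its zeros in the disc leaves a zero-free function
  \<open>g\<close>. The maximum principle for 1/g bounds \<open>g\<close> below by \<open>c\<close>,
  because on the circle every factor of the divisor is at most 2\<delta> \<le> 1.\<close>

lemma holomorphic_min_modulus_zeros:
  assumes hol: "f holomorphic_on S" and S: "open S" "connected S" "cball 0 \<delta> \<subseteq> S"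
    and \<delta>: "0 < \<delta>" "2 * \<delta> \<le> 1" and c: "0 < c" "\<And>t. cmod t = \<delta> \<Longrightarrow> c \<le> cmod (f t)"
    and W: "W = {t. cmod t < \<delta> \<and> f t = 0}" "finite W"
    and t: "cmod t < \<delta>"
  shows "c * (\<Prod>\<rho>\<in>W. cmod (t - \<rho>) ^ nat (zorder f \<rho>)) \<le> cmod (f t)"
proof -
  have fnz: "\<exists>w\<in>S. f w \<noteq> 0"
  proof (rule bexI[of _ "of_real \<delta>"])
    show "f (of_real \<delta>) \<noteq> 0" using c(2)[of "of_real \<delta>"] c(1) \<delta>(1) by auto
    show "of_real \<delta> \<in> S" using S(3) \<delta> by auto
  qed
  have tS: "t \<in> S" using S(3) t by auto
  show ?thesis
  proof (cases "t \<in> W")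
    case True
    then have "f t = 0" using W by auto
    then have "zorder f t > 0"
      using zorder_exist_zero[OF hol S(1,2) tS] fnz by auto
    then have "(\<Prod>\<rho>\<in>W. cmod (t - \<rho>) ^ nat (zorder f \<rho>)) = 0"
      using True W by (intro prod_zero) (auto intro!: bexI[of _ t])
    then show ?thesis by simp
  next
    case False
    define P where "P = (\<lambda>A t. \<Prod>\<rho>\<in>A. (t - \<rho>) ^ nat (zorder f \<rho>))"
    \<comment> \<open>At a zero of \<open>f\<close> the quotient is continued by the value of the
      cofactor \<open>zor_poly\<close>, which fills the removable singularity.\<close>
    define g where "g = (\<lambda>t. if t \<in> W then zor_poly f t t / P (W - {t}) t else f t / P W t)"
    have Pnz: "P A t \<noteq> 0" if "finite A" "t \<notin> A" for A t
      using that by (auto simp: P_def)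
    have WS: "W \<subseteq> S" using W S by auto
    have g_at: "g field_differentiable at u" if u: "u \<in> S" for u
    proof (cases "u \<in> W")
      case True
      obtain e where e: "e > 0" "cball u e \<subseteq> S" "zor_poly f u holomorphic_on cball u e"
        "\<And>w. w \<in> cball u e \<Longrightarrow> f w = zor_poly f u w * (w - u) ^ nat (zorder f u)"
        using zorder_exist_zero[OF hol S(1,2) u] fnz by blast
      obtain e' where e': "e' > 0" "\<And>w. w \<in> W - {u} \<Longrightarrow> e' \<le> dist u w"
        using finite_set_avoid[of "W - {u}" u] W(2) by auto
      define e2 where "e2 = min e e'"
      have e2: "e2 > 0" "ball u e2 \<subseteq> cball u e" "ball u e2 \<inter> (W - {u}) = {}"
        using e e' by (auto simp: e2_def) (use e'(2) in force)
      have eq: "g w = zor_poly f u w / P (W - {u}) w" if "w \<in> ball u e2" for w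
      proof (cases "w = u")
        case True
        then show ?thesis using \<open>u \<in> W\<close> by (simp add: g_def)
      next
        case False
        then have "w \<notin> W" using that e2 by auto
        moreover have "P W w = (w - u) ^ nat (zorder f u) * P (W - {u}) w"
          unfolding P_def using W(2) \<open>u \<in> W\<close> by (rule prod.remove)
        moreover have "f w = zor_poly f u w * (w - u) ^ nat (zorder f u)"
          using e(4) e2 that by auto
        ultimately show ?thesis using False by (simp add: g_def)
      qed
      have nW: "w \<notin> W - {u}" if "w \<in> ball u e2" for w
        using e2 that by auto
      have "(\<lambda>w. zor_poly f u w / P (W - {u}) w) holomorphic_on ball u e2"
        unfolding P_def
        by (intro holomorphic_intros holomorphic_on_subset[OF e(3)])
           (use e2 W(2) Pnz nW in \<open>auto simp: P_def\<close>)
      then have "g holomorphic_on ball u e2"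
        by (rule holomorphic_transform) (simp add: eq)
      then show ?thesis
        using e2 by (auto intro: holomorphic_on_imp_differentiable_at)
    next
      case False
      have o: "open (S - W)" using S W by (auto intro: open_Diff finite_imp_closed)
      have "(\<lambda>w. f w / P W w) holomorphic_on S - W"
        using Pnz W(2) unfolding P_def
        by (intro holomorphic_intros holomorphic_on_subset[OF hol]) (auto simp: P_def)
      then have "g holomorphic_on S - W"
        by (rule holomorphic_transform) (simp add: g_def)
      then show ?thesis
        using False u o by (auto intro: holomorphic_on_imp_differentiable_at)
    qed
    have holg: "g holomorphic_on S"
      using g_at S by (simp add: holomorphic_on_open field_differentiable_def)
    have gnz: "g u \<noteq> 0" if "cmod u \<le> \<delta>" for u
    proof (cases "u \<in> W")
      case True
      then have "zor_poly f u u \<noteq> 0"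
        using zorder_exist_zero[OF hol S(1,2), of u] fnz WS
        by (metis centre_in_cball less_eq_real_def subset_eq)
      then show ?thesis using True Pnz[of "W - {u}" u] W by (simp add: g_def)
    next
      case False
      then have "f u \<noteq> 0" using c(2)[of u] c(1) W that by (cases "cmod u = \<delta>") auto
      then show ?thesis using False Pnz[of W u] W by (simp add: g_def)
    qed
    have "cmod (inverse (g t)) \<le> 1 / c"
    proof (rule maximum_modulus_frontier[of "\<lambda>u. inverse (g u)" "cball 0 \<delta>"])
      have "(\<lambda>u. inverse (g u)) holomorphic_on cball 0 \<delta>"
        by (intro holomorphic_intros holomorphic_on_subset[OF holg]) (use gnz S in auto)
      then show "(\<lambda>u. inverse (g u)) holomorphic_on interior (cball 0 \<delta>)"
        "continuous_on (closure (cball 0 \<delta>)) (\<lambda>u. inverse (g u))"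
        by (auto intro: holomorphic_on_subset holomorphic_on_imp_continuous_on)
      fix u assume "u \<in> frontier (cball 0 \<delta> :: complex set)"
      then have u: "cmod u = \<delta>" using \<delta> by (simp add: frontier_cball)
      then have uW: "u \<notin> W" using W by auto
      have "cmod (P W u) = (\<Prod>\<rho>\<in>W. cmod (u - \<rho>) ^ nat (zorder f \<rho>))"
        by (simp add: P_def norm_power flip: prod_norm)
      also have "\<dots> \<le> 1"
      proof (intro prod_le_1 conjI power_le_one)
        fix \<rho> assume "\<rho> \<in> W"
        then show "cmod (u - \<rho>) \<le> 1"
          using norm_triangle_ineq4[of u \<rho>] u \<delta> W(1) by auto
      qed auto
      finally have "cmod (P W u) * c \<le> 1 * cmod (f u)"
        using c u by (intro mult_mono) auto
      moreover have "cmod (f u) > 0" using c(1) c(2)[OF u] by linarith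
      ultimately show "cmod (inverse (g u)) \<le> 1 / c"
        using uW c(1) by (simp add: g_def norm_divide norm_inverse divide_simps mult_ac del: zero_less_norm_iff)
    qed (use t in auto)
    moreover have "f t \<noteq> 0" using False W t by auto
    ultimately have "c * cmod (P W t) \<le> cmod (f t)"
      using False c(1) by (simp add: g_def norm_divide norm_inverse field_simps)
    then show ?thesis by (simp add: P_def norm_power flip: prod_norm)
  qed
qed

section \<open>Roots along a line\<close>

text \<open>The lower bound \<open>c0\<close> holds over the whole base ball, so no root lies on the
  circle. The factor 2 leaves room around the closed disc for contour integrals, r / 2 leaves room
  for the derivative of \<open>f0\<close>, and \<delta> \<le> 1/4 makes differences of roots at most
  1 in modulus.\<close>

locale root_fibre =
  fixes f0 :: "'a::euclidean_space \<times> 'a \<Rightarrow> complex" and v :: 'a and r r1 \<delta> c0 :: real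
  assumes f0: "gateaux_holo r f0" and v: "norm v = 1"
    and \<delta>: "0 < \<delta>" "\<delta> \<le> 1/4" and r1: "0 < r1" "r1 + 2 * \<delta> \<le> r / 2"
    and c0: "0 < c0"
      "\<And>z t. z \<in> ball 0 r1 \<Longrightarrow> cmod t = \<delta> \<Longrightarrow> c0 \<le> cmod (f0 (z + cscale t v))"
begin

lemma r_pos: "0 < r" "r1 < r"
  using \<delta> r1 by auto

lemma fibre_in_half_ball: "z \<in> ball 0 r1 \<Longrightarrow> cmod t \<le> 2 * \<delta> \<Longrightarrow> z + cscale t v \<in> ball 0 (r / 2)"
  using add_cscale_in_ball[OF v, of z r1 t "2 * \<delta>" "r / 2"] r1 by simp

lemma fibre_in_ball: "z \<in> ball 0 r1 \<Longrightarrow> cmod t \<le> 2 * \<delta> \<Longrightarrow> z + cscale t v \<in> ball 0 r"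
  using fibre_in_half_ball[of z t] r_pos by simp

lemma fibre_holomorphic:
  assumes "gateaux_holo r f" "z \<in> ball 0 r1"
  shows "(\<lambda>t. f (z + cscale t v)) holomorphic_on ball 0 (2 * \<delta>)"
  by (rule gateaux_holo_line[OF assms(1)]) (use fibre_in_ball[OF assms(2)] in auto)

lemma circle_nonzero: "z \<in> ball 0 r1 \<Longrightarrow> cmod t = \<delta> \<Longrightarrow> f0 (z + cscale t v) \<noteq> 0"
  using c0(2)[of z t] c0(1) by auto

lemma finite_zeros:
  assumes z: "z \<in> ball 0 r1"
  shows "finite {t \<in> cball 0 (3/2 * \<delta>). f0 (z + cscale t v) = 0}"
proof (cases "(\<lambda>t. f0 (z + cscale t v)) constant_on ball 0 (2 * \<delta>)")
  case True
  then have "f0 (z + cscale t v) = f0 (z + cscale (of_real \<delta>) v)" if "t \<in> cball 0 (3/2 * \<delta>)" for t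
  proof -
    have "t \<in> ball 0 (2 * \<delta>)" "of_real \<delta> \<in> ball (0 :: complex) (2 * \<delta>)" using that \<delta> by auto
    then show ?thesis using True unfolding constant_on_def by metis
  qed
  moreover have "f0 (z + cscale (of_real \<delta>) v) \<noteq> 0"
    using \<delta> by (intro circle_nonzero[OF z]) auto
  ultimately have "{t \<in> cball 0 (3/2 * \<delta>). f0 (z + cscale t v) = 0} = {}"
    by auto
  then show ?thesis by (simp only: finite.emptyI)
next
  case False
  show ?thesis
    by (rule holomorphic_compact_finite_zeros[OF fibre_holomorphic[OF f0 z] _ _ _ _ False])
       (use \<delta> in auto)
qed

definition roots :: "'a \<times> 'a \<Rightarrow> complex set" where
  "roots z = {t. cmod t < \<delta> \<and> f0 (z + cscale t v) = 0}"

definition mult :: "'a \<times> 'a \<Rightarrow> complex \<Rightarrow> nat" where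
  "mult z t = nat (zorder (\<lambda>t. f0 (z + cscale t v)) t)"

lemma finite_roots: "z \<in> ball 0 r1 \<Longrightarrow> finite (roots z)"
  by (rule finite_subset[OF _ finite_zeros]) (use \<delta> in \<open>auto simp: roots_def\<close>)

lemma zorder_root_pos:
  assumes z: "z \<in> ball 0 r1" and t: "t \<in> roots z"
  shows "zorder (\<lambda>t. f0 (z + cscale t v)) t > 0"
proof -
  have "\<exists>w\<in>ball 0 (2 * \<delta>). f0 (z + cscale w v) \<noteq> 0"
    using \<delta> by (intro bexI[of _ "of_real \<delta>"] circle_nonzero[OF z]) auto
  moreover have "t \<in> ball 0 (2 * \<delta>)" and t0: "f0 (z + cscale t v) = 0"
    using t \<delta> by (auto simp: roots_def)
  ultimately show ?thesis
    using zorder_exist_zero[OF fibre_holomorphic[OF f0 z] open_ball connected_ball]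
    by (simp add: t0)
qed

lemma mult_pos: "z \<in> ball 0 r1 \<Longrightarrow> t \<in> roots z \<Longrightarrow> mult z t > 0"
  using zorder_root_pos by (simp add: mult_def)

text \<open>The argument principle with weight \<open>\<phi>\<close>. Single roots need not vary
  holomorphically where they collide, but weighted sums over all of them do, because
  \<open>z\<close> enters the integral only through the integrand.\<close>

lemma root_sum_eq_integral:
  assumes \<phi>: "gateaux_holo r \<phi>" and z: "z \<in> ball 0 r1"
  shows "contour_integral (circlepath 0 \<delta>)
      (\<lambda>t. dirderiv v f0 (z + cscale t v) * \<phi> (z + cscale t v) / f0 (z + cscale t v)) =
    2 * pi * \<i> * (\<Sum>\<rho>\<in>roots z. of_nat (mult z \<rho>) * \<phi> (z + cscale \<rho> v))"
proof -
  define g where "g = (\<lambda>t. f0 (z + cscale t v))"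
  define h where "h = (\<lambda>t. \<phi> (z + cscale t v))"
  \<comment> \<open>The open set has to contain the circle, so zeros of \<open>f0\<close> just
    outside the disc come in; their winding number is 0 and they drop out of the sum.\<close>
  define S where "S = (ball 0 (3/2 * \<delta>) :: complex set)"
  define pz where "pz = {w \<in> S. g w = 0 \<or> w \<in> {}}"
  have derivg: "deriv g t = dirderiv v f0 (z + cscale t v)" for t
    by (subst deriv_shift_0) (simp add: dirderiv_def g_def o_def cscale_add add.assoc)
  have sub: "S \<subseteq> ball 0 (2 * \<delta>)" using \<delta> by (auto simp: S_def)
  have fin: "finite pz"
    by (rule finite_subset[OF _ finite_zeros[OF z]]) (auto simp: pz_def S_def g_def)
  have rsub: "roots z \<subseteq> pz"
    using \<delta> by (auto simp: roots_def pz_def S_def g_def)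
  have "contour_integral (circlepath 0 \<delta>) (\<lambda>x. deriv g x * h x / g x) =
    2 * pi * \<i> * (\<Sum>p\<in>pz. winding_number (circlepath 0 \<delta>) p * h p * zorder g p)"
    unfolding pz_def
  proof (rule argument_principle)
    show "open S" "connected S" by (auto simp: S_def)
    show "g holomorphic_on S - {}"
      using holomorphic_on_subset[OF fibre_holomorphic[OF f0 z] sub] by (simp add: g_def)
    show "h holomorphic_on S"
      using holomorphic_on_subset[OF fibre_holomorphic[OF \<phi> z] sub] by (simp add: h_def)
    show "path_image (circlepath 0 \<delta>) \<subseteq> S - {w \<in> S. g w = 0 \<or> w \<in> {}}"
      using \<delta> circle_nonzero[OF z] by (auto simp: S_def g_def)
    show "\<forall>w. w \<notin> S \<longrightarrow> winding_number (circlepath 0 \<delta>) w = 0"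
      using \<delta> by (auto simp: S_def intro!: winding_number_zero_outside[where s = "cball 0 \<delta>"])
    show "finite {w \<in> S. g w = 0 \<or> w \<in> {}}" using fin by (simp add: pz_def)
  qed auto
  also have "(\<Sum>p\<in>pz. winding_number (circlepath 0 \<delta>) p * h p * zorder g p) =
      (\<Sum>p\<in>roots z. winding_number (circlepath 0 \<delta>) p * h p * zorder g p)"
  proof (rule sum.mono_neutral_right[OF fin rsub], rule ballI)
    fix p assume p: "p \<in> pz - roots z"
    then have "cmod p > \<delta>"
      using circle_nonzero[OF z, of p] by (cases "cmod p = \<delta>") (auto simp: pz_def roots_def g_def)
    then have "winding_number (circlepath 0 \<delta>) p = 0"
      using \<delta> by (auto intro!: winding_number_zero_outside[where s = "cball 0 \<delta>"])
    then show "winding_number (circlepath 0 \<delta>) p * h p * zorder g p = 0" by simp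
  qed
  also have "\<dots> = (\<Sum>\<rho>\<in>roots z. of_nat (mult z \<rho>) * \<phi> (z + cscale \<rho> v))"
  proof (rule sum.cong[OF refl])
    fix p assume p: "p \<in> roots z"
    then have "winding_number (circlepath 0 \<delta>) p = 1"
      by (auto simp: roots_def intro!: winding_number_circlepath)
    moreover have "of_int (zorder g p) = (of_nat (mult z p) :: complex)"
      using zorder_root_pos[OF z p] by (simp add: mult_def g_def)
    ultimately show "winding_number (circlepath 0 \<delta>) p * h p * zorder g p =
        of_nat (mult z p) * \<phi> (z + cscale p v)"
      by (simp add: h_def)
  qed
  finally show ?thesis unfolding derivg unfolding g_def h_def .
qed

lemma gateaux_holo_root_sum:
  assumes \<phi>: "gateaux_holo r \<phi>"
  shows "gateaux_holo r1 (\<lambda>z. \<Sum>\<rho>\<in>roots z. of_nat (mult z \<rho>) * \<phi> (z + cscale \<rho> v))"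
proof -
  define h where "h = (\<lambda>z t. dirderiv v f0 (z + cscale t v) * \<phi> (z + cscale t v) / f0 (z + cscale t v))"
  have d: "gateaux_holo (r / 2) (dirderiv v f0)"
    by (rule gateaux_holo_dirderiv[OF f0 _ v]) (use r_pos in auto)
  have "gateaux_holo r1 (\<lambda>z. contour_integral (circlepath 0 \<delta>) (h z))"
  proof (rule gateaux_holo_circle_integral[OF \<delta>(1)])
    have in_half: "z + cscale w v \<in> ball 0 (r/2)" if "(z, w) \<in> ball 0 r1 \<times> sphere 0 \<delta>" for z w
      using fibre_in_half_ball[of z w] that \<delta> by auto
    then have in_ball: "z + cscale w v \<in> ball 0 r" if "(z, w) \<in> ball 0 r1 \<times> sphere 0 \<delta>" for z w
      using that r_pos by fastforce
    show "continuous_on (ball 0 r1 \<times> sphere 0 \<delta>) (\<lambda>(z, w). h z w)"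
      unfolding h_def case_prod_unfold
      by (intro continuous_intros continuous_on_compose2[OF gateaux_holo_cont[OF f0]]
          continuous_on_compose2[OF gateaux_holo_cont[OF \<phi>]] continuous_on_compose2[OF gateaux_holo_cont[OF d]])
         (use in_half in_ball circle_nonzero in \<open>auto simp del: mem_ball_0\<close>)
    fix w :: complex and z :: "'a \<times> 'a" and d'
    assume w: "cmod w = \<delta>"
    let ?A = "{s. z + cscale s d' \<in> ball 0 r1}"
    have *: "(\<lambda>s. f ((z + cscale w v) + cscale s d')) holomorphic_on ?A" if "gateaux_holo (r/2) f" for f
    proof (rule gateaux_holo_line[OF that])
      fix s assume "s \<in> ?A"
      then have "(z + cscale s d') + cscale w v \<in> ball 0 (r/2)" using in_half w by auto
      then show "z + cscale w v + cscale s d' \<in> ball 0 (r/2)" by (simp add: ac_simps)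
    qed
    have f0': "gateaux_holo (r/2) f0" and \<phi>': "gateaux_holo (r/2) \<phi>"
      using f0 \<phi> r_pos by (auto intro: gateaux_holo_mono)
    have eq: "z + cscale w v + cscale s d' = z + cscale s d' + cscale w v" for s
      by (simp add: ac_simps)
    show "(\<lambda>s. h (z + cscale s d') w) holomorphic_on ?A"
      unfolding h_def
      by (intro holomorphic_on_divide holomorphic_on_mult *[OF d, unfolded eq] *[OF f0', unfolded eq]
           *[OF \<phi>', unfolded eq] circle_nonzero[OF _ w]) simp
  qed
  then have "gateaux_holo r1 (\<lambda>z. contour_integral (circlepath 0 \<delta>) (h z) * (1 / (2 * pi * \<i>)))"
    by (intro gateaux_holo_mult) auto
  then show ?thesis
    by (rule gateaux_holo_cong) (simp add: h_def root_sum_eq_integral[OF \<phi>])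
qed

text \<open>With weight 1 the argument principle counts the roots with multiplicity, and its
  integrand is at most B / c0 on the circle.\<close>

lemma mult_sum_bounded: "\<exists>D. \<forall>z\<in>ball 0 r1. (\<Sum>\<rho>\<in>roots z. mult z \<rho>) \<le> D"
proof -
  have "gateaux_holo (3/4 * r) (dirderiv v f0)"
    by (rule gateaux_holo_dirderiv[OF f0 _ v]) (use r_pos in auto)
  then obtain B where B: "B > 0" "\<And>z. norm z \<le> r / 2 \<Longrightarrow> cmod (dirderiv v f0 z) \<le> B"
    using gateaux_holo_bounded[of "3/4 * r" "dirderiv v f0" "r / 2"] r_pos by auto
  have "real (\<Sum>\<rho>\<in>roots z. mult z \<rho>) \<le> B / c0" if z: "z \<in> ball 0 r1" for z
  proof -
    let ?h = "\<lambda>t. dirderiv v f0 (z + cscale t v) * 1 / f0 (z + cscale t v)"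
    let ?n = "\<Sum>\<rho>\<in>roots z. of_nat (mult z \<rho>) :: complex"
    have I: "contour_integral (circlepath 0 \<delta>) ?h = 2 * pi * \<i> * ?n"
      using root_sum_eq_integral[OF gateaux_holo_const z, of 1] by simp
    have "norm (2 * pi * \<i> * ?n) \<le> B / c0 * (2 * pi * \<delta>)"
    proof (cases "?h contour_integrable_on circlepath 0 \<delta>")
      case True
      then have "(?h has_contour_integral (2 * pi * \<i> * ?n)) (circlepath 0 \<delta>)"
        unfolding I[symmetric] by (rule has_contour_integral_integral)
      then show ?thesis
      proof (rule has_contour_integral_bound_circlepath)
        fix t :: complex assume "cmod (t - 0) = \<delta>"
        then have t: "cmod t = \<delta>" by simp
        show "cmod (?h t) \<le> B / c0"
        proof -
          have "cmod (dirderiv v f0 (z + cscale t v)) \<le> B"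
            using B(2)[of "z + cscale t v"] fibre_in_half_ball[OF z, of t] t \<delta> by simp
          then show ?thesis
            using c0(2)[OF z t] c0(1) B(1) unfolding norm_divide mult_1_right by (intro frac_le) auto
        qed
      qed (use B c0 \<delta> in auto)
    next
      \<comment> \<open>A contour integral that does not exist is 0 by convention, so the bound
        holds trivially here.\<close>
      case False
      then show ?thesis
        unfolding I[symmetric] using not_integrable_contour_integral[OF False] B c0 \<delta> by simp
    qed
    moreover have "?n = of_nat (\<Sum>\<rho>\<in>roots z. mult z \<rho>)" by simp
    ultimately have "2 * pi * real (\<Sum>\<rho>\<in>roots z. mult z \<rho>) \<le> B / c0 * (2 * pi * \<delta>)"
      by (simp add: norm_mult del: of_nat_sum)
    then have "(2 * pi) * real (\<Sum>\<rho>\<in>roots z. mult z \<rho>) \<le> (2 * pi) * (B / c0 * \<delta>)"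
      by (simp only: mult_ac)
    then have "real (\<Sum>\<rho>\<in>roots z. mult z \<rho>) \<le> B / c0 * \<delta>"
      by (rule mult_left_le_imp_le) simp
    also have "\<dots> \<le> B / c0 * 1" using B c0 \<delta> by (intro mult_left_mono) auto
    finally show ?thesis by simp
  qed
  then have "(\<Sum>\<rho>\<in>roots z. mult z \<rho>) \<le> nat \<lfloor>B / c0\<rfloor>" if "z \<in> ball 0 r1" for z
    using le_nat_floor that by blast
  then show ?thesis by blast
qed

text \<open>Some bound valid over the whole base ball, not the exact number of roots; it serves as
  an upper estimate for multiplicities, numbers of roots and exponents.\<close>

definition deg :: nat where
  "deg = (SOME D. \<forall>z\<in>ball 0 r1. (\<Sum>\<rho>\<in>roots z. mult z \<rho>) \<le> D)"

lemma mult_sum_le_deg: "z \<in> ball 0 r1 \<Longrightarrow> (\<Sum>\<rho>\<in>roots z. mult z \<rho>) \<le> deg"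
  using someI_ex[OF mult_sum_bounded] unfolding deg_def by blast

lemma mult_le_deg: "z \<in> ball 0 r1 \<Longrightarrow> \<rho> \<in> roots z \<Longrightarrow> mult z \<rho> \<le> deg"
  using mult_sum_le_deg[of z] member_le_sum[of \<rho> "roots z" "mult z"] finite_roots[of z]
  by (meson le_trans zero_le)

lemma card_roots_le_deg:
  assumes z: "z \<in> ball 0 r1"
  shows "card (roots z) \<le> deg"
proof -
  have "card (roots z) = (\<Sum>\<rho>\<in>roots z. 1)" by simp
  also have "\<dots> \<le> (\<Sum>\<rho>\<in>roots z. mult z \<rho>)"
    using mult_pos[OF z] by (intro sum_mono) (simp add: Suc_le_eq)
  finally show ?thesis using mult_sum_le_deg[OF z] by simp
qed

text \<open>If every root had distance at least \<open>\<kappa>\<close> from \<open>t\<close>, the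
  product in the minimum modulus estimate would be at least \<open>\<kappa> ^ deg\<close>. This
  Hoelder dependence of the roots is the source of the powers in the final inequality.\<close>

lemma root_near:
  assumes z: "z \<in> ball 0 r1" and t: "cmod t < \<delta>" and \<kappa>: "0 < \<kappa>" "\<kappa> \<le> 1"
    and small: "cmod (f0 (z + cscale t v)) < c0 * \<kappa> ^ deg"
  shows "\<exists>\<rho>\<in>roots z. cmod (t - \<rho>) < \<kappa>"
proof (rule ccontr)
  assume "\<not> ?thesis"
  then have far: "\<kappa> \<le> cmod (t - \<rho>)" if "\<rho> \<in> roots z" for \<rho>
    using that by force
  have "\<kappa> ^ deg \<le> \<kappa> ^ (\<Sum>\<rho>\<in>roots z. mult z \<rho>)"
    using mult_sum_le_deg[OF z] \<kappa> by (intro power_decreasing) auto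
  also have "\<dots> = (\<Prod>\<rho>\<in>roots z. \<kappa> ^ mult z \<rho>)" by (simp add: power_sum)
  also have "\<dots> \<le> (\<Prod>\<rho>\<in>roots z. cmod (t - \<rho>) ^ mult z \<rho>)"
    using far \<kappa> by (intro prod_mono) (auto intro!: power_mono)
  finally have "c0 * \<kappa> ^ deg \<le> c0 * (\<Prod>\<rho>\<in>roots z. cmod (t - \<rho>) ^ mult z \<rho>)"
    using c0 by simp
  also have "\<dots> \<le> cmod (f0 (z + cscale t v))"
    unfolding mult_def
    by (rule holomorphic_min_modulus_zeros[OF fibre_holomorphic[OF f0 z] _ _ _ _ _ c0(1) c0(2)[OF z]])
       (use \<delta> t finite_roots[OF z] in \<open>auto simp: roots_def\<close>)
  finally show False using small by simp
qed

text \<open>The differences \<open>\<rho> a - \<rho> b\<close> are differences of values of the linear function \<open>ccoord v\<close>, so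
  each of them can be absorbed into the weights \<open>\<phi>\<close>.\<close>

definition tuple_sum ::
  "nat \<Rightarrow> (nat \<Rightarrow> 'a \<times> 'a \<Rightarrow> complex) \<Rightarrow> (nat \<times> nat) set \<Rightarrow> 'a \<times> 'a \<Rightarrow> complex" where
  "tuple_sum t \<phi> L z = (\<Sum>\<rho> \<in> {..<t} \<rightarrow>\<^sub>E roots z.
     (\<Prod>a<t. of_nat (mult z (\<rho> a)) * \<phi> a (z + cscale (\<rho> a) v)) * (\<Prod>p\<in>L. \<rho> (fst p) - \<rho> (snd p)))"

lemma gateaux_holo_tuple_sum:
  assumes "finite L" "L \<subseteq> {..<t} \<times> {..<t}" "\<And>a. a < t \<Longrightarrow> gateaux_holo r (\<phi> a)"
  shows "gateaux_holo r1 (tuple_sum t \<phi> L)"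
  using assms
proof (induction L arbitrary: \<phi> rule: finite_induct)
  case empty
  have "gateaux_holo r1 (\<lambda>z. \<Prod>a<t. \<Sum>\<rho>\<in>roots z. of_nat (mult z \<rho>) * \<phi> a (z + cscale \<rho> v))"
    using empty by (intro gateaux_holo_prod gateaux_holo_root_sum) auto
  then show ?case
    by (rule gateaux_holo_cong) (simp add: tuple_sum_def prod_sum_PiE finite_roots)
next
  case (insert p L)
  obtain a b where p: "p = (a, b)" by (cases p)
  have ab: "a < t" "b < t" using insert.prems p by auto
  \<comment> \<open>At \<open>z + cscale \<rho> v\<close> the function \<open>ccoord v\<close>
    equals \<open>ccoord v z + \<rho>\<close>, since \<open>v\<close> is a unit vector. The base
    value \<open>ccoord v z\<close> cancels in the difference of the two sums.\<close>
  define \<psi> where "\<psi> = (\<lambda>c. \<phi>(c := \<lambda>z. \<phi> c z * ccoord v z))"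
  have hol: "gateaux_holo r1 (tuple_sum t (\<psi> c) L)" if "c < t" for c
    using insert.prems that
    by (intro insert.IH) (auto simp: \<psi>_def intro!: gateaux_holo_mult gateaux_holo_ccoord)
  have vv: "v \<bullet> v = 1" using v by (simp add: norm_eq_1)
  have pr: "(\<Prod>i<t. of_nat (mult z (\<rho> i)) * \<psi> c i (z + cscale (\<rho> i) v)) =
      ccoord v (z + cscale (\<rho> c) v) * (\<Prod>i<t. of_nat (mult z (\<rho> i)) * \<phi> i (z + cscale (\<rho> i) v))"
    if "c < t" for c z \<rho>
    using that by (subst (1 2) prod.remove[of _ c]) (auto simp: \<psi>_def intro!: prod.cong)
  have "tuple_sum t \<phi> (insert p L) z = tuple_sum t (\<psi> a) L z - tuple_sum t (\<psi> b) L z" for z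
    unfolding tuple_sum_def sum_subtractf[symmetric]
    by (rule sum.cong[OF refl])
       (use ab insert.hyps in \<open>simp add: pr p ccoord_add_cscale vv algebra_simps\<close>)
  then show ?case using gateaux_holo_diff[OF hol[OF ab(1)] hol[OF ab(2)]] by presburger
qed

end

section \<open>Generalized discriminants\<close>

text \<open>A single member of \<open>G\<close> may vanish at some of the bad roots. A linear
  combination can be nonzero at all of them at once, so a discriminant gets by with one weight
  \<open>\<phi>\<close>.\<close>

inductive_set lincomb :: "('a \<Rightarrow> complex) set \<Rightarrow> ('a \<Rightarrow> complex) set" for G where
  zero: "(\<lambda>z. 0) \<in> lincomb G"
| add: "\<phi> \<in> lincomb G \<Longrightarrow> f \<in> G \<Longrightarrow> (\<lambda>z. \<phi> z + c * f z) \<in> lincomb G"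

lemma gateaux_holo_lincomb:
  "\<phi> \<in> lincomb G \<Longrightarrow> (\<And>f. f \<in> G \<Longrightarrow> gateaux_holo r f) \<Longrightarrow> gateaux_holo r \<phi>"
  by (induction rule: lincomb.induct) (auto intro!: gateaux_holo_add gateaux_holo_mult)

lemma lincomb_eq_0: "\<phi> \<in> lincomb G \<Longrightarrow> (\<And>f. f \<in> G \<Longrightarrow> f z = 0) \<Longrightarrow> \<phi> z = 0"
  by (induction rule: lincomb.induct) auto

lemma lincomb_bound:
  assumes "\<phi> \<in> lincomb G"
  shows "\<exists>J C. finite J \<and> J \<subseteq> G \<and> 1 \<le> C \<and>
    (\<forall>z e. 0 \<le> e \<longrightarrow> (\<forall>f\<in>J. cmod (f z) \<le> e) \<longrightarrow> cmod (\<phi> z) \<le> C * e)"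
  using assms
proof (induction rule: lincomb.induct)
  case zero
  show ?case by (rule exI[of _ "{}"], rule exI[of _ 1]) auto
next
  case (add \<phi> f c)
  then obtain J C where J: "finite J" "J \<subseteq> G" "1 \<le> C"
    "\<And>z e. 0 \<le> e \<Longrightarrow> (\<forall>f\<in>J. cmod (f z) \<le> e) \<Longrightarrow> cmod (\<phi> z) \<le> C * e" by blast
  have "cmod (\<phi> z + c * f z) \<le> (C + cmod c) * e"
    if "0 \<le> e" "\<forall>g\<in>insert f J. cmod (g z) \<le> e" for z e
  proof -
    have "cmod (c * f z) \<le> cmod c * e"
      using that by (simp add: norm_mult mult_left_mono)
    then show ?thesis
      using J(4)[OF that(1), of z] that norm_triangle_ineq[of "\<phi> z" "c * f z"]
      by (simp add: algebra_simps)
  qed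
  then show ?case
    using J add.hyps by (intro exI[of _ "insert f J"] exI[of _ "C + cmod c"])
      (auto intro: add_increasing2)
qed

lemma lincomb_nonzero:
  assumes "finite N" "\<And>n. n \<in> N \<Longrightarrow> \<exists>f\<in>G. f n \<noteq> 0"
  shows "\<exists>\<phi>\<in>lincomb G. \<forall>n\<in>N. \<phi> n \<noteq> 0"
  using assms
proof (induction N rule: finite_induct)
  case empty
  show ?case using lincomb.zero by auto
next
  case (insert n N)
  then obtain \<phi> where \<phi>: "\<phi> \<in> lincomb G" "\<forall>n\<in>N. \<phi> n \<noteq> 0" by auto
  obtain f where f: "f \<in> G" "f n \<noteq> 0" using insert.prems by auto
  \<comment> \<open>Each point excludes one coefficient. Where \<open>f m = 0\<close>, division by
    zero merely excludes 0; such a point lies in \<open>N\<close>, and \<open>\<phi>\<close> is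
    already nonzero there.\<close>
  have "finite ((\<lambda>m. - \<phi> m / f m) ` insert n N)" using insert.hyps by simp
  then obtain c where c: "c \<notin> (\<lambda>m. - \<phi> m / f m) ` insert n N"
    using ex_new_if_finite[OF infinite_UNIV_char_0] by blast
  have "\<phi> m + c * f m \<noteq> 0" if m: "m \<in> insert n N" for m
  proof (cases "f m = 0")
    case True
    then show ?thesis using m f \<phi>(2) by auto
  next
    case False
    show ?thesis
    proof
      assume "\<phi> m + c * f m = 0"
      then have "c * f m = - \<phi> m" by (simp add: eq_neg_iff_add_eq_0 add.commute)
      then have "c = - \<phi> m / f m" using False by (metis nonzero_eq_divide_eq)
      then show False using c m by blast
    qed
  qed
  then show ?case
    by (intro bexI[of _ "\<lambda>z. \<phi> z + c * f z"] ballI lincomb.add[OF \<phi>(1) f(1)]) simp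
qed

text \<open>Applied to the roots with the bad ones first, this supplies at least one tuple that
  survives in the discriminant.\<close>

lemma ex_bij_betw_subset:
  fixes A B :: "'a set"
  assumes "finite A" "B \<subseteq> A"
  shows "\<exists>h. bij_betw h {..<card A} A \<and> h ` {..<card B} = B"
proof -
  have fB: "finite B" using assms finite_subset by blast
  have le: "card B \<le> card A" using assms card_mono by blast
  obtain h1 where h1: "bij_betw h1 {..<card B} B"
    using ex_bij_betw_nat_finite[OF fB] by (auto simp: lessThan_atLeast0)
  have "card {card B..<card A} = card (A - B)"
    using assms fB by (simp add: card_Diff_subset)
  then obtain h2 where h2: "bij_betw h2 {card B..<card A} (A - B)"
    using finite_same_card_bij[of "{card B..<card A}" "A - B"] assms by auto
  define h where "h = (\<lambda>i. if i < card B then h1 i else h2 i)"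
  have "bij_betw h {..<card B} B"
    using h1 bij_betw_cong[of "{..<card B}" h h1 "B"] by (simp add: h_def)
  moreover have "bij_betw h {card B..<card A} (A - B)"
    using h2 bij_betw_cong[of "{card B..<card A}" h h2 "(A - B)"] by (simp add: h_def)
  ultimately have "bij_betw h ({..<card B} \<union> {card B..<card A}) (B \<union> (A - B))"
    by (rule bij_betw_combine) auto
  moreover have "{..<card B} \<union> {card B..<card A} = {..<card A}" "B \<union> (A - B) = A"
    using le assms by auto
  ultimately show ?thesis using bij_betw_imp_surj_on[OF \<open>bij_betw h {..<card B} B\<close>]
    by (intro exI[of _ h] conjI) simp_all
qed

text \<open>Pairs are taken in both orders, so the product is invariant under permutations. A
  Vandermonde product would change sign, and the enumerations of the same roots could cancel in the
  sum over tuples.\<close>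

definition offdiag :: "nat \<Rightarrow> (nat \<times> nat) set" where
  "offdiag t = {p \<in> {..<t} \<times> {..<t}. fst p \<noteq> snd p}"

lemma finite_offdiag [simp]: "finite (offdiag t)"
  by (simp add: offdiag_def)

lemma prod_offdiag_eq_0:
  fixes \<rho> :: "nat \<Rightarrow> complex"
  assumes "\<not> inj_on \<rho> {..<t}"
  shows "(\<Prod>p\<in>offdiag t. \<rho> (fst p) - \<rho> (snd p)) = 0"
proof -
  obtain a b where "a < t" "b < t" "a \<noteq> b" "\<rho> a = \<rho> b"
    using assms by (auto simp: inj_on_def)
  then show ?thesis
    by (intro prod_zero[OF finite_offdiag] bexI[of _ "(a, b)"]) (auto simp: offdiag_def)
qed

lemma prod_offdiag_bij:
  fixes \<rho> :: "nat \<Rightarrow> complex"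
  assumes "bij_betw \<rho> {..<t} A"
  shows "(\<Prod>p\<in>offdiag t. \<rho> (fst p) - \<rho> (snd p)) = (\<Prod>p\<in>{p \<in> A \<times> A. fst p \<noteq> snd p}. fst p - snd p)"
proof -
  have inj: "inj_on \<rho> {..<t}" and im: "\<rho> ` {..<t} = A"
    using assms by (auto simp: bij_betw_def)
  have "bij_betw (map_prod \<rho> \<rho>) (offdiag t) {p \<in> A \<times> A. fst p \<noteq> snd p}"
    unfolding bij_betw_def
  proof
    show "inj_on (map_prod \<rho> \<rho>) (offdiag t)"
      by (rule inj_on_subset[OF map_prod_inj_on[OF inj inj]]) (simp add: offdiag_def subset_iff)
    have "map_prod \<rho> \<rho> p \<in> {p \<in> A \<times> A. fst p \<noteq> snd p}" if p: "p \<in> offdiag t" for p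
    proof -
      have *: "fst p \<in> {..<t}" "snd p \<in> {..<t}" "fst p \<noteq> snd p"
        using p by (simp_all add: offdiag_def mem_Times_iff)
      then have "\<rho> (fst p) \<noteq> \<rho> (snd p)" using inj_on_eq_iff[OF inj] by simp
      then show ?thesis using * im by (simp add: mem_Times_iff imageI[of _ "{..<t}" \<rho>, unfolded im])
    qed
    then have sub: "map_prod \<rho> \<rho> ` offdiag t \<subseteq> {p \<in> A \<times> A. fst p \<noteq> snd p}"
      by (rule image_subsetI)
    have sup: "(x, y) \<in> map_prod \<rho> \<rho> ` offdiag t" if xy: "x \<in> A" "y \<in> A" "x \<noteq> y" for x y
    proof -
      have "x \<in> \<rho> ` {..<t}" "y \<in> \<rho> ` {..<t}" using xy by (simp_all only: im)
      then obtain a b where "a < t" "b < t" "x = \<rho> a" "y = \<rho> b"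
        by (elim imageE) simp
      then show ?thesis using xy
        by (intro image_eqI[of _ _ "(a, b)"]) (simp_all only: offdiag_def map_prod_simp mem_Collect_eq
            mem_Times_iff fst_conv snd_conv lessThan_iff simp_thms, blast)
    qed
    have "p \<in> map_prod \<rho> \<rho> ` offdiag t" if "p \<in> {p \<in> A \<times> A. fst p \<noteq> snd p}" for p
      using sup[of "fst p" "snd p"] that unfolding prod.collapse mem_Collect_eq mem_Times_iff by blast
    then show "map_prod \<rho> \<rho> ` offdiag t = {p \<in> A \<times> A. fst p \<noteq> snd p}"
      by (intro subset_antisym sub subsetI)
  qed
  then have "(\<Prod>p\<in>offdiag t. fst (map_prod \<rho> \<rho> p) - snd (map_prod \<rho> \<rho> p)) =
      (\<Prod>p\<in>{p \<in> A \<times> A. fst p \<noteq> snd p}. fst p - snd p)"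
    by (rule prod.reindex_bij_betw)
  then show ?thesis by (simp only: fst_map_prod snd_map_prod)
qed

lemma norm_prod_offdiag_le:
  fixes \<rho> :: "nat \<Rightarrow> complex"
  assumes "\<And>a b. a < t \<Longrightarrow> b < t \<Longrightarrow> cmod (\<rho> a - \<rho> b) \<le> 1"
  shows "cmod (\<Prod>p\<in>offdiag t. \<rho> (fst p) - \<rho> (snd p)) \<le> 1"
    and "a < t \<Longrightarrow> b < t \<Longrightarrow> a \<noteq> b \<Longrightarrow>
      cmod (\<Prod>p\<in>offdiag t. \<rho> (fst p) - \<rho> (snd p)) \<le> cmod (\<rho> a - \<rho> b)"
proof -
  have le: "(\<Prod>p\<in>L. cmod (\<rho> (fst p) - \<rho> (snd p))) \<le> 1" if "L \<subseteq> offdiag t" for L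
    using that by (intro prod_le_1) (auto simp: offdiag_def intro!: assms)
  show "cmod (\<Prod>p\<in>offdiag t. \<rho> (fst p) - \<rho> (snd p)) \<le> 1"
    using le[of "offdiag t"] by (simp flip: prod_norm)
  assume "a < t" "b < t" "a \<noteq> b"
  then have "(a, b) \<in> offdiag t" by (auto simp: offdiag_def)
  then have "(\<Prod>p\<in>offdiag t. cmod (\<rho> (fst p) - \<rho> (snd p))) =
      cmod (\<rho> a - \<rho> b) * (\<Prod>p\<in>offdiag t - {(a, b)}. cmod (\<rho> (fst p) - \<rho> (snd p)))"
    by (simp add: prod.remove[of "offdiag t" "(a, b)"])
  also have "\<dots> \<le> cmod (\<rho> a - \<rho> b) * 1"
    by (intro mult_left_mono le) auto
  finally show "cmod (\<Prod>p\<in>offdiag t. \<rho> (fst p) - \<rho> (snd p)) \<le> cmod (\<rho> a - \<rho> b)"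
    by (simp flip: prod_norm)
qed

section \<open>Discriminants that detect the numbers of roots and bad roots\<close>

context root_fibre begin

text \<open>With \<open>t\<close> roots, \<open>k\<close> of which are not zeros of \<open>\<phi>\<close>, this is up to a nonzero factor the
  discriminant of the roots times the product of the nonzero values of \<open>\<phi>\<close> (lemma \<open>discr_nonzero\<close>);
  it vanishes when there are fewer roots, or equally many roots but fewer nonzero values.\<close>

definition discr :: "nat \<Rightarrow> nat \<Rightarrow> ('a \<times> 'a \<Rightarrow> complex) \<Rightarrow> 'a \<times> 'a \<Rightarrow> complex" where
  "discr t k \<phi> = tuple_sum t (\<lambda>a. if a < k then \<phi> else (\<lambda>_. 1)) (offdiag t)"

lemma gateaux_holo_discr: "gateaux_holo r \<phi> \<Longrightarrow> gateaux_holo r1 (discr t k \<phi>)"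
  unfolding discr_def by (rule gateaux_holo_tuple_sum) (auto simp: offdiag_def)

lemma discr_eq:
  assumes "k \<le> t"
  shows "discr t k \<phi> z = (\<Sum>\<rho> \<in> {..<t} \<rightarrow>\<^sub>E roots z.
    (\<Prod>a<t. of_nat (mult z (\<rho> a))) * (\<Prod>a<k. \<phi> (z + cscale (\<rho> a) v)) *
    (\<Prod>p\<in>offdiag t. \<rho> (fst p) - \<rho> (snd p)))"
proof -
  have "(\<Prod>a<t. (if a < k then \<phi> else (\<lambda>_. 1)) (z + cscale (\<rho> a) v)) = (\<Prod>a<k. \<phi> (z + cscale (\<rho> a) v))" for \<rho>
    using assms by (intro prod.mono_neutral_cong_right) auto
  then show ?thesis
    by (simp add: discr_def tuple_sum_def prod.distrib)
qed

definition bad_roots :: "('a \<times> 'a \<Rightarrow> complex) set \<Rightarrow> 'a \<times> 'a \<Rightarrow> complex set" where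
  "bad_roots G z = {\<rho> \<in> roots z. \<exists>f\<in>G. f (z + cscale \<rho> v) \<noteq> 0}"

text \<open>The lexicographic order on (number of roots, number of bad roots), both at most \<open>deg\<close>, coded as a
  single number.\<close>

definition root_rank :: "('a \<times> 'a \<Rightarrow> complex) set \<Rightarrow> 'a \<times> 'a \<Rightarrow> nat" where
  "root_rank G z = card (roots z) * (deg + 1) + card (bad_roots G z)"

lemma bad_roots_subset: "bad_roots G z \<subseteq> roots z"
  by (auto simp: bad_roots_def)

lemma finite_bad_roots: "z \<in> ball 0 r1 \<Longrightarrow> finite (bad_roots G z)"
  using finite_roots finite_subset[OF bad_roots_subset] by blast

lemma card_bad_le: "z \<in> ball 0 r1 \<Longrightarrow> card (bad_roots G z) \<le> card (roots z)"
  by (intro card_mono finite_roots bad_roots_subset)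

lemma discr_term_eq_0:
  assumes \<phi>: "\<phi> \<in> lincomb G" and \<rho>: "\<rho> \<in> {..<t} \<rightarrow>\<^sub>E roots z" and "k \<le> t"
    and "\<not> (inj_on \<rho> {..<t} \<and> \<rho> ` {..<k} \<subseteq> bad_roots G z)"
  shows "(\<Prod>a<k. \<phi> (z + cscale (\<rho> a) v)) = 0 \<or> (\<Prod>p\<in>offdiag t. \<rho> (fst p) - \<rho> (snd p)) = 0"
proof (cases "inj_on \<rho> {..<t}")
  case True
  then obtain a where a: "a < k" "\<rho> a \<notin> bad_roots G z" using assms(4) by auto
  have "\<phi> (z + cscale (\<rho> a) v) = 0"
    using \<rho> a \<open>k \<le> t\<close> by (intro lincomb_eq_0[OF \<phi>]) (auto simp: bad_roots_def PiE_iff)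
  then show ?thesis using a by (intro disjI1 prod_zero) auto
qed (simp add: prod_offdiag_eq_0)

lemma discr_term_bij:
  assumes z: "z \<in> ball 0 r1" and "\<rho> \<in> {..<t} \<rightarrow>\<^sub>E roots z" and t: "t = card (roots z)"
    and k: "k = card (bad_roots G z)" and inj: "inj_on \<rho> {..<t}" and sub: "\<rho> ` {..<k} \<subseteq> bad_roots G z"
  shows "bij_betw \<rho> {..<t} (roots z)" "bij_betw \<rho> {..<k} (bad_roots G z)"
proof -
  have sub': "\<rho> ` {..<t} \<subseteq> roots z" using assms(2) by auto
  have "\<rho> ` {..<t} = roots z"
    by (rule card_subset_eq[OF finite_roots[OF z] sub']) (simp only: card_image[OF inj] card_lessThan t[symmetric])
  then show "bij_betw \<rho> {..<t} (roots z)" using inj by (simp add: bij_betw_def)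
  have injk: "inj_on \<rho> {..<k}"
    using card_bad_le[OF z, of G] by (intro inj_on_subset[OF inj]) (simp add: t k)
  have "\<rho> ` {..<k} = bad_roots G z"
    by (rule card_subset_eq[OF finite_bad_roots[OF z] sub]) (simp only: card_image[OF injk] card_lessThan k[symmetric])
  then show "bij_betw \<rho> {..<k} (bad_roots G z)" using injk by (simp add: bij_betw_def)
qed

lemma discr_eq_0:
  assumes z: "z \<in> ball 0 r1" and \<phi>: "\<phi> \<in> lincomb G" and tk: "k \<le> t" "t \<le> deg"
    and gt: "root_rank G z < t * (deg + 1) + k"
  shows "discr t k \<phi> z = 0"
  unfolding discr_eq[OF tk(1)]
proof (rule sum.neutral, rule ballI)
  fix \<rho> assume \<rho>: "\<rho> \<in> {..<t} \<rightarrow>\<^sub>E roots z"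
  show "(\<Prod>a<t. of_nat (mult z (\<rho> a))) * (\<Prod>a<k. \<phi> (z + cscale (\<rho> a) v)) *
    (\<Prod>p\<in>offdiag t. \<rho> (fst p) - \<rho> (snd p)) = 0"
  proof (cases "inj_on \<rho> {..<t}")
    case False
    then show ?thesis by (simp add: prod_offdiag_eq_0)
  next
    case True
    have "card {..<t} \<le> card (roots z)"
      by (rule card_inj_on_le[OF True _ finite_roots[OF z]]) (use \<rho> in auto)
    then have "t \<le> card (roots z)" by simp
    \<comment> \<open>Since k \<le> t \<le> deg, one more root outweighs any number of bad roots in
      the code.\<close>
    moreover have "\<not> t < card (roots z)"
    proof
      assume "t < card (roots z)"
      then have "(t + 1) * (deg + 1) \<le> card (roots z) * (deg + 1)" by (intro mult_le_mono1) simp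
      then show False using gt tk by (simp add: root_rank_def)
    qed
    ultimately have "card (bad_roots G z) < k" using gt by (simp add: root_rank_def)
    moreover have "card {..<k} \<le> card (bad_roots G z)" if "\<rho> ` {..<k} \<subseteq> bad_roots G z"
      by (rule card_inj_on_le[OF _ that finite_bad_roots[OF z]]) (use True tk in \<open>auto intro: inj_on_subset\<close>)
    ultimately have "\<not> \<rho> ` {..<k} \<subseteq> bad_roots G z" by (metis card_lessThan not_le)
    then show ?thesis using discr_term_eq_0[OF \<phi> \<rho> tk(1)] by auto
  qed
qed

text \<open>The surviving tuples enumerate the roots with the bad ones first, and each contributes
  the same number \<open>K\<close>. The sum is therefore \<open>card X\<close> times
  \<open>K\<close>, and nothing cancels; \<open>K\<close> is nonzero because \<open>\<phi>\<close>
  vanishes at no bad root.\<close>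

lemma discr_nonzero:
  assumes z: "z \<in> ball 0 r1"
  shows "\<exists>\<phi>\<in>lincomb G. discr (card (roots z)) (card (bad_roots G z)) \<phi> z \<noteq> 0"
proof -
  define t k where "t = card (roots z)" and "k = card (bad_roots G z)"
  have kt: "k \<le> t" using card_bad_le[OF z] by (simp add: t_def k_def)
  have "\<exists>f\<in>G. f n \<noteq> 0" if "n \<in> (\<lambda>\<rho>. z + cscale \<rho> v) ` bad_roots G z" for n
    using that by (auto simp: bad_roots_def)
  then obtain \<phi> where \<phi>: "\<phi> \<in> lincomb G" "\<forall>n \<in> (\<lambda>\<rho>. z + cscale \<rho> v) ` bad_roots G z. \<phi> n \<noteq> 0"
    using lincomb_nonzero[OF finite_imageI[OF finite_bad_roots[OF z]]] by blast
  define X where "X = {\<rho> \<in> {..<t} \<rightarrow>\<^sub>E roots z. inj_on \<rho> {..<t} \<and> \<rho> ` {..<k} \<subseteq> bad_roots G z}"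
  define K where "K = (\<Prod>u\<in>roots z. of_nat (mult z u)) * (\<Prod>u\<in>bad_roots G z. \<phi> (z + cscale u v)) *
    (\<Prod>p\<in>{p \<in> roots z \<times> roots z. fst p \<noteq> snd p}. fst p - snd p)"
  have fin: "finite ({..<t} \<rightarrow>\<^sub>E roots z)" using finite_roots[OF z] by (intro finite_PiE) auto
  have "discr t k \<phi> z = (\<Sum>\<rho>\<in>X. (\<Prod>a<t. of_nat (mult z (\<rho> a))) * (\<Prod>a<k. \<phi> (z + cscale (\<rho> a) v)) *
    (\<Prod>p\<in>offdiag t. \<rho> (fst p) - \<rho> (snd p)))"
    unfolding discr_eq[OF kt]
  proof (rule sum.mono_neutral_right[OF fin], goal_cases)
    case 2
    show ?case
    proof
      fix \<rho> assume \<rho>: "\<rho> \<in> ({..<t} \<rightarrow>\<^sub>E roots z) - X"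
      show "(\<Prod>a<t. of_nat (mult z (\<rho> a))) * (\<Prod>a<k. \<phi> (z + cscale (\<rho> a) v)) *
        (\<Prod>p\<in>offdiag t. \<rho> (fst p) - \<rho> (snd p)) = 0"
        using discr_term_eq_0[OF \<phi>(1) _ kt, of \<rho> z] \<rho> by (auto simp: X_def)
    qed
  qed (auto simp: X_def)
  also have "\<dots> = (\<Sum>\<rho>\<in>X. K)"
  proof (rule sum.cong[OF refl])
    fix \<rho> assume \<rho>: "\<rho> \<in> X"
    then have "\<rho> \<in> {..<t} \<rightarrow>\<^sub>E roots z" "inj_on \<rho> {..<t}" "\<rho> ` {..<k} \<subseteq> bad_roots G z"
      by (auto simp: X_def)
    note b1 = discr_term_bij(1)[OF z this(1) t_def k_def this(2,3)]
      and b2 = discr_term_bij(2)[OF z this(1) t_def k_def this(2,3)]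
    show "(\<Prod>a<t. of_nat (mult z (\<rho> a))) * (\<Prod>a<k. \<phi> (z + cscale (\<rho> a) v)) *
        (\<Prod>p\<in>offdiag t. \<rho> (fst p) - \<rho> (snd p)) = K"
      unfolding K_def prod_offdiag_bij[OF b1]
      using prod.reindex_bij_betw[OF b1, of "\<lambda>u. of_nat (mult z u) :: complex"]
        prod.reindex_bij_betw[OF b2, of "\<lambda>u. \<phi> (z + cscale u v)"] by simp
  qed
  also have "\<dots> = of_nat (card X) * K" by simp
  finally have eq: "discr t k \<phi> z = of_nat (card X) * K" .
  have "K \<noteq> 0"
    using finite_roots[OF z] finite_bad_roots[OF z, of G] mult_pos[OF z] \<phi>(2) by (auto simp: K_def)
  moreover have "card X \<noteq> 0"
  proof -
    obtain h where h: "bij_betw h {..<t} (roots z)" "h ` {..<k} = bad_roots G z"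
      using ex_bij_betw_subset[OF finite_roots[OF z] bad_roots_subset[of G z]] by (auto simp: t_def k_def)
    have "restrict h {..<t} \<in> X"
      using h kt by (auto simp: X_def bij_betw_def inj_on_def image_subset_iff)
    moreover have "finite X" by (rule finite_subset[OF _ fin]) (auto simp: X_def)
    ultimately show ?thesis by auto
  qed
  ultimately show ?thesis
    using eq unfolding t_def k_def by (intro bexI[OF _ \<phi>(1)]) simp
qed

text \<open>In every surviving tuple some factor is at most \<open>\<eta>\<close>: either
  \<open>\<rho>0\<close> occupies one of the first \<open>k\<close> slots and contributes its value
  of \<open>\<phi>\<close>, or \<open>\<rho>0\<close> and its conjugate both occur and contribute
  their difference. The other factors are bounded, and there are at most \<open>deg ^ deg\<close>
  tuples.\<close>

lemma discr_small:
  assumes z: "z \<in> ball 0 r1" and \<phi>: "\<phi> \<in> lincomb G" and tk: "k \<le> t" "t \<le> deg"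
    and eq: "root_rank G z = t * (deg + 1) + k"
    and \<rho>0: "\<rho>0 \<in> roots z"
    and B: "1 \<le> B" "\<And>\<rho>. \<rho> \<in> roots z \<Longrightarrow> cmod (\<phi> (z + cscale \<rho> v)) \<le> B"
    and small: "\<rho>0 \<in> bad_roots G z \<and> cmod (\<phi> (z + cscale \<rho>0 v)) \<le> \<eta> \<or>
      cnj \<rho>0 \<in> roots z \<and> Im \<rho>0 \<noteq> 0 \<and> 2 * \<bar>Im \<rho>0\<bar> \<le> \<eta>"
  shows "cmod (discr t k \<phi> z) \<le> real deg ^ deg * (real deg ^ deg * (B ^ deg * \<eta>))"
proof -
  have \<eta>: "0 \<le> \<eta>" using small by (smt (verit) norm_ge_zero)
  \<comment> \<open>Both numbers of bad roots are below \<open>deg + 1\<close>, so quotient and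
    remainder recover the pair from its code.\<close>
  have tc: "t = card (roots z)" "k = card (bad_roots G z)"
  proof -
    have "card (bad_roots G z) < deg + 1" "k < deg + 1"
      using card_bad_le[OF z, of G] card_roots_le_deg[OF z] tk by auto
    moreover have "card (roots z) * (deg + 1) + card (bad_roots G z) = t * (deg + 1) + k"
      using eq by (simp add: root_rank_def)
    moreover have "(a * (deg + 1) + b) div (deg + 1) = a" "(a * (deg + 1) + b) mod (deg + 1) = b"
      if "b < deg + 1" for a b
      using that by (simp_all only: div_mult_self3 mod_mult_self3 mod_less div_less add_0_right Suc_not_Zero
          add_is_0 one_neq_zero simp_thms)
    ultimately show "t = card (roots z)" "k = card (bad_roots G z)"
      by metis+
  qed
  have deg1: "1 \<le> real deg"
    using mult_le_deg[OF z \<rho>0] mult_pos[OF z \<rho>0] by simp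
  have B0: "0 \<le> B" using B by simp
  have "cmod (discr t k \<phi> z) \<le> (\<Sum>\<rho> \<in> {..<t} \<rightarrow>\<^sub>E roots z. real deg ^ deg * (B ^ deg * \<eta>))"
    unfolding discr_eq[OF tk(1)]
  proof (rule sum_norm_le)
    fix \<rho> assume \<rho>: "\<rho> \<in> {..<t} \<rightarrow>\<^sub>E roots z"
    let ?M = "\<Prod>a<t. of_nat (mult z (\<rho> a)) :: complex"
    let ?P = "\<Prod>a<k. \<phi> (z + cscale (\<rho> a) v)"
    let ?V = "\<Prod>p\<in>offdiag t. \<rho> (fst p) - \<rho> (snd p)"
    have \<rho>r: "\<rho> a \<in> roots z" if "a < t" for a using \<rho> that by auto
    have diff: "cmod (\<rho> a - \<rho> b) \<le> 1" if "a < t" "b < t" for a b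
      using \<rho>r[OF that(1)] \<rho>r[OF that(2)] norm_triangle_ineq4[of "\<rho> a" "\<rho> b"] \<delta> by (auto simp: roots_def)
    have "cmod ?M = (\<Prod>a<t. real (mult z (\<rho> a)))" by (simp flip: prod_norm)
    also have "\<dots> \<le> (\<Prod>a<t. real deg)"
      using mult_le_deg[OF z \<rho>r] by (intro prod_mono) auto
    also have "\<dots> \<le> real deg ^ deg" using deg1 tk by (simp add: power_increasing)
    finally have M: "cmod ?M \<le> real deg ^ deg" .
    have Pl: "(\<Prod>a\<in>A. cmod (\<phi> (z + cscale (\<rho> a) v))) \<le> B ^ deg" if "A \<subseteq> {..<k}" for A
    proof -
      have "(\<Prod>a\<in>A. cmod (\<phi> (z + cscale (\<rho> a) v))) \<le> (\<Prod>a\<in>A. B)"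
        using that tk by (intro prod_mono) (auto intro!: B(2) \<rho>r)
      also have "\<dots> \<le> B ^ deg"
      proof -
        have "card A \<le> deg" using card_mono[OF _ that] tk by simp
        then show ?thesis using B by (simp add: power_increasing)
      qed
      finally show ?thesis .
    qed
    have PV: "cmod ?P * cmod ?V \<le> B ^ deg * \<eta>"
    proof (cases "inj_on \<rho> {..<t} \<and> \<rho> ` {..<k} \<subseteq> bad_roots G z")
      case False
      have "?P = 0 \<or> ?V = 0" by (rule discr_term_eq_0[OF \<phi> \<rho> tk(1) False])
      then have "cmod ?P * cmod ?V = 0" by (elim disjE) (simp_all only: norm_zero mult_zero_left mult_zero_right)
      then show ?thesis using B0 \<eta> by (simp only: mult_nonneg_nonneg zero_le_power)
    next
      case True
      then have im: "\<rho> ` {..<t} = roots z" and imk: "\<rho> ` {..<k} = bad_roots G z"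
        using discr_term_bij[OF z \<rho> tc] by (auto simp: bij_betw_def)
      show ?thesis using small
      proof
        assume *: "\<rho>0 \<in> bad_roots G z \<and> cmod (\<phi> (z + cscale \<rho>0 v)) \<le> \<eta>"
        then have "\<rho>0 \<in> \<rho> ` {..<k}" using imk by simp
        then obtain a where a: "a < k" "\<rho> a = \<rho>0" by blast
        have "cmod ?P = cmod (\<phi> (z + cscale \<rho>0 v)) * (\<Prod>i\<in>{..<k} - {a}. cmod (\<phi> (z + cscale (\<rho> i) v)))"
          using a by (subst prod_norm[symmetric], subst prod.remove[of _ a]) auto
        also have "\<dots> \<le> \<eta> * B ^ deg"
          using * \<eta> by (intro mult_mono Pl) (auto intro: prod_nonneg)
        finally have "cmod ?P \<le> \<eta> * B ^ deg" .
        moreover have "cmod ?V \<le> 1" by (rule norm_prod_offdiag_le(1)) (rule diff)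
        ultimately have "cmod ?P * cmod ?V \<le> (\<eta> * B ^ deg) * 1"
          using \<eta> B0 by (intro mult_mono) auto
        then show ?thesis by (simp add: mult.commute)
      next
        assume *: "cnj \<rho>0 \<in> roots z \<and> Im \<rho>0 \<noteq> 0 \<and> 2 * \<bar>Im \<rho>0\<bar> \<le> \<eta>"
        then have "\<rho>0 \<in> \<rho> ` {..<t}" "cnj \<rho>0 \<in> \<rho> ` {..<t}" using im \<rho>0 by simp_all
        then obtain a b where ab: "a < t" "\<rho> a = \<rho>0" "b < t" "\<rho> b = cnj \<rho>0"
          by (elim imageE) simp
        then have "a \<noteq> b" using * by (auto simp: complex_eq_iff)
        then have "cmod ?V \<le> cmod (\<rho> a - \<rho> b)"
          using ab by (intro norm_prod_offdiag_le(2)) (auto intro: diff)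
        also have "\<dots> = 2 * \<bar>Im \<rho>0\<bar>"
          using ab by (simp add: complex_diff_cnj norm_mult)
        finally have "cmod ?V \<le> \<eta>" using * by linarith
        moreover have "cmod ?P \<le> B ^ deg" using Pl[of "{..<k}"] by (simp flip: prod_norm)
        ultimately show ?thesis using B0 \<eta> by (intro mult_mono) auto
      qed
    qed
    have "cmod (?M * ?P * ?V) = cmod ?M * (cmod ?P * cmod ?V)" by (simp add: norm_mult mult.assoc)
    also have "\<dots> \<le> real deg ^ deg * (B ^ deg * \<eta>)"
      by (rule mult_mono[OF M PV]) (simp_all add: deg1)
    finally show "cmod (?M * ?P * ?V) \<le> real deg ^ deg * (B ^ deg * \<eta>)" .
  qed
  also have "\<dots> = real (card (roots z)) ^ t * (real deg ^ deg * (B ^ deg * \<eta>))"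
    by (simp add: card_PiE)
  also have "\<dots> \<le> real deg ^ deg * (real deg ^ deg * (B ^ deg * \<eta>))"
  proof (rule mult_right_mono)
    have "real (card (roots z)) ^ t \<le> real deg ^ t"
      using card_roots_le_deg[OF z] by (intro power_mono) auto
    also have "\<dots> \<le> real deg ^ deg" using deg1 tk by (intro power_increasing) auto
    finally show "real (card (roots z)) ^ t \<le> real deg ^ deg" .
  qed (use B0 \<eta> in auto)
  finally show ?thesis .
qed

lemma cnj_root:
  assumes "star f0 \<in> G" "\<rho> \<in> roots (x, 0)" "\<rho> \<notin> bad_roots G (x, 0)"
  shows "cnj \<rho> \<in> roots (x, 0)"
proof -
  have "star f0 ((x, 0) + cscale \<rho> v) = 0"
    using assms unfolding bad_roots_def by blast
  moreover have "cconj ((x, 0) + cscale \<rho> v) = (x, 0) + cscale (cnj \<rho>) v"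
    unfolding cconj_add_cscale by (simp add: cconj_def)
  ultimately have "f0 ((x, 0) + cscale (cnj \<rho>) v) = 0"
    unfolding star_def by simp
  then show ?thesis using assms(2) unfolding roots_def by simp
qed

end

section \<open>The Lojasiewicz inequality for a family\<close>

text \<open>Only a lower bound by a power is recorded. The class is then closed under minima,
  positive multiples, powers and composition, and exponents need not be tracked; the Hoelder
  exponent is read off once, at the end.\<close>

definition tolerance :: "(real \<Rightarrow> real) \<Rightarrow> bool" where
  "tolerance \<tau> \<longleftrightarrow> (\<exists>c>0. \<exists>N. \<forall>e. 0 < e \<longrightarrow> e \<le> 1 \<longrightarrow> c * e ^ N \<le> \<tau> e)"

lemma toleranceI: "0 < c \<Longrightarrow> (\<And>e. 0 < e \<Longrightarrow> e \<le> 1 \<Longrightarrow> c * e ^ N \<le> \<tau> e) \<Longrightarrow> tolerance \<tau>"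
  unfolding tolerance_def by blast

lemma toleranceE:
  assumes "tolerance \<tau>"
  obtains c N where "0 < c" "\<And>e. 0 < e \<Longrightarrow> e \<le> 1 \<Longrightarrow> c * e ^ N \<le> \<tau> e"
  using assms unfolding tolerance_def by blast

lemma tolerance_pos: "tolerance \<tau> \<Longrightarrow> 0 < e \<Longrightarrow> e \<le> 1 \<Longrightarrow> 0 < \<tau> e"
  by (erule toleranceE) (meson less_le_trans mult_pos_pos zero_less_power)

lemma tolerance_const: "0 < c \<Longrightarrow> tolerance (\<lambda>_. c)"
  by (rule toleranceI[of c 0]) auto

lemma tolerance_id: "tolerance (\<lambda>e. e)"
  by (rule toleranceI[of 1 1]) auto

lemma tolerance_cmult: "0 < a \<Longrightarrow> tolerance \<tau> \<Longrightarrow> tolerance (\<lambda>e. a * \<tau> e)"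
proof (erule toleranceE)
  fix c N
  assume a: "0 < a" "0 < c" and *: "\<And>e. 0 < e \<Longrightarrow> e \<le> 1 \<Longrightarrow> c * e ^ N \<le> \<tau> e"
  show ?thesis
    by (rule toleranceI[of "a * c" N]) (use a * in \<open>auto simp: mult.assoc\<close>)
qed

lemma tolerance_min:
  assumes "tolerance \<tau>" "tolerance \<sigma>"
  shows "tolerance (\<lambda>e. min (\<tau> e) (\<sigma> e))"
proof -
  obtain c N where c: "0 < c" "\<And>e. 0 < e \<Longrightarrow> e \<le> 1 \<Longrightarrow> c * e ^ N \<le> \<tau> e"
    using assms(1) by (erule toleranceE)
  obtain d M where d: "0 < d" "\<And>e. 0 < e \<Longrightarrow> e \<le> 1 \<Longrightarrow> d * e ^ M \<le> \<sigma> e"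
    using assms(2) by (erule toleranceE)
  show ?thesis
  proof (rule toleranceI[of "min c d" "max N M"])
    fix e :: real assume e: "0 < e" "e \<le> 1"
    have "min c d * e ^ max N M \<le> c * e ^ N" "min c d * e ^ max N M \<le> d * e ^ M"
      using e c(1) d(1) by (auto intro!: mult_mono power_decreasing)
    then show "min c d * e ^ max N M \<le> min (\<tau> e) (\<sigma> e)"
      using c(2)[OF e] d(2)[OF e] by simp
  qed (use c d in auto)
qed

lemma tolerance_power:
  assumes "tolerance \<tau>"
  shows "tolerance (\<lambda>e. \<tau> e ^ n)"
proof -
  obtain c N where c: "0 < c" "\<And>e. 0 < e \<Longrightarrow> e \<le> 1 \<Longrightarrow> c * e ^ N \<le> \<tau> e"
    using assms by (erule toleranceE)
  show ?thesis
  proof (rule toleranceI[of "c ^ n" "N * n"])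
    fix e :: real assume e: "0 < e" "e \<le> 1"
    have "(c * e ^ N) ^ n \<le> \<tau> e ^ n"
      using c e by (intro power_mono) auto
    then show "c ^ n * e ^ (N * n) \<le> \<tau> e ^ n"
      by (simp add: power_mult_distrib power_mult)
  qed (use c in auto)
qed

lemma tolerance_compose:
  assumes "tolerance \<tau>" "tolerance \<sigma>" "\<And>e. 0 < e \<Longrightarrow> e \<le> 1 \<Longrightarrow> \<sigma> e \<le> 1"
  shows "tolerance (\<lambda>e. \<tau> (\<sigma> e))"
proof -
  obtain c N where c: "0 < c" "\<And>e. 0 < e \<Longrightarrow> e \<le> 1 \<Longrightarrow> c * e ^ N \<le> \<tau> e"
    using assms(1) by (erule toleranceE)
  obtain d M where d: "0 < d" "\<And>e. 0 < e \<Longrightarrow> e \<le> 1 \<Longrightarrow> d * e ^ M \<le> \<sigma> e ^ N"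
    using tolerance_power[OF assms(2)] by (erule toleranceE)
  show ?thesis
  proof (rule toleranceI[of "c * d" M])
    fix e :: real assume e: "0 < e" "e \<le> 1"
    have "c * (d * e ^ M) \<le> c * \<sigma> e ^ N"
      using c d(2)[OF e] by simp
    also have "\<dots> \<le> \<tau> (\<sigma> e)"
      using tolerance_pos[OF assms(2) e] assms(3)[OF e] by (rule c(2))
    finally show "c * d * e ^ M \<le> \<tau> (\<sigma> e)" by (simp add: mult.assoc)
  qed (use c d in auto)
qed

text \<open>The members of the finite set \<open>J\<close> control the common zeros of all of \<open>Fam\<close>: this contains both the
  Lojasiewicz inequality and the local Noetherian property.\<close>

definition lojasiewicz :: "real \<Rightarrow> 'a::euclidean_space set \<Rightarrow> ('a \<times> 'a \<Rightarrow> complex) set \<Rightarrow> bool" where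
  "lojasiewicz r S Fam \<longleftrightarrow> (\<exists>J \<tau> \<rho>. finite J \<and> J \<subseteq> Fam \<and> tolerance \<tau> \<and> 0 < \<rho> \<and>
     (\<forall>e x. 0 < e \<longrightarrow> e \<le> 1 \<longrightarrow> x \<in> S \<longrightarrow> norm x < \<rho> \<longrightarrow> (\<forall>f\<in>J. cmod (f (x, 0)) \<le> \<tau> e) \<longrightarrow>
        (\<exists>z\<in>S. norm (z - x) \<le> e \<and> norm z < r \<and> (\<forall>f\<in>Fam. f (z, 0) = 0))))"

lemma finite_common_Lipschitz:
  fixes J :: "('a::euclidean_space \<times> 'a \<Rightarrow> complex) set"
  assumes "finite J" "\<And>f. f \<in> J \<Longrightarrow> gateaux_holo r f" "r' < r"
  obtains L where "L > 0"
    "\<And>f z s d. f \<in> J \<Longrightarrow> z \<in> ball 0 r' \<Longrightarrow> z + cscale s d \<in> ball 0 r' \<Longrightarrow>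
       cmod (f (z + cscale s d) - f z) \<le> L * (cmod s * norm d)"
proof -
  have "\<exists>L>0. \<forall>f\<in>J. \<forall>z s d. z \<in> ball 0 r' \<longrightarrow> z + cscale s d \<in> ball 0 r' \<longrightarrow>
       cmod (f (z + cscale s d) - f z) \<le> L * (cmod s * norm d)"
    using assms(1,2)
  proof (induction J rule: finite_induct)
    case empty
    show ?case by (rule exI[of _ 1]) simp
  next
    case (insert f J)
    then obtain L where L: "L > 0" "\<And>g z s d. g \<in> J \<Longrightarrow> z \<in> ball 0 r' \<Longrightarrow> z + cscale s d \<in> ball 0 r' \<Longrightarrow>
         cmod (g (z + cscale s d) - g z) \<le> L * (cmod s * norm d)" by (metis insertI2)
    obtain K where K: "K > 0" "\<And>z s d. z \<in> ball 0 r' \<Longrightarrow> z + cscale s d \<in> ball 0 r' \<Longrightarrow>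
         cmod (f (z + cscale s d) - f z) \<le> K * (cmod s * norm d)"
      using gateaux_holo_Lipschitz[OF insert.prems[OF insertI1] assms(3)] by blast
    have "cmod (g (z + cscale s d) - g z) \<le> max K L * (cmod s * norm d)"
      if g: "g \<in> insert f J" and z: "z \<in> ball 0 r'" "z + cscale s d \<in> ball 0 r'" for g z s d
    proof -
      have "K * (cmod s * norm d) \<le> max K L * (cmod s * norm d)"
        "L * (cmod s * norm d) \<le> max K L * (cmod s * norm d)"
        by (intro mult_right_mono; simp)+
      then show ?thesis using g K(2)[OF z] L(2)[OF _ z, of g] by force
    qed
    then show ?case using L(1) by (intro exI[of _ "max K L"]) auto
  qed
  then show ?thesis using that by blast
qed

section \<open>Descent through the strata\<close>

context root_fibre begin

definition discr_family :: "('a \<times> 'a \<Rightarrow> complex) set \<Rightarrow> nat \<Rightarrow> ('a \<times> 'a \<Rightarrow> complex) set" where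
  "discr_family G m = {discr t k \<phi> |t k \<phi>. k \<le> t \<and> t \<le> deg \<and> m \<le> t * (deg + 1) + k \<and> \<phi> \<in> lincomb G}"

text \<open>Otherwise the discriminant formed with the exact numbers of roots and bad roots of
  \<open>z\<close> itself would belong to the family, and some weight makes it nonzero at
  \<open>z\<close>.\<close>

lemma root_rank_less_of_discr_family:
  assumes z: "z \<in> ball 0 r1" and "\<And>T. T \<in> discr_family G m \<Longrightarrow> T z = 0"
  shows "root_rank G z < m"
proof (rule ccontr)
  assume "\<not> root_rank G z < m"
  then have "m \<le> card (roots z) * (deg + 1) + card (bad_roots G z)" by (simp add: root_rank_def)
  moreover obtain \<phi> where \<phi>: "\<phi> \<in> lincomb G" "discr (card (roots z)) (card (bad_roots G z)) \<phi> z \<noteq> 0"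
    using discr_nonzero[OF z] by blast
  ultimately have "discr (card (roots z)) (card (bad_roots G z)) \<phi> \<in> discr_family G m"
    using card_bad_le[OF z] card_roots_le_deg[OF z] unfolding discr_family_def by blast
  then show False using assms(2) \<phi>(2) by blast
qed

lemma real_good_root:
  assumes x: "norm x < r1" and t: "t \<in> roots (x, 0)" "t \<notin> bad_roots G (x, 0)" "Im t = 0"
    and S: "subspace S" "v \<in> S" "x \<in> S"
  shows "x + Re t *\<^sub>R v \<in> S" "norm (x + Re t *\<^sub>R v) < r" "\<forall>f\<in>G. f (x + Re t *\<^sub>R v, 0) = 0"
proof -
  have eq: "(x, 0) + cscale t v = (x + Re t *\<^sub>R v, 0)"
    using t(3) by (simp add: cscale_def)
  show "x + Re t *\<^sub>R v \<in> S" using S by (simp add: subspace_add subspace_scale)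
  have "(x, 0) + cscale t v \<in> ball 0 r"
    using x t(1) \<delta> by (intro fibre_in_ball) (auto simp: roots_def norm_Pair)
  then show "norm (x + Re t *\<^sub>R v) < r" by (simp add: eq norm_Pair)
  show "\<forall>f\<in>G. f (x + Re t *\<^sub>R v, 0) = 0"
    using t(1,2) eq by (auto simp: bad_roots_def)
qed

text \<open>Here \<open>t\<close> is a possibly non-real root over the real point \<open>x\<close>.\<close>

definition descent :: "('a \<times> 'a \<Rightarrow> complex) set \<Rightarrow> 'a set \<Rightarrow> nat \<Rightarrow> bool" where
  "descent G S m \<longleftrightarrow> (\<exists>J \<tau> \<rho>. finite J \<and> J \<subseteq> G \<and> tolerance \<tau> \<and> 0 < \<rho> \<and> \<rho> \<le> r1 \<and>
     (\<forall>e x t. 0 < e \<longrightarrow> e \<le> 1 \<longrightarrow> x \<in> S \<longrightarrow> x \<bullet> v = 0 \<longrightarrow> norm x < \<rho> \<longrightarrow> t \<in> roots (x, 0) \<longrightarrow>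
        root_rank G (x, 0) < m \<longrightarrow> \<bar>Im t\<bar> \<le> \<tau> e \<longrightarrow> (\<forall>f\<in>J. cmod (f ((x, 0) + cscale t v)) \<le> \<tau> e) \<longrightarrow>
        (\<exists>z\<in>S. norm (z - (x + Re t *\<^sub>R v)) \<le> e \<and> norm z < r \<and> (\<forall>f\<in>G. f (z, 0) = 0))))"

text \<open>A root counts \<open>deg + 1\<close>, so below \<open>deg + 2\<close> the given root
  \<open>t\<close> is the only one and it is good. Its conjugate is then a root as well, hence equal
  to \<open>t\<close>. No smallness is used, and the empty \<open>J\<close> will do.\<close>

lemma descent_base:
  assumes "star f0 \<in> G" "subspace S" "v \<in> S"
  shows "descent G S (deg + 2)"
  unfolding descent_def
proof (intro exI conjI allI impI)
  show "finite {}" "{} \<subseteq> G" "tolerance (\<lambda>_. 1)" "0 < r1" "r1 \<le> r1"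
    using r1 tolerance_const[of 1] by auto
  fix e :: real and x t
  assume e: "0 < e" and x: "x \<in> S" "norm x < r1" and t: "t \<in> roots (x, 0)"
    and rk: "root_rank G (x, 0) < deg + 2"
  have z: "(x, 0) \<in> ball (0 :: 'a \<times> 'a) r1" using x by (simp add: norm_Pair)
  have "card (roots (x, 0)) \<noteq> 0" using t finite_roots[OF z] by auto
  moreover have "\<not> 2 \<le> card (roots (x, 0))"
  proof
    assume "2 \<le> card (roots (x, 0))"
    then have "2 * (deg + 1) \<le> card (roots (x, 0)) * (deg + 1)" by (rule mult_le_mono1)
    then show False using rk by (simp add: root_rank_def)
  qed
  ultimately have c1: "card (roots (x, 0)) = 1" by simp
  then have rt: "roots (x, 0) = {t}" using t by (metis card_1_singletonE singletonD)
  have "card (bad_roots G (x, 0)) = 0" using rk c1 by (simp add: root_rank_def)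
  then have tb: "t \<notin> bad_roots G (x, 0)" using finite_bad_roots[OF z, of G] by auto
  then have "cnj t = t" using cnj_root[OF assms(1) t] rt by auto
  then have "Im t = 0" by (simp add: complex_eq_iff)
  note real_good_root[OF x(2) t tb this assms(2,3) x(1)]
  then show "\<exists>z\<in>S. norm (z - (x + Re t *\<^sub>R v)) \<le> e \<and> norm z < r \<and> (\<forall>f\<in>G. f (z, 0) = 0)"
    using e by (intro bexI[of _ "x + Re t *\<^sub>R v"]) auto
qed

text \<open>Records that at rank exactly \<open>m\<close> a bad or non-real root forces
  \<open>T\<close> to be small, with a loss linear in \<open>\<eta>\<close>. The number
  \<open>2 * \<bar>Im t\<bar>\<close> is the distance from \<open>t\<close> to its
  conjugate.\<close>

definition discr_control ::
  "('a \<times> 'a \<Rightarrow> complex) set \<Rightarrow> nat \<Rightarrow> ('a \<times> 'a \<Rightarrow> complex) set \<Rightarrow> real \<Rightarrow> ('a \<times> 'a \<Rightarrow> complex) \<Rightarrow> bool" where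
  "discr_control G m J C T \<longleftrightarrow>
    (\<forall>x t \<eta>. norm x < r1 \<longrightarrow> 0 \<le> \<eta> \<longrightarrow> t \<in> roots (x, 0) \<longrightarrow> root_rank G (x, 0) = m \<longrightarrow>
      t \<in> bad_roots G (x, 0) \<or> Im t \<noteq> 0 \<longrightarrow> 2 * \<bar>Im t\<bar> \<le> \<eta> \<longrightarrow>
      (\<forall>f\<in>J. cmod (f ((x, 0) + cscale t v)) \<le> \<eta>) \<longrightarrow> cmod (T (x, 0)) \<le> C * \<eta>)"

lemma discr_controlD:
  assumes "discr_control G m J C T" "norm x < r1" "0 \<le> \<eta>" "t \<in> roots (x, 0)" "root_rank G (x, 0) = m"
    "t \<in> bad_roots G (x, 0) \<or> Im t \<noteq> 0" "2 * \<bar>Im t\<bar> \<le> \<eta>"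
    "\<forall>f\<in>J. cmod (f ((x, 0) + cscale t v)) \<le> \<eta>"
  shows "cmod (T (x, 0)) \<le> C * \<eta>"
  using assms unfolding discr_control_def by blast

lemma discr_control_mono:
  assumes T: "discr_control G m J C T" and JC: "J \<subseteq> J'" "C \<le> C'"
  shows "discr_control G m J' C' T"
  unfolding discr_control_def
proof (intro allI impI)
  fix x t and \<eta> :: real
  assume *: "norm x < r1" "0 \<le> \<eta>" "t \<in> roots (x, 0)" "root_rank G (x, 0) = m"
    "t \<in> bad_roots G (x, 0) \<or> Im t \<noteq> 0" "2 * \<bar>Im t\<bar> \<le> \<eta>"
    and f: "\<forall>f\<in>J'. cmod (f ((x, 0) + cscale t v)) \<le> \<eta>"
  have "\<forall>f\<in>J. cmod (f ((x, 0) + cscale t v)) \<le> \<eta>" using f JC(1) by blast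
  then have "cmod (T (x, 0)) \<le> C * \<eta>" using T * unfolding discr_control_def by blast
  also have "\<dots> \<le> C' * \<eta>" using *(2) JC(2) by (rule mult_right_mono[rotated])
  finally show "cmod (T (x, 0)) \<le> C' * \<eta>" .
qed

text \<open>A discriminant coded above \<open>m\<close> vanishes at rank \<open>m\<close>; one coded
  exactly \<open>m\<close> is small. At a bad root this comes from a small value of
  \<open>\<phi>\<close>; at a good non-real root the conjugate is a root too, and the two are
  close.\<close>

lemma discr_control_exists:
  assumes G: "star f0 \<in> G" "\<And>f. f \<in> G \<Longrightarrow> gateaux_holo r f" and T: "T \<in> discr_family G m"
  shows "\<exists>J C. finite J \<and> J \<subseteq> G \<and> 1 \<le> C \<and> discr_control G m J C T"
proof -
  obtain t0 k \<phi> where T_def: "T = discr t0 k \<phi>" and tk: "k \<le> t0" "t0 \<le> deg" "m \<le> t0 * (deg + 1) + k"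
    and \<phi>: "\<phi> \<in> lincomb G" using T unfolding discr_family_def by blast
  obtain J C where J: "finite J" "J \<subseteq> G" "1 \<le> C"
    and JC: "\<And>z e. 0 \<le> e \<Longrightarrow> (\<forall>f\<in>J. cmod (f z) \<le> e) \<Longrightarrow> cmod (\<phi> z) \<le> C * e"
    using lincomb_bound[OF \<phi>] by blast
  have "gateaux_holo r \<phi>" by (rule gateaux_holo_lincomb[OF \<phi> G(2)])
  then obtain B0 where B0: "\<And>z. norm z \<le> r / 2 \<Longrightarrow> cmod (\<phi> z) \<le> B0"
    using gateaux_holo_bounded[of r \<phi> "r / 2"] r_pos
    by (metis half_gt_zero_iff field_sum_of_halves less_add_same_cancel1)
  define B where "B = max 1 B0"
  have B: "1 \<le> B" "cmod (\<phi> z) \<le> B" if "norm z \<le> r / 2" for z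
    using B0[OF that] by (auto simp: B_def)
  define C' where "C' = real deg ^ deg * (real deg ^ deg * (B ^ deg * C))"
  have bound: "cmod (T (x, 0)) \<le> max 1 C' * \<eta>"
    if x: "norm x < r1" and \<eta>: "0 \<le> \<eta>" and t: "t \<in> roots (x, 0)" and rk: "root_rank G (x, 0) = m"
      and bad: "t \<in> bad_roots G (x, 0) \<or> Im t \<noteq> 0" and Im: "2 * \<bar>Im t\<bar> \<le> \<eta>"
      and f: "\<forall>f\<in>J. cmod (f ((x, 0) + cscale t v)) \<le> \<eta>" for x t \<eta>
  proof -
    have z: "(x, 0) \<in> ball (0 :: 'a \<times> 'a) r1" using x by (simp add: norm_Pair)
    show ?thesis
    proof (cases "m < t0 * (deg + 1) + k")
      case True
      then have "T (x, 0) = 0"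
        unfolding T_def using rk by (intro discr_eq_0[OF z \<phi> tk(1,2)]) simp
      then show ?thesis using \<eta> by simp
    next
      case False
      have "cmod (discr t0 k \<phi> (x, 0)) \<le> real deg ^ deg * (real deg ^ deg * (B ^ deg * (C * \<eta>)))"
      proof (rule discr_small[OF z \<phi> tk(1,2) _ t])
        show "root_rank G (x, 0) = t0 * (deg + 1) + k" using rk tk False by simp
        show "1 \<le> B" by (simp add: B_def)
        show "cmod (\<phi> ((x, 0) + cscale \<rho> v)) \<le> B" if "\<rho> \<in> roots (x, 0)" for \<rho>
          using fibre_in_half_ball[OF z, of \<rho>] that \<delta> by (intro B(2)) (auto simp: roots_def)
        have "\<eta> \<le> C * \<eta>" using J(3) \<eta> by (simp add: mult_le_cancel_right1)
        then show "t \<in> bad_roots G (x, 0) \<and> cmod (\<phi> ((x, 0) + cscale t v)) \<le> C * \<eta> \<or>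
          cnj t \<in> roots (x, 0) \<and> Im t \<noteq> 0 \<and> 2 * \<bar>Im t\<bar> \<le> C * \<eta>"
          using bad JC[OF \<eta> f] cnj_root[OF G(1) t] Im by linarith
      qed
      also have "\<dots> = C' * \<eta>" by (simp add: C'_def mult_ac)
      also have "\<dots> \<le> max 1 C' * \<eta>" using \<eta> by (intro mult_right_mono) auto
      finally show ?thesis by (simp add: T_def)
    qed
  qed
  have "discr_control G m J (max 1 C') T"
    unfolding discr_control_def using bound by simp
  then show ?thesis using J(1,2) by (meson max.cobounded1)
qed

lemma discr_control_finite:
  assumes G: "star f0 \<in> G" "\<And>f. f \<in> G \<Longrightarrow> gateaux_holo r f"
    and "finite F" "F \<subseteq> discr_family G m"
  shows "\<exists>J C. finite J \<and> J \<subseteq> G \<and> 1 \<le> C \<and> (\<forall>T\<in>F. discr_control G m J C T)"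
  using assms(3,4)
proof (induction F rule: finite_induct)
  case empty
  show ?case by (rule exI[of _ "{}"], rule exI[of _ 1]) simp
next
  case (insert T F)
  then obtain J C where J: "finite J" "J \<subseteq> G" "1 \<le> C" and JC: "\<forall>T\<in>F. discr_control G m J C T"
    by auto
  have "T \<in> discr_family G m" using insert.prems by simp
  from discr_control_exists[OF G this] obtain J' C' where J': "finite J'" "J' \<subseteq> G" "1 \<le> C'"
    and JC': "discr_control G m J' C' T"
    by blast
  have "\<forall>S\<in>insert T F. discr_control G m (J \<union> J') (max C C') S"
    using discr_control_mono[OF JC', of "J \<union> J'" "max C C'"]
      discr_control_mono[of G m J C _ "J \<union> J'" "max C C'"] JC by simp
  then show ?case
    using J J' by (intro exI[of _ "J \<union> J'"] exI[of _ "max C C'"]) simp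
qed


text \<open>Over the origin the only possible root is 0, and it is good because \<open>G\<close>
  vanishes there. Hence every discriminant coded at least \<open>deg + 2\<close> vanishes at the
  origin, as the induction hypothesis requires.\<close>

lemma root_rank_zero:
  assumes "\<forall>f\<in>G. f 0 = 0" "\<And>t. t \<noteq> 0 \<Longrightarrow> cmod t < \<delta> \<Longrightarrow> f0 (cscale t v) \<noteq> 0"
  shows "root_rank G 0 \<le> deg + 1"
proof -
  have sub: "roots 0 \<subseteq> {0}" using assms(2) by (auto simp: roots_def)
  then have "bad_roots G 0 = {}"
    using assms(1) by (auto simp: bad_roots_def)
  moreover have "card (roots 0) \<le> 1" using card_mono[OF _ sub] by simp
  then have "card (roots 0) * (deg + 1) \<le> 1 * (deg + 1)" by (rule mult_le_mono1)
  ultimately show ?thesis by (simp add: root_rank_def)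
qed

text \<open>Only a bad or non-real root over a point of rank exactly \<open>m\<close> needs work.
  The pair (x, t) is moved in two stages: to a base point \<open>y\<close> of lower rank, then along
  the fibre over \<open>y\<close> to a root \<open>t1\<close> near \<open>t\<close>. The hypothesis
  for \<open>m\<close> then applies at scale e / 2.\<close>

lemma descent_step:
  assumes G: "star f0 \<in> G" "\<And>f. f \<in> G \<Longrightarrow> gateaux_holo r f" "\<forall>f\<in>G. f 0 = 0"
    and isolated: "\<And>t. t \<noteq> 0 \<Longrightarrow> cmod t < \<delta> \<Longrightarrow> f0 (cscale t v) \<noteq> 0"
    and S: "subspace S" "v \<in> S"
    and IH: "\<And>Fam. \<forall>f\<in>Fam. gateaux_holo r1 f \<and> f 0 = 0 \<Longrightarrow>
      lojasiewicz r1 {x \<in> S. x \<bullet> v = 0} Fam"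
    and m: "deg + 2 \<le> m" and desc: "descent G S m"
  shows "descent G S (Suc m)"
proof -
  obtain Jm \<tau>m \<rho>m where Jm: "finite Jm" "Jm \<subseteq> G" "tolerance \<tau>m" "0 < \<rho>m" "\<rho>m \<le> r1"
    and descm: "\<And>e x t. 0 < e \<Longrightarrow> e \<le> 1 \<Longrightarrow> x \<in> S \<Longrightarrow> x \<bullet> v = 0 \<Longrightarrow> norm x < \<rho>m \<Longrightarrow> t \<in> roots (x, 0) \<Longrightarrow>
        root_rank G (x, 0) < m \<Longrightarrow> \<bar>Im t\<bar> \<le> \<tau>m e \<Longrightarrow> (\<forall>f\<in>Jm. cmod (f ((x, 0) + cscale t v)) \<le> \<tau>m e) \<Longrightarrow>
        (\<exists>z\<in>S. norm (z - (x + Re t *\<^sub>R v)) \<le> e \<and> norm z < r \<and> (\<forall>f\<in>G. f (z, 0) = 0))"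
    using desc unfolding descent_def by metis
  have zero: "T 0 = 0" if T: "T \<in> discr_family G m" for T
  proof -
    obtain t0 k \<phi> where *: "T = discr t0 k \<phi>" "k \<le> t0" "t0 \<le> deg" "m \<le> t0 * (deg + 1) + k"
      "\<phi> \<in> lincomb G" using T unfolding discr_family_def by blast
    have "root_rank G 0 < t0 * (deg + 1) + k"
      using root_rank_zero[of G, OF G(3) isolated] m *(4) by linarith
    then show ?thesis unfolding *(1) using * r1 by (intro discr_eq_0) auto
  qed
  have hol: "gateaux_holo r1 T" if T: "T \<in> discr_family G m" for T
  proof -
    obtain t0 k \<phi> where *: "T = discr t0 k \<phi>" "\<phi> \<in> lincomb G"
      using T unfolding discr_family_def by blast
    show ?thesis
      unfolding *(1) by (rule gateaux_holo_discr, rule gateaux_holo_lincomb[OF *(2)], rule G(2))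
  qed
  have "lojasiewicz r1 {x \<in> S. x \<bullet> v = 0} (discr_family G m)"
    by (rule IH) (simp add: hol zero)
  then obtain F \<tau>' \<rho>' where F: "finite F" "F \<subseteq> discr_family G m" "tolerance \<tau>'" "0 < \<rho>'"
    and loj: "\<forall>e x. 0 < e \<longrightarrow> e \<le> 1 \<longrightarrow> x \<in> {x \<in> S. x \<bullet> v = 0} \<longrightarrow> norm x < \<rho>' \<longrightarrow>
      (\<forall>f\<in>F. cmod (f (x, 0)) \<le> \<tau>' e) \<longrightarrow>
      (\<exists>z\<in>{x \<in> S. x \<bullet> v = 0}. norm (z - x) \<le> e \<and> norm z < r1 \<and> (\<forall>f\<in>discr_family G m. f (z, 0) = 0))"
    unfolding lojasiewicz_def by (elim exE conjE) (rule that)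
  obtain J C where J: "finite J" "J \<subseteq> G" "1 \<le> C" "\<forall>T\<in>F. discr_control G m J C T"
    using discr_control_finite[OF G(1,2) F(1,2)] by blast
  obtain L where L: "L > 0" and Lip: "\<And>f z s d. f \<in> insert f0 Jm \<Longrightarrow> z \<in> ball 0 (r / 2) \<Longrightarrow>
      z + cscale s d \<in> ball 0 (r / 2) \<Longrightarrow> cmod (f (z + cscale s d) - f z) \<le> L * (cmod s * norm d)"
  proof (rule finite_common_Lipschitz[of "insert f0 Jm" r "r / 2"])
    show "gateaux_holo r f" if "f \<in> insert f0 Jm" for f using that Jm(2) G(2) f0 by blast
  qed (use Jm r_pos in auto)
  \<comment> \<open>This bounds the move of the root. With \<open>\<eta> e \<le> \<kappa> e\<close>
    the two moves change the values of \<open>Jm\<close> by at most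
    \<open>2 * L * \<kappa> e\<close> and shift the point by at most e / 2, which leaves e / 2 for
    the hypothesis at \<open>m\<close>.\<close>
  define \<kappa> where "\<kappa> = (\<lambda>e. 1 / (4 * (L + 1)) * min (\<tau>m (1/2 * e)) e)"
  \<comment> \<open>This bounds the move of the base point. The second entry keeps \<open>f0\<close>
    below \<open>c0 * \<kappa> e ^ deg\<close>, as \<open>root_near\<close> demands; the last two
    make \<open>\<eta> e\<close> an admissible scale and keep \<open>y\<close> within radius
    \<open>\<rho>m\<close>.\<close>
  define \<eta> where "\<eta> = (\<lambda>e. min (min (\<kappa> e) (c0 / (2 * L) * \<kappa> e ^ deg)) (min 1 (\<rho>m / 2)))"
  \<comment> \<open>The factor 2 comes from the distance between conjugate roots: the discriminants
    are controlled at level \<open>2 * \<tau> e\<close>, so they are at most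
    \<open>2 * C * \<tau> e\<close>.\<close>
  define \<tau> where "\<tau> = (\<lambda>e. min (\<kappa> e) (1 / (2 * C) * \<tau>' (\<eta> e)))"
  have t\<kappa>: "tolerance \<kappa>"
    unfolding \<kappa>_def using L
    by (intro tolerance_cmult tolerance_min tolerance_compose[OF Jm(3)] tolerance_id) auto
  have t\<eta>: "tolerance \<eta>"
    unfolding \<eta>_def using L c0 Jm
    by (intro tolerance_min tolerance_cmult tolerance_power t\<kappa> tolerance_const) auto
  have t\<tau>: "tolerance \<tau>"
    unfolding \<tau>_def using J
    by (intro tolerance_min tolerance_cmult t\<kappa> tolerance_compose[OF F(3) t\<eta>]) (auto simp: \<eta>_def)
  show ?thesis
    unfolding descent_def
  proof (intro exI conjI allI impI)
    show "finite (J \<union> Jm)" "J \<union> Jm \<subseteq> G" using J Jm by auto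
    show "tolerance \<tau>" by (rule t\<tau>)
    show "0 < min \<rho>' (\<rho>m / 2)" "min \<rho>' (\<rho>m / 2) \<le> r1" using F Jm by auto
    fix e :: real and x t
    assume e: "0 < e" "e \<le> 1" and x: "x \<in> S" "x \<bullet> v = 0" "norm x < min \<rho>' (\<rho>m / 2)"
      and t: "t \<in> roots (x, 0)" and rk: "root_rank G (x, 0) < Suc m" and Im: "\<bar>Im t\<bar> \<le> \<tau> e"
      and small: "\<forall>f\<in>J \<union> Jm. cmod (f ((x, 0) + cscale t v)) \<le> \<tau> e"
    have \<kappa>0: "0 < \<kappa> e" and \<eta>0: "0 < \<eta> e"
      using tolerance_pos[OF t\<kappa> e] tolerance_pos[OF t\<eta> e] by auto
    have \<kappa>4: "4 * (L + 1) * \<kappa> e \<le> \<tau>m (1/2 * e)" "4 * (L + 1) * \<kappa> e \<le> e"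
      using L by (simp_all add: \<kappa>_def)
    have L\<kappa>: "0 < L * \<kappa> e" using L \<kappa>0 by simp
    have \<kappa>': "4 * (L * \<kappa> e) + 4 * \<kappa> e \<le> \<tau>m (1/2 * e)" "4 * (L * \<kappa> e) + 4 * \<kappa> e \<le> e"
      using \<kappa>4 by (simp_all add: algebra_simps)
    have \<tau>\<kappa>: "\<tau> e \<le> \<kappa> e" and \<tau>': "2 * C * \<tau> e \<le> \<tau>' (\<eta> e)"
    proof -
      show "\<tau> e \<le> \<kappa> e" by (simp add: \<tau>_def)
      have "2 * C * \<tau> e \<le> 2 * C * (1 / (2 * C) * \<tau>' (\<eta> e))"
        using J(3) by (intro mult_left_mono) (auto simp: \<tau>_def)
      then show "2 * C * \<tau> e \<le> \<tau>' (\<eta> e)" using J(3) by simp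
    qed
    have \<eta>: "\<eta> e \<le> \<kappa> e" "\<eta> e \<le> c0 / (2 * L) * \<kappa> e ^ deg" "\<eta> e \<le> 1" "\<eta> e \<le> \<rho>m / 2"
      by (auto simp: \<eta>_def)
    have xr: "norm x < r1" using x(3) Jm by auto
    have zx: "(x, 0) \<in> ball (0 :: 'a \<times> 'a) r1" using xr by (simp add: norm_Pair)
    show "\<exists>z\<in>S. norm (z - (x + Re t *\<^sub>R v)) \<le> e \<and> norm z < r \<and> (\<forall>f\<in>G. f (z, 0) = 0)"
    proof (cases "root_rank G (x, 0) < m")
      case True
      have b: "\<tau> e \<le> \<tau>m (1/2 * e)" using \<tau>\<kappa> \<kappa>'(1) \<kappa>0 L\<kappa> by linarith
      have "\<exists>z\<in>S. norm (z - (x + Re t *\<^sub>R v)) \<le> 1/2 * e \<and> norm z < r \<and> (\<forall>f\<in>G. f (z, 0) = 0)"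
      proof (rule descm[OF _ _ x(1,2) _ t True])
        show "\<forall>f\<in>Jm. cmod (f ((x, 0) + cscale t v)) \<le> \<tau>m (1/2 * e)"
          using small b by (auto intro: order_trans)
      qed (use e x(3) Jm Im b in auto)
      then obtain z where z: "z \<in> S" "norm (z - (x + Re t *\<^sub>R v)) \<le> 1/2 * e" "norm z < r" "\<forall>f\<in>G. f (z, 0) = 0"
        by blast
      show ?thesis
        by (rule bexI[OF _ z(1)]) (use z e in simp)
    next
      case False
      then have rkm: "root_rank G (x, 0) = m" using rk by simp
      show ?thesis
      proof (cases "t \<in> bad_roots G (x, 0) \<or> Im t \<noteq> 0")
        case False
        then have "t \<notin> bad_roots G (x, 0)" "Im t = 0" by auto
        from real_good_root[OF xr t this S x(1)] show ?thesis
          using e by (intro bexI[of _ "x + Re t *\<^sub>R v"]) auto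
      next
        case True
        have "cmod (T (x, 0)) \<le> \<tau>' (\<eta> e)" if "T \<in> F" for T
        proof -
          have \<tau>0: "0 < \<tau> e" by (rule tolerance_pos[OF t\<tau> e])
          have "\<forall>f\<in>J. cmod (f ((x, 0) + cscale t v)) \<le> 2 * \<tau> e"
            using small \<tau>0 by (auto intro: order_trans)
          moreover have "discr_control G m J C T" using J(4) that by blast
          ultimately have "cmod (T (x, 0)) \<le> C * (2 * \<tau> e)"
            using Im \<tau>0 by (intro discr_controlD[OF _ xr _ t rkm True]) auto
          then show ?thesis using \<tau>' by (simp add: mult_ac)
        qed
        then obtain y where y: "y \<in> S" "y \<bullet> v = 0" "norm (y - x) \<le> \<eta> e" "norm y < r1"
          "\<forall>f\<in>discr_family G m. f (y, 0) = 0"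
          using loj[rule_format, OF \<eta>0 \<eta>(3), of x] x by auto
        have zy: "(y, 0) \<in> ball (0 :: 'a \<times> 'a) r1" using y(4) by (simp add: norm_Pair)
        have rky: "root_rank G (y, 0) < m" using root_rank_less_of_discr_family[OF zy] y(5) by blast
        have y\<rho>: "norm y < \<rho>m"
          using y(3) \<eta>(4) x(3) norm_triangle_ineq[of x "y - x"] by simp
        have t\<delta>: "cmod t < \<delta>" "f0 ((x, 0) + cscale t v) = 0" using t by (auto simp: roots_def)
        have inb: "(u, 0) + cscale s v \<in> ball 0 (r / 2)" if "norm u < r1" "cmod s < \<delta>" for u s
          using that \<delta> by (intro fibre_in_half_ball) (auto simp: norm_Pair)
        \<comment> \<open>The base point moves with coefficient 1 in the real direction
          \<open>y - x\<close>; the later move along the fibre has coefficient \<open>t1 - t\<close>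
          in direction \<open>v\<close>. Both are displacements covered by the Lipschitz
          bound.\<close>
        have w1: "((x, 0) + cscale t v) + cscale 1 (y - x) = (y, 0) + cscale t v"
          by (simp add: cscale_def)
        have d1: "cmod (f ((y, 0) + cscale t v) - f ((x, 0) + cscale t v)) \<le> L * \<eta> e"
          if "f \<in> insert f0 Jm" for f
        proof -
          have "cmod (f (((x, 0) + cscale t v) + cscale 1 (y - x)) - f ((x, 0) + cscale t v))
              \<le> L * (cmod 1 * norm (y - x))"
            by (rule Lip[OF that]) (simp_all only: w1 inb xr y(4) t\<delta>)
          also have "\<dots> \<le> L * \<eta> e" using L y(3) by simp
          finally show ?thesis by (simp only: w1)
        qed
        have "cmod (f0 ((y, 0) + cscale t v)) \<le> L * \<eta> e"
          using d1[of f0] t\<delta>(2) by simp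
        also have "\<dots> \<le> L * (c0 / (2 * L) * \<kappa> e ^ deg)"
          using L \<eta>(2) by (intro mult_left_mono) auto
        also have "\<dots> = 1/2 * (c0 * \<kappa> e ^ deg)" using L by simp
        also have "\<dots> < c0 * \<kappa> e ^ deg" using c0(1) \<kappa>0 by simp
        finally have "cmod (f0 ((y, 0) + cscale t v)) < c0 * \<kappa> e ^ deg" .
        moreover have "\<kappa> e \<le> 1" using \<kappa>'(2) L\<kappa> \<kappa>0 e by linarith
        ultimately obtain t1 where t1: "t1 \<in> roots (y, 0)" "cmod (t - t1) < \<kappa> e"
          using root_near[OF zy t\<delta>(1) \<kappa>0] by blast
        have t1\<delta>: "cmod t1 < \<delta>" using t1(1) by (auto simp: roots_def)
        have w2: "((y, 0) + cscale t v) + cscale (t1 - t) v = (y, 0) + cscale t1 v"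
          by (simp add: add.assoc flip: cscale_add)
        have d2: "cmod (f ((y, 0) + cscale t1 v) - f ((y, 0) + cscale t v)) \<le> L * \<kappa> e"
          if "f \<in> insert f0 Jm" for f
        proof -
          have "cmod (f (((y, 0) + cscale t v) + cscale (t1 - t) v) - f ((y, 0) + cscale t v))
              \<le> L * (cmod (t1 - t) * norm v)"
            by (rule Lip[OF that]) (simp_all only: w2 inb y(4) t\<delta> t1\<delta>)
          also have "\<dots> \<le> L * \<kappa> e" using L t1(2) v by (simp add: norm_minus_commute)
          finally show ?thesis by (simp only: w2)
        qed
        have fsmall: "cmod (f ((y, 0) + cscale t1 v)) \<le> \<tau>m (1/2 * e)" if "f \<in> Jm" for f
        proof -
          have "cmod (f ((x, 0) + cscale t v)) \<le> \<tau> e" using small that by blast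
          moreover have "L * \<eta> e \<le> L * \<kappa> e" using L \<eta>(1) by simp
          moreover have "f \<in> insert f0 Jm" using that by simp
          note d1[OF this] d2[OF this]
          moreover have "cmod a \<le> cmod c + cmod (b - c) + cmod (a - b)" for a b c
            by (smt (verit) norm_triangle_sub)
          ultimately have "cmod (f ((y, 0) + cscale t1 v)) \<le> \<kappa> e + L * \<kappa> e + L * \<kappa> e"
            using \<tau>\<kappa> by (smt (verit))
          then show ?thesis using \<kappa>' L\<kappa> \<kappa>0 by linarith
        qed
        have "\<bar>Im t1\<bar> \<le> \<bar>Im t\<bar> + cmod (t - t1)"
          using abs_Im_le_cmod[of "t - t1"] by simp
        then have "\<bar>Im t1\<bar> \<le> \<tau>m (1/2 * e)"
          using Im \<tau>\<kappa> t1(2) \<kappa>' L\<kappa> \<kappa>0 by linarith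
        then obtain z where z: "z \<in> S" "norm (z - (y + Re t1 *\<^sub>R v)) \<le> 1/2 * e" "norm z < r" "\<forall>f\<in>G. f (z, 0) = 0"
          using descm[of "1/2 * e" y t1] y(1,2) y\<rho> t1(1) rky e fsmall by auto
        have "z - (x + Re t *\<^sub>R v) = (z - (y + Re t1 *\<^sub>R v)) + (y - x) + Re (t1 - t) *\<^sub>R v"
          by (simp add: algebra_simps)
        then have "norm (z - (x + Re t *\<^sub>R v)) \<le>
            norm (z - (y + Re t1 *\<^sub>R v)) + norm (y - x) + norm (Re (t1 - t) *\<^sub>R v)"
          by (simp only:) (rule order_trans[OF norm_triangle_ineq add_right_mono[OF norm_triangle_ineq]])
        also have "norm (Re (t1 - t) *\<^sub>R v) \<le> cmod (t - t1)"
          using abs_Re_le_cmod[of "t1 - t"] v by (simp add: norm_minus_commute)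
        finally have "norm (z - (x + Re t *\<^sub>R v)) \<le> e"
          using z(2) y(3) \<eta>(1) t1(2) \<kappa>' L\<kappa> \<kappa>0 by linarith
        then show ?thesis using z by blast
      qed
    qed
  qed
qed

text \<open>Write \<open>x\<close> as \<open>y + s *\<^sub>R v\<close> with \<open>y\<close>
  orthogonal to \<open>v\<close>. A small value of \<open>f0\<close> at \<open>x\<close> gives a
  root over \<open>y\<close> close to the real number \<open>s\<close>, hence with small imaginary
  part, and descent from above all ranks applies to it.\<close>

lemma lojasiewicz_of_fibre:
  assumes f0_mem: "f0 \<in> Fam" and Fam: "\<And>f. f \<in> Fam \<Longrightarrow> gateaux_holo r f" "\<forall>f\<in>Fam. f 0 = 0"
    and isolated: "\<And>t. t \<noteq> 0 \<Longrightarrow> cmod t < \<delta> \<Longrightarrow> f0 (cscale t v) \<noteq> 0"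
    and S: "subspace S" "v \<in> S"
    and IH: "\<And>Fam. \<forall>f\<in>Fam. gateaux_holo r1 f \<and> f 0 = 0 \<Longrightarrow>
      lojasiewicz r1 {x \<in> S. x \<bullet> v = 0} Fam"
  shows "lojasiewicz r S Fam"
proof -
  define G where "G = Fam \<union> star ` Fam"
  have star0: "star f 0 = 0" if "f 0 = 0" for f :: "'a \<times> 'a \<Rightarrow> complex"
    using that by (simp add: star_def cconj_def zero_prod_def)
  have G: "star f0 \<in> G" "\<And>f. f \<in> G \<Longrightarrow> gateaux_holo r f" "\<forall>f\<in>G. f 0 = 0"
    using f0_mem Fam star0 by (auto simp: G_def intro: gateaux_holo_star)
  \<comment> \<open>Exceeds every rank, since a rank is at most
    \<open>deg * (deg + 1) + deg\<close>.\<close>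
  define m where "m = (deg + 2) * (deg + 2)"
  have "deg + 2 \<le> m" by (simp add: m_def)
  then have "descent G S m"
  proof (induction m rule: dec_induct)
    case base
    show ?case by (rule descent_base[OF G(1) S])
  next
    case (step n)
    show ?case
      by (rule descent_step[where G = G and S = S, OF G isolated S IH]) (use step in auto)
  qed
  then obtain Jm \<tau>m \<rho>m where Jm: "finite Jm" "Jm \<subseteq> G" "tolerance \<tau>m" "0 < \<rho>m" "\<rho>m \<le> r1"
    and descm: "\<And>e x t. 0 < e \<Longrightarrow> e \<le> 1 \<Longrightarrow> x \<in> S \<Longrightarrow> x \<bullet> v = 0 \<Longrightarrow> norm x < \<rho>m \<Longrightarrow> t \<in> roots (x, 0) \<Longrightarrow>
        root_rank G (x, 0) < m \<Longrightarrow> \<bar>Im t\<bar> \<le> \<tau>m e \<Longrightarrow> (\<forall>f\<in>Jm. cmod (f ((x, 0) + cscale t v)) \<le> \<tau>m e) \<Longrightarrow>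
        (\<exists>z\<in>S. norm (z - (x + Re t *\<^sub>R v)) \<le> e \<and> norm z < r \<and> (\<forall>f\<in>G. f (z, 0) = 0))"
    unfolding descent_def by metis
  obtain L where L: "L > 0" and Lip: "\<And>f z s d. f \<in> Jm \<Longrightarrow> z \<in> ball 0 (r / 2) \<Longrightarrow>
      z + cscale s d \<in> ball 0 (r / 2) \<Longrightarrow> cmod (f (z + cscale s d) - f z) \<le> L * (cmod s * norm d)"
  proof (rule finite_common_Lipschitz[of Jm r "r / 2"])
    show "gateaux_holo r f" if "f \<in> Jm" for f using that Jm(2) G(2) by blast
  qed (use Jm r_pos in auto)
  \<comment> \<open>Some functions in \<open>Jm\<close> may be of the form \<open>star f\<close>
    with \<open>f\<close> in \<open>Fam\<close>; each is replaced by that partner, which has the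
    same modulus at real points. The function \<open>f0\<close> is added to produce the nearby
    root.\<close>
  define J where "J = insert f0 ((Jm \<inter> Fam) \<union> (star ` Jm \<inter> Fam))"
  define \<kappa> where "\<kappa> = (\<lambda>e. 1 / (2 * (L + 1)) * min (\<tau>m (1/2 * e)) e)"
  define \<tau> where "\<tau> = (\<lambda>e. min (\<kappa> e) (c0 / 2 * \<kappa> e ^ deg))"
  have t\<kappa>: "tolerance \<kappa>"
    unfolding \<kappa>_def using L
    by (intro tolerance_cmult tolerance_min tolerance_compose[OF Jm(3)] tolerance_id) auto
  have t\<tau>: "tolerance \<tau>"
    unfolding \<tau>_def using c0
    by (intro tolerance_min tolerance_cmult tolerance_power t\<kappa>) auto
  show ?thesis
    unfolding lojasiewicz_def
  proof (intro exI conjI allI impI)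
    show "finite J" "J \<subseteq> Fam" using Jm f0_mem by (auto simp: J_def)
    show "tolerance \<tau>" by (rule t\<tau>)
    show "0 < min \<delta> (\<rho>m / 2)" using \<delta> Jm by auto
    fix e :: real and x
    assume e: "0 < e" "e \<le> 1" and x: "x \<in> S" "norm x < min \<delta> (\<rho>m / 2)"
      and small: "\<forall>f\<in>J. cmod (f (x, 0)) \<le> \<tau> e"
    have \<kappa>0: "0 < \<kappa> e" using tolerance_pos[OF t\<kappa> e] by auto
    have \<kappa>4: "2 * (L + 1) * \<kappa> e \<le> \<tau>m (1/2 * e)" "2 * (L + 1) * \<kappa> e \<le> e"
      using L by (simp_all add: \<kappa>_def)
    have L\<kappa>: "0 < L * \<kappa> e" using L \<kappa>0 by simp
    have \<kappa>': "2 * (L * \<kappa> e) + 2 * \<kappa> e \<le> \<tau>m (1/2 * e)" "2 * (L * \<kappa> e) + 2 * \<kappa> e \<le> e"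
      using \<kappa>4 by (simp_all add: algebra_simps)
    have \<tau>\<kappa>: "\<tau> e \<le> \<kappa> e" "\<tau> e \<le> c0 / 2 * \<kappa> e ^ deg" by (auto simp: \<tau>_def)
    have smallG: "cmod (g (x, 0)) \<le> \<kappa> e" if "g \<in> Jm" for g
    proof -
      have "g \<in> Fam \<or> star g \<in> Fam" using that Jm(2) by (auto simp: G_def)
      then have "g \<in> J \<or> star g \<in> J" using that by (auto simp: J_def)
      then have "cmod (g (x, 0)) \<le> \<tau> e" using small norm_star_real[of g x] by metis
      then show ?thesis using \<tau>\<kappa> by linarith
    qed
    define s where "s = x \<bullet> v"
    define y where "y = x - s *\<^sub>R v"
    have vv: "v \<bullet> v = 1" using v by (simp add: norm_eq_1)
    have vx: "\<bar>s\<bar> \<le> norm x" using Cauchy_Schwarz_ineq2[of x v] v by (simp add: s_def)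
    have y: "y \<in> S" "y \<bullet> v = 0" "norm y < \<rho>m"
    proof -
      show "y \<in> S" using x S by (simp add: y_def subspace_diff subspace_scale)
      show "y \<bullet> v = 0" by (simp add: y_def s_def inner_diff_left vv)
      have "norm y \<le> norm x + norm (s *\<^sub>R v)" unfolding y_def by (rule norm_triangle_ineq4)
      then show "norm y < \<rho>m" using vx x(2) v by simp
    qed
    have zy: "(y, 0) \<in> ball (0 :: 'a \<times> 'a) r1" using y Jm by (simp add: norm_Pair)
    have xy: "(y, 0) + cscale (of_real s) v = (x, 0)"
      by (simp add: cscale_of_real y_def)
    have s\<delta>: "cmod (of_real s) < \<delta>" using vx x(2) by simp
    have "cmod (f0 (x, 0)) \<le> \<tau> e" using small by (simp add: J_def)
    also have "\<dots> \<le> c0 / 2 * \<kappa> e ^ deg" by (rule \<tau>\<kappa>)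
    also have "\<dots> < c0 * \<kappa> e ^ deg" using c0(1) \<kappa>0 by simp
    finally have "cmod (f0 ((y, 0) + cscale (of_real s) v)) < c0 * \<kappa> e ^ deg" by (simp only: xy)
    moreover have "\<kappa> e \<le> 1" using \<kappa>'(2) L\<kappa> \<kappa>0 e by linarith
    ultimately obtain t where t: "t \<in> roots (y, 0)" "cmod (of_real s - t) < \<kappa> e"
      using root_near[OF zy s\<delta> \<kappa>0] by blast
    have t\<delta>: "cmod t < \<delta>" using t(1) by (auto simp: roots_def)
    have inb: "(y, 0) + cscale s v \<in> ball 0 (r / 2)" if "cmod s < \<delta>" for s
      using that \<delta> by (intro fibre_in_half_ball[OF zy]) auto
    have w: "(x, 0) + cscale (t - of_real s) v = (y, 0) + cscale t v"
      by (simp add: add.assoc flip: cscale_add xy)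
    have fsmall: "cmod (f ((y, 0) + cscale t v)) \<le> \<tau>m (1/2 * e)" if "f \<in> Jm" for f
    proof -
      have "cmod (f ((x, 0) + cscale (t - of_real s) v) - f (x, 0)) \<le> L * (cmod (t - of_real s) * norm v)"
        by (rule Lip[OF that]) (use inb[OF s\<delta>] inb[OF t\<delta>] in \<open>simp_all only: w xy\<close>)
      also have "\<dots> \<le> L * \<kappa> e" using L t(2) v by (simp add: norm_minus_commute)
      finally have "cmod (f ((y, 0) + cscale t v) - f (x, 0)) \<le> L * \<kappa> e" by (simp only: w)
      then have "cmod (f ((y, 0) + cscale t v)) \<le> \<kappa> e + L * \<kappa> e"
        using smallG[OF that] norm_triangle_sub[of "f ((y, 0) + cscale t v)" "f (x, 0)"] by linarith
      then show ?thesis using \<kappa>' L\<kappa> \<kappa>0 by linarith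
    qed
    have "\<bar>Im t\<bar> \<le> \<tau>m (1/2 * e)"
      using abs_Im_le_cmod[of "of_real s - t"] t(2) \<kappa>' L\<kappa> \<kappa>0 by simp
    moreover have "root_rank G (y, 0) < m"
    proof -
      have "card (roots (y, 0)) * (deg + 1) \<le> deg * (deg + 1)"
        using card_roots_le_deg[OF zy] by (rule mult_le_mono1)
      moreover have "card (bad_roots G (y, 0)) \<le> deg"
        using card_bad_le[OF zy, of G] card_roots_le_deg[OF zy] by linarith
      ultimately show ?thesis by (simp add: root_rank_def m_def)
    qed
    ultimately obtain z where z: "z \<in> S" "norm (z - (y + Re t *\<^sub>R v)) \<le> 1/2 * e" "norm z < r" "\<forall>f\<in>G. f (z, 0) = 0"
      using descm[of "1/2 * e" y t] y t(1) e fsmall by auto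
    have "z - x = (z - (y + Re t *\<^sub>R v)) + Re (t - of_real s) *\<^sub>R v"
      by (simp add: y_def algebra_simps)
    then have "norm (z - x) \<le> norm (z - (y + Re t *\<^sub>R v)) + norm (Re (t - of_real s) *\<^sub>R v)"
      by (simp only: norm_triangle_ineq)
    also have "norm (Re (t - of_real s) *\<^sub>R v) \<le> cmod (of_real s - t)"
      using abs_Re_le_cmod[of "t - of_real s"] v by (simp add: norm_minus_commute)
    finally have "norm (z - x) \<le> e"
      using z(2) t(2) \<kappa>' L\<kappa> \<kappa>0 by linarith
    then show "\<exists>z\<in>S. norm (z - x) \<le> e \<and> norm z < r \<and> (\<forall>f\<in>Fam. f (z, 0) = 0)"
      using z by (auto simp: G_def)
  qed
qed

end

text \<open>On the line through \<open>x\<close> the function \<open>f0\<close> is not identically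
  zero, so its root 0 is isolated. A small circle avoids all roots, and uniform continuity carries
  half of the minimum on it over to nearby base points.\<close>

lemma root_fibre_exists:
  fixes f0 :: "'a::euclidean_space \<times> 'a \<Rightarrow> complex"
  assumes f0: "gateaux_holo r f0" and f00: "f0 0 = 0" and x: "norm x < r" "f0 (x, 0) \<noteq> 0"
  obtains v \<delta> r1 c0 where "v = (1 / norm x) *\<^sub>R x" "root_fibre f0 v r r1 \<delta> c0"
    "\<And>t. t \<noteq> 0 \<Longrightarrow> cmod t < \<delta> \<Longrightarrow> f0 (cscale t v) \<noteq> 0"
proof -
  define v where "v = (1 / norm x) *\<^sub>R x"
  define g where "g = (\<lambda>t. f0 (cscale t v))"
  have x0: "x \<noteq> 0" using x(2) f00 by (auto simp: zero_prod_def)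
  then have v: "norm v = 1" and xv: "norm x *\<^sub>R v = x" by (auto simp: v_def)
  have r: "0 < r" using x(1) norm_ge_zero[of x] by linarith
  have nc: "norm (cscale t v) = cmod t" for t by (simp add: norm_cscale v)
  have holg: "g holomorphic_on ball 0 r"
    using gateaux_holo_line[OF f0, of "ball 0 r" 0 v] by (simp add: nc g_def)
  have gx: "g (of_real (norm x)) \<noteq> 0" and g0: "g 0 = 0"
    using x(2) f00 by (simp_all add: g_def cscale_of_real xv)
  have nconst: "\<not> g constant_on ball 0 r"
  proof
    assume "g constant_on ball 0 r"
    moreover have "of_real (norm x) \<in> ball (0 :: complex) r" "0 \<in> ball (0 :: complex) r" using x r by auto
    ultimately have "g (of_real (norm x)) = g 0" unfolding constant_on_def by metis
    then show False using gx g0 by simp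
  qed
  have fin: "finite {t \<in> cball 0 (r / 2). g t = 0}"
    by (rule holomorphic_compact_finite_zeros[OF holg _ _ _ _ nconst]) (use r in auto)
  obtain d where d: "d > 0" "\<And>t. t \<in> cball 0 (r / 2) \<Longrightarrow> g t = 0 \<Longrightarrow> t \<noteq> 0 \<Longrightarrow> d \<le> cmod t"
    using finite_set_avoid[OF fin, of 0] by (auto simp: dist_norm)
  \<comment> \<open>The nonzero roots have modulus at least \<open>d\<close>. The bound r / 16
    combines with r1 \<le> r / 8 to give r1 + 2\<delta> \<le> r / 2.\<close>
  define \<delta> where "\<delta> = min (d / 2) (min (1/4) (r / 16))"
  have \<delta>: "0 < \<delta>" "\<delta> \<le> 1/4" "\<delta> < d" "\<delta> \<le> r / 16" using d r by (auto simp: \<delta>_def)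
  have gnz: "g t \<noteq> 0" if "t \<noteq> 0" "cmod t \<le> \<delta>" for t
    using d(2)[of t] that \<delta> r by auto
  have "\<exists>t0\<in>sphere 0 \<delta>. \<forall>t\<in>sphere 0 \<delta>. cmod (g t0) \<le> cmod (g t)"
  proof (rule continuous_attains_inf)
    show "sphere 0 \<delta> \<noteq> ({} :: complex set)" using \<delta> by simp
    show "continuous_on (sphere 0 \<delta>) (\<lambda>t. cmod (g t))"
      by (intro continuous_on_norm continuous_on_subset[OF holomorphic_on_imp_continuous_on[OF holg]])
         (use \<delta> r in auto)
  qed auto
  then obtain t0 where t0: "cmod t0 = \<delta>" "\<And>t. cmod t = \<delta> \<Longrightarrow> cmod (g t0) \<le> cmod (g t)"
    by auto
  define c0 where "c0 = cmod (g t0) / 2"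
  have c0: "0 < c0" using gnz[of t0] t0(1) \<delta> by (auto simp: c0_def)
  have "uniformly_continuous_on (cball 0 (r / 2)) f0"
    by (rule compact_uniformly_continuous[OF continuous_on_subset[OF gateaux_holo_cont[OF f0]]]) (use r in auto)
  then obtain d2 where d2: "d2 > 0"
    "\<And>a b. a \<in> cball 0 (r / 2) \<Longrightarrow> b \<in> cball 0 (r / 2) \<Longrightarrow> dist b a < d2 \<Longrightarrow> dist (f0 b) (f0 a) < c0"
    unfolding uniformly_continuous_on_def using c0 by metis
  define r1 where "r1 = min d2 (r / 8)"
  have "root_fibre f0 v r r1 \<delta> c0"
  proof
    show "gateaux_holo r f0" "norm v = 1" "0 < \<delta>" "\<delta> \<le> 1/4" "0 < c0" by (fact f0 v \<delta> c0)+
    show "0 < r1" "r1 + 2 * \<delta> \<le> r / 2" using d2 r \<delta> by (auto simp: r1_def)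
    fix z :: "'a \<times> 'a" and t
    assume z: "z \<in> ball 0 r1" and t: "cmod t = \<delta>"
    have "norm (z + cscale t v) \<le> norm z + \<delta>"
      using norm_triangle_ineq[of z "cscale t v"] by (simp add: nc t)
    then have "z + cscale t v \<in> cball 0 (r / 2)" "cscale t v \<in> cball 0 (r / 2)"
      using z \<delta> r t by (auto simp: r1_def nc)
    moreover have "dist (z + cscale t v) (cscale t v) < d2"
      using z by (simp add: r1_def dist_norm)
    ultimately have "dist (f0 (z + cscale t v)) (f0 (cscale t v)) < c0" by (intro d2(2))
    then have "cmod (g t) < cmod (f0 (z + cscale t v)) + c0"
      using norm_triangle_sub[of "g t" "f0 (z + cscale t v)"]
      by (simp add: g_def dist_norm norm_minus_commute)
    then show "c0 \<le> cmod (f0 (z + cscale t v))" using t0(2)[OF t] by (simp add: c0_def)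
  qed
  moreover have "f0 (cscale t v) \<noteq> 0" if "t \<noteq> 0" "cmod t < \<delta>" for t
    using gnz[of t] that by (simp add: g_def)
  ultimately show ?thesis by (rule that[OF v_def])
qed

text \<open>The induction runs over subspaces of one fixed space, so neither types nor coordinates
  change. If no member of the family is nonzero at a real point of \<open>S\<close> in the ball,
  every such point is its own witness; this includes dimension 0.\<close>

theorem lojasiewicz_holds:
  fixes S :: "'a::euclidean_space set"
  assumes "subspace S" "0 < r" "\<forall>f\<in>Fam. gateaux_holo r f \<and> f 0 = 0"
  shows "lojasiewicz r S Fam"
  using assms
proof (induction "dim S" arbitrary: S Fam r rule: less_induct)
  case less
  show ?case
  proof (cases "\<exists>f\<in>Fam. \<exists>x\<in>S. norm x < r \<and> f (x, 0) \<noteq> 0")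
    case False
    show ?thesis
      unfolding lojasiewicz_def
    proof (intro exI conjI allI impI)
      show "finite {}" "{} \<subseteq> Fam" "tolerance (\<lambda>_. 1)" "0 < r"
        using less.prems tolerance_const[of 1] by auto
      fix e :: real and x
      assume "0 < e" "x \<in> S" "norm x < r"
      then show "\<exists>z\<in>S. norm (z - x) \<le> e \<and> norm z < r \<and> (\<forall>f\<in>Fam. f (z, 0) = 0)"
        using False by (intro bexI[of _ x]) auto
    qed
  next
    case True
    then obtain f0 x where f0_mem: "f0 \<in> Fam" and x: "x \<in> S" "norm x < r" "f0 (x, 0) \<noteq> 0" by blast
    have f0': "gateaux_holo r f0" "f0 0 = 0" using less.prems(3) f0_mem by auto
    obtain v \<delta> r1 c0 where v_eq: "v = (1 / norm x) *\<^sub>R x" and fib: "root_fibre f0 v r r1 \<delta> c0"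
      and iso: "\<And>t. t \<noteq> 0 \<Longrightarrow> cmod t < \<delta> \<Longrightarrow> f0 (cscale t v) \<noteq> 0"
      by (rule root_fibre_exists[OF f0' x(2,3)]) (rule that)
    interpret root_fibre f0 v r r1 \<delta> c0 by (rule fib)
    let ?S' = "{x \<in> S. x \<bullet> v = 0}"
    have vS: "v \<in> S" using x(1) less.prems(1) by (simp add: v_eq subspace_scale)
    have sub': "subspace ?S'"
      using less.prems(1) by (auto simp: subspace_def inner_add_left)
    have "v \<notin> ?S'" using v by (simp add: norm_eq_1)
    then have "?S' \<noteq> S" using vS by blast
    then have "dim ?S' \<noteq> dim S"
      using subspace_dim_equal[OF sub' less.prems(1)] by auto
    moreover have "dim ?S' \<le> dim S" by (rule dim_subset) auto
    ultimately have dim: "dim ?S' < dim S" by simp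
    show ?thesis
    proof (rule lojasiewicz_of_fibre[OF f0_mem _ _ iso less.prems(1) vS])
      show "lojasiewicz r1 ?S' Fam'" if "\<forall>f\<in>Fam'. gateaux_holo r1 f \<and> f 0 = 0" for Fam'
        by (rule less.hyps[OF dim sub' r1(1) that])
    qed (use less.prems(3) in auto)
  qed
qed

section \<open>Complexification of real analytic maps\<close>

lemma multilinear_form_cong:
  "multilinear_form k A \<Longrightarrow> (\<And>i. i < k \<Longrightarrow> v i = w i) \<Longrightarrow> A v = A w"
  by (simp add: multilinear_form_def)

lemma multilinear_form_linear:
  "multilinear_form k A \<Longrightarrow> i < k \<Longrightarrow> linear (\<lambda>x. A (v(i := x)))"
  by (simp add: multilinear_form_def)

text \<open>Only the first \<open>n\<close> arguments are expanded; the others stay arbitrary, so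
  that the induction step can put a single summand into slot \<open>n\<close>.\<close>

lemma multilinear_form_sum_aux:
  assumes A: "multilinear_form k A" and "n \<le> k"
  shows "A (\<lambda>j. if j < n then (\<Sum>i\<in>I. c j i) else w j) =
    (\<Sum>\<tau> \<in> {..<n} \<rightarrow>\<^sub>E I. A (\<lambda>j. if j < n then c j (\<tau> j) else w j))"
  using assms(2)
proof (induction n arbitrary: w)
  case 0
  show ?case by simp
next
  case (Suc n)
  have "A (\<lambda>j. if j < Suc n then (\<Sum>i\<in>I. c j i) else w j) =
      A ((\<lambda>j. if j < n then (\<Sum>i\<in>I. c j i) else w j)(n := (\<Sum>i\<in>I. c n i)))"
    by (rule arg_cong[of _ _ A]) (auto simp: fun_eq_iff less_Suc_eq)
  also have "\<dots> = (\<Sum>i\<in>I. A ((\<lambda>j. if j < n then (\<Sum>i\<in>I. c j i) else w j)(n := c n i)))"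
    using Suc.prems by (intro linear_sum[OF multilinear_form_linear[OF A]]) simp
  also have "\<dots> = (\<Sum>i\<in>I. A (\<lambda>j. if j < n then (\<Sum>i\<in>I. c j i) else (w(n := c n i)) j))"
    by (intro sum.cong refl arg_cong[of _ _ A]) (auto simp: fun_eq_iff)
  also have "\<dots> = (\<Sum>i\<in>I. \<Sum>\<tau> \<in> {..<n} \<rightarrow>\<^sub>E I. A (\<lambda>j. if j < n then c j (\<tau> j) else (w(n := c n i)) j))"
    using Suc.prems by (intro sum.cong refl Suc.IH) simp
  also have "\<dots> = (\<Sum>(i, \<tau>) \<in> I \<times> ({..<n} \<rightarrow>\<^sub>E I). A (\<lambda>j. if j < Suc n then c j ((\<tau>(n := i)) j) else w j))"
    unfolding sum.cartesian_product
  proof (intro sum.cong refl, clarify)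
    fix i \<tau>
    show "A (\<lambda>j. if j < n then c j (\<tau> j) else (w(n := c n i)) j) =
        A (\<lambda>j. if j < Suc n then c j ((\<tau>(n := i)) j) else w j)"
      by (rule arg_cong[of _ _ A]) (auto simp: fun_eq_iff less_Suc_eq)
  qed
  also have "\<dots> = (\<Sum>\<tau> \<in> (\<lambda>(i, \<tau>). \<tau>(n := i)) ` (I \<times> ({..<n} \<rightarrow>\<^sub>E I)).
      A (\<lambda>j. if j < Suc n then c j (\<tau> j) else w j))"
    using inj_combinator[of n "{..<n}" "\<lambda>_. I"] by (simp add: sum.reindex case_prod_unfold)
  also have "(\<lambda>(i, \<tau>). \<tau>(n := i)) ` (I \<times> ({..<n} \<rightarrow>\<^sub>E I)) = ({..<Suc n} \<rightarrow>\<^sub>E I)"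
    by (simp add: lessThan_Suc PiE_insert_eq)
  finally show ?case .
qed

lemma multilinear_form_sum:
  assumes A: "multilinear_form k A"
  shows "A (\<lambda>j. \<Sum>i\<in>I. c j i) = (\<Sum>\<tau> \<in> {..<k} \<rightarrow>\<^sub>E I. A (\<lambda>j. c j (\<tau> j)))"
proof -
  have "A (\<lambda>j. \<Sum>i\<in>I. c j i) = A (\<lambda>j. if j < k then (\<Sum>i\<in>I. c j i) else 0)"
    by (rule multilinear_form_cong[OF A]) simp
  also have "\<dots> = (\<Sum>\<tau> \<in> {..<k} \<rightarrow>\<^sub>E I. A (\<lambda>j. if j < k then c j (\<tau> j) else 0))"
    by (rule multilinear_form_sum_aux[OF A order_refl])
  also have "\<dots> = (\<Sum>\<tau> \<in> {..<k} \<rightarrow>\<^sub>E I. A (\<lambda>j. c j (\<tau> j)))"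
    by (intro sum.cong refl multilinear_form_cong[OF A]) simp
  finally show ?thesis .
qed

lemma multilinear_form_scale:
  assumes A: "multilinear_form k A"
  shows "A (\<lambda>j. a j *\<^sub>R v j) = (\<Prod>j<k. a j) *\<^sub>R A v"
proof -
  have "A (\<lambda>j. if j < n then a j *\<^sub>R v j else v j) = (\<Prod>j<n. a j) *\<^sub>R A v" if "n \<le> k" for n
    using that
  proof (induction n)
    case 0
    show ?case by simp
  next
    case (Suc n)
    let ?v = "\<lambda>j. if j < n then a j *\<^sub>R v j else v j"
    have "A (\<lambda>j. if j < Suc n then a j *\<^sub>R v j else v j) = A (?v(n := a n *\<^sub>R v n))"
      by (rule arg_cong[of _ _ A]) (auto simp: fun_eq_iff less_Suc_eq)
    also have "\<dots> = a n *\<^sub>R A (?v(n := v n))"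
      using Suc.prems by (intro linear_scale[OF multilinear_form_linear[OF A]]) simp
    also have "?v(n := v n) = ?v" by auto
    finally show ?case using Suc by simp
  qed
  from this[of k] have "A (\<lambda>j. if j < k then a j *\<^sub>R v j else v j) = (\<Prod>j<k. a j) *\<^sub>R A v" by simp
  moreover have "A (\<lambda>j. a j *\<^sub>R v j) = A (\<lambda>j. if j < k then a j *\<^sub>R v j else v j)"
    by (rule multilinear_form_cong[OF A]) simp
  ultimately show ?thesis by simp
qed

text \<open>Inclusion-exclusion, read off from the expansion of a product whose factors 1 +
  \<open>?f i\<close> are 1 for \<open>i\<close> in \<open>R\<close> and 0 otherwise.\<close>

lemma sum_Pow_sign_eq:
  fixes R :: "nat set"
  shows "(\<Sum>S\<in>Pow {..<k}. (-1) ^ (k - card S) * (if R \<inter> {..<k} \<subseteq> S then 1 else 0)) =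
    (if {..<k} \<subseteq> R then 1 else 0 :: real)"
proof -
  let ?f = "\<lambda>i. if i \<in> R then 0 else (-1 :: real)"
  have "(-1) ^ (k - card S) * (if R \<inter> {..<k} \<subseteq> S then 1 else 0) = (\<Prod>i\<in>S. 1) * (\<Prod>i\<in>{..<k} - S. ?f i)"
    if S: "S \<in> Pow {..<k}" for S
  proof (cases "R \<inter> {..<k} \<subseteq> S")
    case True
    have "(\<Prod>i\<in>{..<k} - S. ?f i) = (\<Prod>i\<in>{..<k} - S. -1)"
      using True by (intro prod.cong) auto
    also have "\<dots> = (-1) ^ (k - card S)"
      using S by (simp add: card_Diff_subset finite_subset[of S "{..<k}"])
    finally show ?thesis using True by simp
  next
    case False
    then obtain i where "i \<in> R" "i < k" "i \<notin> S" by auto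
    then have "(\<Prod>i\<in>{..<k} - S. ?f i) = 0" by (intro prod_zero) auto
    then show ?thesis using False by simp
  qed
  then have "(\<Sum>S\<in>Pow {..<k}. (-1) ^ (k - card S) * (if R \<inter> {..<k} \<subseteq> S then 1 else 0)) =
      (\<Sum>S\<in>Pow {..<k}. (\<Prod>i\<in>S. 1) * (\<Prod>i\<in>{..<k} - S. ?f i))"
    by (rule sum.cong[OF refl])
  also have "\<dots> = (\<Prod>i<k. 1 + ?f i)" by (simp add: prod_add)
  also have "\<dots> = (if {..<k} \<subseteq> R then 1 else 0)"
  proof (cases "{..<k} \<subseteq> R")
    case True
    then show ?thesis by (auto intro!: prod.neutral)
  next
    case False
    then obtain i where "i < k" "i \<notin> R" by auto
    then have "(\<Prod>i<k. 1 + ?f i) = 0" by (intro prod_zero) auto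
    then show ?thesis using False by simp
  qed
  finally show ?thesis .
qed

lemma permutes_of_onto_lessThan:
  fixes \<tau> :: "nat \<Rightarrow> nat"
  assumes "{..<k} \<subseteq> \<tau> ` {..<k}"
  shows "\<tau> ` {..<k} = {..<k}" "(\<lambda>j. if j < k then \<tau> j else j) permutes {..<k}"
proof -
  have "card (\<tau> ` {..<k}) \<le> card {..<k}" by (rule card_image_le) simp
  then show im: "\<tau> ` {..<k} = {..<k}" using card_seteq[OF _ assms] by simp
  then have "inj_on \<tau> {..<k}" by (intro eq_card_imp_inj_on) simp_all
  then have "bij_betw \<tau> {..<k} {..<k}" using im by (simp add: bij_betw_def)
  then have "bij_betw (\<lambda>j. if j < k then \<tau> j else j) {..<k} {..<k}"
    using bij_betw_cong[of "{..<k}" \<tau> "\<lambda>j. if j < k then \<tau> j else j" "{..<k}"] by simp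
  then show "(\<lambda>j. if j < k then \<tau> j else j) permutes {..<k}" by (rule bij_imp_permutes) simp
qed

text \<open>The extra value \<open>k\<close> will stand for a base point in the polarization
  formula. A tuple of length \<open>k\<close> that takes all \<open>k\<close> smaller values has no
  slot left for it and is a permutation.\<close>

lemma card_PiE_onto_lessThan:
  "card {\<tau> \<in> {..<k} \<rightarrow>\<^sub>E {..k}. {..<k} \<subseteq> \<tau> ` {..<k}} = fact k"
proof -
  have "bij_betw (\<lambda>\<pi>. restrict \<pi> {..<k}) {\<pi>. \<pi> permutes {..<k}}
      {\<tau> \<in> {..<k} \<rightarrow>\<^sub>E {..k}. {..<k} \<subseteq> \<tau> ` {..<k}}"
  proof (rule bij_betwI[where g = "\<lambda>\<tau> j. if j < k then \<tau> j else j"])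
    show "(\<lambda>\<pi>. restrict \<pi> {..<k}) \<in> {\<pi>. \<pi> permutes {..<k}} \<rightarrow> {\<tau> \<in> {..<k} \<rightarrow>\<^sub>E {..k}. {..<k} \<subseteq> \<tau> ` {..<k}}"
    proof
      fix \<pi> assume "\<pi> \<in> {\<pi>. \<pi> permutes {..<k}}"
      then have \<pi>: "\<pi> ` {..<k} = {..<k}" by (simp add: permutes_image)
      then have "\<pi> j \<le> k" if "j < k" for j using that by (metis imageI lessThan_iff less_imp_le)
      moreover have "restrict \<pi> {..<k} ` {..<k} = {..<k}" using \<pi> by simp
      ultimately show "restrict \<pi> {..<k} \<in> {\<tau> \<in> {..<k} \<rightarrow>\<^sub>E {..k}. {..<k} \<subseteq> \<tau> ` {..<k}}"
        by (simp add: PiE_iff)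
    qed
    show "(\<lambda>\<tau> j. if j < k then \<tau> j else j) \<in> {\<tau> \<in> {..<k} \<rightarrow>\<^sub>E {..k}. {..<k} \<subseteq> \<tau> ` {..<k}} \<rightarrow> {\<pi>. \<pi> permutes {..<k}}"
      using permutes_of_onto_lessThan(2) by blast
    show "(\<lambda>j. if j < k then restrict \<pi> {..<k} j else j) = \<pi>" if "\<pi> \<in> {\<pi>. \<pi> permutes {..<k}}" for \<pi>
      using that by (auto simp: fun_eq_iff permutes_not_in)
    show "restrict (\<lambda>j. if j < k then \<tau> j else j) {..<k} = \<tau>"
      if "\<tau> \<in> {\<tau> \<in> {..<k} \<rightarrow>\<^sub>E {..k}. {..<k} \<subseteq> \<tau> ` {..<k}}" for \<tau>
    proof -
      have "restrict (\<lambda>j. if j < k then \<tau> j else j) {..<k} = restrict \<tau> {..<k}"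
        by (simp add: restrict_def fun_eq_iff)
      also have "\<dots> = \<tau>" using that by (intro PiE_restrict[of _ _ "\<lambda>_. {..k}"]) simp
      finally show ?thesis .
    qed
  qed
  then have "card {\<pi>. \<pi> permutes {..<k}} = card {\<tau> \<in> {..<k} \<rightarrow>\<^sub>E {..k}. {..<k} \<subseteq> \<tau> ` {..<k}}"
    by (rule bij_betw_same_card)
  then show ?thesis by (simp add: card_permutations)
qed

text \<open>After multilinear expansion the alternating sum keeps only the terms in which every
  \<open>g i\<close> occurs, and these contain no \<open>h0\<close>. An arbitrary base point is
  allowed because the ball on which the diagonal gets bounded need not be centred at the
  origin.\<close>

lemma polarization:
  fixes A :: "(nat \<Rightarrow> 'a::real_vector) \<Rightarrow> 'b::real_vector"
  assumes A: "multilinear_form k A" and sym: "symmetric_form k A"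
  shows "(\<Sum>S\<in>Pow {..<k}. (-1) ^ (k - card S) *\<^sub>R A (\<lambda>_. h0 + (\<Sum>i\<in>S. g i))) = fact k *\<^sub>R A g"
proof -
  define u where "u = (\<lambda>i. if i = k then h0 else g i)"
  define sel where "sel = (\<lambda>S i. if i = k \<or> i \<in> S then 1 else (0::real))"
  define X where "X = {\<tau> \<in> {..<k} \<rightarrow>\<^sub>E {..k}. {..<k} \<subseteq> \<tau> ` {..<k}}"
  have pt: "h0 + (\<Sum>i\<in>S. g i) = (\<Sum>i\<in>{..k}. sel S i *\<^sub>R u i)" if S: "S \<subseteq> {..<k}" for S
  proof -
    have "(\<Sum>i\<in>{..k}. sel S i *\<^sub>R u i) = h0 + (\<Sum>i<k. sel S i *\<^sub>R u i)"
      by (simp add: lessThan_Suc_atMost[symmetric] sel_def u_def add.commute)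
    also have "(\<Sum>i<k. sel S i *\<^sub>R u i) = (\<Sum>i\<in>S. g i)"
      using S by (intro sum.mono_neutral_cong_right) (auto simp: sel_def u_def)
    finally show ?thesis by simp
  qed
  have selprod: "(\<Prod>j<k. sel S (\<tau> j)) = (if \<tau> ` {..<k} \<inter> {..<k} \<subseteq> S then 1 else 0)"
    if \<tau>: "\<tau> \<in> {..<k} \<rightarrow>\<^sub>E {..k}" for S \<tau>
  proof (cases "\<tau> ` {..<k} \<inter> {..<k} \<subseteq> S")
    case True
    have "\<tau> j = k \<or> \<tau> j \<in> S" if "j < k" for j
    proof -
      have "\<tau> j \<le> k" using \<tau> that by auto
      then show ?thesis using True that by (cases "\<tau> j = k") auto
    qed
    then show ?thesis using True by (auto simp: sel_def intro!: prod.neutral)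
  next
    case False
    then obtain j where "j < k" "\<tau> j < k" "\<tau> j \<notin> S" by auto
    then have "(\<Prod>j<k. sel S (\<tau> j)) = 0" by (intro prod_zero) (auto simp: sel_def)
    then show ?thesis using False by simp
  qed
  have expand: "A (\<lambda>_. h0 + (\<Sum>i\<in>S. g i)) =
      (\<Sum>\<tau> \<in> {..<k} \<rightarrow>\<^sub>E {..k}. (if \<tau> ` {..<k} \<inter> {..<k} \<subseteq> S then 1 else 0) *\<^sub>R A (\<lambda>j. u (\<tau> j)))"
    if S: "S \<subseteq> {..<k}" for S
    unfolding pt[OF S] multilinear_form_sum[OF A] multilinear_form_scale[OF A]
    by (intro sum.cong refl) (simp only: selprod)
  have "(\<Sum>S\<in>Pow {..<k}. (-1) ^ (k - card S) *\<^sub>R A (\<lambda>_. h0 + (\<Sum>i\<in>S. g i))) =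
     (\<Sum>S\<in>Pow {..<k}. \<Sum>\<tau> \<in> {..<k} \<rightarrow>\<^sub>E {..k}.
        ((-1) ^ (k - card S) * (if \<tau> ` {..<k} \<inter> {..<k} \<subseteq> S then 1 else 0)) *\<^sub>R A (\<lambda>j. u (\<tau> j)))"
    by (intro sum.cong refl) (simp add: expand scaleR_sum_right)
  also have "\<dots> = (\<Sum>\<tau> \<in> {..<k} \<rightarrow>\<^sub>E {..k}. (\<Sum>S\<in>Pow {..<k}.
        (-1) ^ (k - card S) * (if \<tau> ` {..<k} \<inter> {..<k} \<subseteq> S then 1 else 0)) *\<^sub>R A (\<lambda>j. u (\<tau> j)))"
    by (subst sum.swap) (simp only: scaleR_sum_left)
  also have "\<dots> = (\<Sum>\<tau> \<in> {..<k} \<rightarrow>\<^sub>E {..k}. (if {..<k} \<subseteq> \<tau> ` {..<k} then 1 else 0) *\<^sub>R A (\<lambda>j. u (\<tau> j)))"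
    by (simp only: sum_Pow_sign_eq)
  also have "\<dots> = (\<Sum>\<tau> \<in> X. A (\<lambda>j. u (\<tau> j)))"
    unfolding X_def by (intro sum.mono_neutral_cong_right) (auto intro: finite_PiE)
  also have "\<dots> = (\<Sum>\<tau> \<in> X. A g)"
  proof (rule sum.cong[OF refl])
    fix \<tau> assume "\<tau> \<in> X"
    then have sub: "{..<k} \<subseteq> \<tau> ` {..<k}" by (simp add: X_def)
    note im = permutes_of_onto_lessThan(1)[OF sub]
    define \<pi> where "\<pi> = (\<lambda>j. if j < k then \<tau> j else j)"
    have "\<pi> permutes {..<k}" unfolding \<pi>_def by (rule permutes_of_onto_lessThan(2)[OF sub])
    then have "A (g \<circ> \<pi>) = A g" using sym by (simp add: symmetric_form_def)
    moreover have "A (\<lambda>j. u (\<tau> j)) = A (g \<circ> \<pi>)"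
    proof (rule multilinear_form_cong[OF A])
      fix j assume "j < k"
      moreover have "\<tau> j < k" using im \<open>j < k\<close> by (metis imageI lessThan_iff)
      ultimately show "u (\<tau> j) = (g \<circ> \<pi>) j" by (simp add: u_def \<pi>_def)
    qed
    ultimately show "A (\<lambda>j. u (\<tau> j)) = A g" by simp
  qed
  also have "\<dots> = fact k *\<^sub>R A g"
    by (simp add: X_def card_PiE_onto_lessThan sum_constant_scaleR)
  finally show ?thesis .
qed

text \<open>One term of the series for exp k. It turns the polarization constant k^k / k! into a
  geometric factor.\<close>

lemma power_self_le_fact_exp: "real k ^ k \<le> fact k * exp 1 ^ k"
proof -
  have s: "(\<lambda>n. real k ^ n /\<^sub>R fact n) sums exp (real k)" by (rule exp_converges)
  have "(\<Sum>n\<in>{k}. real k ^ n /\<^sub>R fact n) \<le> (\<Sum>n. real k ^ n /\<^sub>R fact n)"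
    using sums_summable[OF s] by (intro sum_le_suminf) auto
  then have "(\<Sum>n\<in>{k}. real k ^ n /\<^sub>R fact n) \<le> exp (real k)"
    using sums_unique[OF s] by simp
  moreover have "exp (real k) = exp 1 ^ k" by (metis exp_of_nat_mult mult.right_neutral)
  ultimately show ?thesis by (simp add: field_simps)
qed

lemma multilinear_form_bound_from_diagonal:
  fixes A :: "(nat \<Rightarrow> 'a::real_normed_vector) \<Rightarrow> 'b::real_normed_vector"
  assumes A: "multilinear_form k A" "symmetric_form k A" and "0 < \<rho>"
    and N: "\<And>h. h \<in> cball h0 \<rho> \<Longrightarrow> norm (A (\<lambda>_. h)) \<le> N"
    and v: "\<And>j. j < k \<Longrightarrow> norm (v j) \<le> 1"
  shows "norm (A v) \<le> N * (2 * exp 1 / \<rho>) ^ k"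
proof -
  \<comment> \<open>Sums of at most \<open>k\<close> vectors of norm at most \<rho> / k have norm at
    most \<open>\<rho>\<close>, so polarization evaluates the diagonal only inside the ball;
    \<open>max k 1\<close> covers k = 0.\<close>
  define c where "c = \<rho> / real (max k 1)"
  have c: "0 < c" using \<open>0 < \<rho>\<close> by (simp add: c_def)
  define g where "g = (\<lambda>j. c *\<^sub>R v j)"
  have "norm (fact k *\<^sub>R A g) \<le> (\<Sum>S\<in>Pow {..<k}. N)"
    unfolding polarization[OF A, of h0 g, symmetric]
  proof (rule sum_norm_le)
    fix S assume S: "S \<in> Pow {..<k}"
    have "norm (\<Sum>i\<in>S. g i) \<le> real (card S) * c"
    proof (rule sum_norm_bound)
      fix i assume "i \<in> S"
      then have "norm (v i) \<le> 1" using S v by auto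
      then show "norm (g i) \<le> c" using c by (simp add: g_def mult_le_cancel_left1)
    qed
    also have "real (card S) * c \<le> real (max k 1) * c"
      using card_mono[of "{..<k}" S] S c by (intro mult_right_mono) auto
    also have "\<dots> = \<rho>" by (simp add: c_def)
    finally have "norm (A (\<lambda>_. h0 + (\<Sum>i\<in>S. g i))) \<le> N"
      by (intro N) (simp add: dist_norm)
    then show "norm ((-1) ^ (k - card S) *\<^sub>R A (\<lambda>_. h0 + (\<Sum>i\<in>S. g i))) \<le> N"
      by (simp add: power_abs)
  qed
  also have "\<dots> = 2 ^ k * N" by (simp add: card_Pow)
  finally have "fact k * norm (A g) \<le> 2 ^ k * N" by simp
  moreover have "A g = c ^ k *\<^sub>R A v"
    unfolding g_def using multilinear_form_scale[OF A(1), of "\<lambda>_. c" v] by simp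
  ultimately have *: "fact k * (c ^ k * norm (A v)) \<le> 2 ^ k * N" using c by simp
  have ck: "c ^ k * real k ^ k = \<rho> ^ k"
  proof (cases "k = 0")
    case False
    then have "c * real k = \<rho>" by (simp add: c_def max_def)
    then show ?thesis by (metis power_mult_distrib)
  qed simp
  have "\<rho> ^ k * norm (A v) = real k ^ k * (c ^ k * norm (A v))" by (simp add: ck[symmetric] mult_ac)
  also have "\<dots> \<le> (fact k * exp 1 ^ k) * (c ^ k * norm (A v))"
    using c by (intro mult_right_mono power_self_le_fact_exp) auto
  also have "\<dots> = exp 1 ^ k * (fact k * (c ^ k * norm (A v)))" by (simp only: mult_ac)
  also have "\<dots> \<le> exp 1 ^ k * (2 ^ k * N)" by (intro mult_left_mono *) simp
  finally have "norm (A v) \<le> exp 1 ^ k * (2 ^ k * N) / \<rho> ^ k"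
    using \<open>0 < \<rho>\<close> by (simp add: pos_le_divide_eq mult.commute)
  also have "\<dots> = N * (2 * exp 1 / \<rho>) ^ k"
    by (simp add: power_divide power_mult_distrib mult_ac)
  finally show ?thesis .
qed

text \<open>A pointwise bound on the diagonal becomes uniform on some ball by Baire's theorem, and
  polarization around the centre of that ball bounds the whole multilinear form.\<close>

lemma multilinear_series_bound:
  fixes A :: "nat \<Rightarrow> (nat \<Rightarrow> 'a::euclidean_space) \<Rightarrow> 'b::real_normed_vector"
  assumes A: "\<And>k. multilinear_form k (A k)" "\<And>k. symmetric_form k (A k)" "\<And>k. continuous_on UNIV (A k)"
    and e: "0 < e" and conv: "\<And>h. norm h \<le> e \<Longrightarrow> summable (\<lambda>k. A k (\<lambda>_. h))"
  obtains C M where "0 < C" "0 < M"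
    "\<And>k v. (\<And>j. j < k \<Longrightarrow> norm (v j) \<le> 1) \<Longrightarrow> norm (A k v) \<le> C * M ^ k"
proof -
  define E where "E = (\<lambda>N::nat. {h \<in> cball 0 e. \<forall>k. norm (A k (\<lambda>_. h)) \<le> real N})"
  have cont: "continuous_on UNIV (\<lambda>h. A k (\<lambda>_. h))" for k
    by (rule continuous_on_compose2[OF A(3)]) (auto intro!: continuous_on_coordinatewise_then_product)
  have closedE: "closed (E N)" for N
  proof -
    have "E N = cball 0 e \<inter> (\<Inter>k. {h. norm (A k (\<lambda>_. h)) \<le> real N})" by (auto simp: E_def)
    moreover have "closed {h. norm (A k (\<lambda>_. h)) \<le> real N}" for k
      by (intro closed_Collect_le continuous_on_norm cont continuous_on_const)
    ultimately show ?thesis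
      using closed_INT[of UNIV "\<lambda>k. {h. norm (A k (\<lambda>_. h)) \<le> real N}"] by (simp add: closed_Int)
  qed
  have cover: "\<exists>N. h \<in> E N" if h: "h \<in> cball 0 e" for h
  proof -
    have "(\<lambda>k. A k (\<lambda>_. h)) \<longlonglongrightarrow> 0" using conv[of h] h by (intro summable_LIMSEQ_zero) auto
    then have "Bseq (\<lambda>k. A k (\<lambda>_. h))" using convergentI convergent_imp_Bseq by blast
    then obtain B where "\<And>k. norm (A k (\<lambda>_. h)) \<le> B" unfolding Bseq_def by blast
    moreover obtain N :: nat where "B \<le> real N" using real_arch_simple by blast
    ultimately have "h \<in> E N" using h unfolding E_def by (auto intro: order_trans)
    then show ?thesis ..
  qed
  \<comment> \<open>If every complement of \<open>E N\<close> were dense in the closed ball, Baire's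
    theorem would make their intersection dense, but it is empty by \<open>cover\<close>.\<close>
  have "\<exists>N. \<not> cball 0 e \<subseteq> closure (cball 0 e - E N)"
  proof (rule ccontr)
    assume dense: "\<not> ?thesis"
    have "openin (top_of_set (cball 0 e)) (cball 0 e - E N)" for N
      unfolding openin_open using closedE[of N] by (intro exI[of _ "- E N"]) (auto simp: open_Compl)
    then have "cball 0 e \<subseteq> closure (\<Inter>N. cball 0 e - E N)"
      using dense by (intro Baire) auto
    moreover have "(\<Inter>N. cball 0 e - E N) = {}" using cover by auto
    ultimately have "cball 0 e \<subseteq> ({} :: 'a set)" by (simp only: closure_empty)
    moreover have "0 \<in> cball (0 :: 'a) e" using e by simp
    ultimately show False by blast
  qed
  then obtain N x where x: "x \<in> cball 0 e" "x \<notin> closure (cball 0 e - E N)"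
    by (meson subsetI)
  then have "open (- closure (cball 0 e - E N))" "x \<in> - closure (cball 0 e - E N)" by auto
  \<comment> \<open>The point \<open>x\<close> may lie on the boundary of the ball, but its
    neighbourhood also meets the open ball, where the centre \<open>h0\<close> can be taken.\<close>
  then have "- closure (cball 0 e - E N) \<inter> ball 0 e \<noteq> {}"
    using x(1) e by (metis closure_ball open_Int_closure_eq_empty disjoint_iff)
  then obtain h0 where h0: "h0 \<in> - closure (cball 0 e - E N) \<inter> ball 0 e" by blast
  have "open (- closure (cball 0 e - E N) \<inter> ball 0 e)" by auto
  then obtain \<rho> where \<rho>: "0 < \<rho>" "cball h0 \<rho> \<subseteq> - closure (cball 0 e - E N) \<inter> ball 0 e"
    using h0 open_contains_cball by blast
  have "h \<in> E N" if "h \<in> cball h0 \<rho>" for h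
  proof -
    have "h \<in> - closure (cball 0 e - E N)" "h \<in> ball 0 e" using that \<rho>(2) by blast+
    then show ?thesis using closure_subset[of "cball 0 e - E N"] ball_subset_cball[of 0 e] by blast
  qed
  then have bound: "norm (A k (\<lambda>_. h)) \<le> real N" if "h \<in> cball h0 \<rho>" for h k
    using that by (simp add: E_def)
  show ?thesis
  proof (rule that)
    show "0 < real N + 1" "0 < 2 * exp 1 / \<rho>" using \<rho> by auto
    fix k and v :: "nat \<Rightarrow> 'a" assume v: "\<And>j. j < k \<Longrightarrow> norm (v j) \<le> 1"
    have "norm (A k v) \<le> real N * (2 * exp 1 / \<rho>) ^ k"
      by (rule multilinear_form_bound_from_diagonal[OF A(1,2) \<rho>(1)]) (fact bound, fact v)
    also have "\<dots> \<le> (real N + 1) * (2 * exp 1 / \<rho>) ^ k"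
      using \<rho> by (intro mult_right_mono) auto
    finally show "norm (A k v) \<le> (real N + 1) * (2 * exp 1 / \<rho>) ^ k" .
  qed
qed

section \<open>Power series in complexified coordinates\<close>

lemma norm_ccoord_le:
  assumes "b \<in> Basis"
  shows "cmod (ccoord b z) \<le> norm z"
proof -
  have "\<bar>fst z \<bullet> b\<bar>\<^sup>2 \<le> (norm (fst z))\<^sup>2" "\<bar>snd z \<bullet> b\<bar>\<^sup>2 \<le> (norm (snd z))\<^sup>2"
    by (rule power_mono[OF Basis_le_norm[OF assms] abs_ge_zero])+
  then show ?thesis by (simp add: ccoord_def cmod_def norm_prod_def)
qed

lemma gateaux_holo_suminf:
  assumes T: "\<And>k::nat. gateaux_holo r (T k)"
    and B: "\<And>k z. z \<in> ball 0 r \<Longrightarrow> cmod (T k z) \<le> B k" and "summable B"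
  shows "gateaux_holo r (\<lambda>z. \<Sum>k. T k z)"
proof (rule gateaux_holoI)
  have "uniform_limit (ball 0 r) (\<lambda>n z. \<Sum>k<n. T k z) (\<lambda>z. \<Sum>k. T k z) sequentially"
    using B \<open>summable B\<close> by (rule Weierstrass_m_test)
  then show "continuous_on (ball 0 r) (\<lambda>z. \<Sum>k. T k z)"
    by (rule uniform_limit_theorem[rotated])
       (auto intro!: always_eventually continuous_on_sum gateaux_holo_cont[OF T])
  fix z :: "'a \<times> 'a" and d
  let ?A = "{s. z + cscale s d \<in> ball 0 r}"
  have lim: "uniform_limit ?A (\<lambda>n s. \<Sum>k<n. T k (z + cscale s d)) (\<lambda>s. \<Sum>k. T k (z + cscale s d)) sequentially"
    by (rule Weierstrass_m_test[OF _ \<open>summable B\<close>]) (rule B, simp)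
  show "(\<lambda>s. \<Sum>k. T k (z + cscale s d)) holomorphic_on ?A"
  proof (rule holomorphic_uniform_sequence[OF open_cscale_line])
    show "(\<lambda>s. \<Sum>k<n. T k (z + cscale s d)) holomorphic_on ?A" for n
      by (intro holomorphic_on_sum gateaux_holo_line[OF T]) simp
    fix s assume "s \<in> ?A"
    then obtain e where "0 < e" "cball s e \<subseteq> ?A"
      using open_cscale_line open_contains_cball by blast
    then show "\<exists>e>0. cball s e \<subseteq> ?A \<and>
        uniform_limit (cball s e) (\<lambda>n s. \<Sum>k<n. T k (z + cscale s d)) (\<lambda>s. \<Sum>k. T k (z + cscale s d)) sequentially"
      using uniform_limit_on_subset[OF lim] by blast
  qed
qed

text \<open>The diagonal is expanded in real coordinates, which are then replaced by complex ones.
  In degree \<open>k\<close> there are \<open>DIM('a) ^ k\<close> terms, each at most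
  \<open>r ^ k * (C * M ^ k)\<close>, so the condition on \<open>r\<close> yields a geometric
  majorant.\<close>

lemma multilinear_series_complexify:
  fixes A :: "nat \<Rightarrow> (nat \<Rightarrow> 'a::euclidean_space) \<Rightarrow> real" and C M r :: real
  assumes A: "\<And>k. multilinear_form k (A k)"
    and bound: "\<And>k v. (\<And>j. j < k \<Longrightarrow> norm (v j) \<le> 1) \<Longrightarrow> \<bar>A k v\<bar> \<le> C * M ^ k"
    and "0 \<le> C" "0 < M" and r: "0 < r" "r * (DIM('a) * M) \<le> 1/2"
  obtains f where "gateaux_holo r f" "\<And>h. norm h < r \<Longrightarrow> f (h, 0) = of_real (\<Sum>k. A k (\<lambda>_. h))"
proof -
  define T where "T = (\<lambda>k z. \<Sum>\<tau> \<in> {..<k} \<rightarrow>\<^sub>E Basis. (\<Prod>j<k. ccoord (\<tau> j) z) * of_real (A k \<tau>))"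
  have hol: "gateaux_holo r (T k)" for k
    unfolding T_def
    by (intro gateaux_holo_sum gateaux_holo_mult gateaux_holo_prod gateaux_holo_ccoord gateaux_holo_const)
  have Tb: "cmod (T k z) \<le> C * (1/2) ^ k" if z: "z \<in> ball 0 r" for k z
  proof -
    have "cmod (T k z) \<le> (\<Sum>\<tau> \<in> {..<k} \<rightarrow>\<^sub>E (Basis :: 'a set). r ^ k * (C * M ^ k))"
      unfolding T_def
    proof (rule sum_norm_le)
      fix \<tau> :: "nat \<Rightarrow> 'a" assume \<tau>: "\<tau> \<in> {..<k} \<rightarrow>\<^sub>E Basis"
      have B: "\<tau> j \<in> Basis" if "j < k" for j using \<tau> that by auto
      have cr: "cmod (ccoord (\<tau> j) z) \<le> r" if "j < k" for j
        using norm_ccoord_le[OF B[OF that], of z] z by simp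
      have "cmod (\<Prod>j<k. ccoord (\<tau> j) z) \<le> (\<Prod>j<k. r)"
        unfolding prod_norm[symmetric] using cr by (intro prod_mono) simp
      moreover have "\<bar>A k \<tau>\<bar> \<le> C * M ^ k" using B by (intro bound) simp
      ultimately show "cmod ((\<Prod>j<k. ccoord (\<tau> j) z) * of_real (A k \<tau>)) \<le> r ^ k * (C * M ^ k)"
        unfolding norm_mult by (intro mult_mono) (use r in auto)
    qed
    also have "\<dots> = C * (r * (DIM('a) * M)) ^ k"
      by (simp add: card_funcsetE power_mult_distrib mult_ac)
    also have "\<dots> \<le> C * (1/2) ^ k"
      using r \<open>0 < M\<close> \<open>0 \<le> C\<close> by (intro mult_left_mono power_mono) auto
    finally show ?thesis .
  qed
  have sB: "summable (\<lambda>k. C * (1/2) ^ k :: real)" by (intro summable_mult) simp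
  have real: "T k (h, 0) = of_real (A k (\<lambda>_. h))" for k h
  proof -
    have "A k (\<lambda>_. h) = A k (\<lambda>_. \<Sum>b\<in>Basis. (h \<bullet> b) *\<^sub>R b)" by (simp add: euclidean_representation)
    also have "\<dots> = (\<Sum>\<tau> \<in> {..<k} \<rightarrow>\<^sub>E Basis. (\<Prod>j<k. h \<bullet> \<tau> j) * A k \<tau>)"
      unfolding multilinear_form_sum[OF A] multilinear_form_scale[OF A] by simp
    finally show ?thesis
      by (simp add: T_def ccoord_def complex_of_real_def[symmetric])
  qed
  show ?thesis
  proof (rule that)
    show "gateaux_holo r (\<lambda>z. \<Sum>k. T k z)" by (rule gateaux_holo_suminf[OF hol Tb sB])
    fix h :: 'a assume h: "norm h < r"
    have "\<bar>A k (\<lambda>_. h)\<bar> \<le> C * (1/2) ^ k" for k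
      using Tb[of "(h, 0)" k] h by (simp add: real norm_Pair)
    then have "summable (\<lambda>k. A k (\<lambda>_. h))"
      by (intro summable_comparison_test'[OF sB, of 0]) simp
    then show "(\<Sum>k. T k (h, 0)) = of_real (\<Sum>k. A k (\<lambda>_. h))"
      by (simp add: real suminf_of_real)
  qed
qed

text \<open>One radius serves all functionals \<open>l\<close>: the multilinear forms are bounded in
  the norm of the target space, and applying \<open>l\<close> changes the constant in front but not
  the geometric factor. Hence all matrix entries extend to a common ball.\<close>

lemma real_analytic_complex_extension:
  fixes F :: "'a::euclidean_space \<Rightarrow> 'b::real_normed_vector"
  assumes "real_analytic_on F U" "p \<in> U"
  obtains r where "0 < r"
    "\<And>l :: 'b \<Rightarrow> real. bounded_linear l \<Longrightarrow>
      \<exists>f. gateaux_holo r f \<and> (\<forall>h. norm h < r \<longrightarrow> f (h, 0) = of_real (l (F (p + h))))"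
proof -
  obtain A where A: "\<And>k. multilinear_form k (A k)" "\<And>k. symmetric_form k (A k)" "\<And>k. continuous_on UNIV (A k)"
    and ev: "\<forall>\<^sub>F h in nhds 0. (\<lambda>k. A k (\<lambda>_. h)) sums F (p + h)"
    using assms unfolding real_analytic_on_def by meson
  obtain e0 where e0: "0 < e0" "\<And>h. norm h < e0 \<Longrightarrow> (\<lambda>k. A k (\<lambda>_. h)) sums F (p + h)"
    using ev unfolding eventually_nhds_metric by auto
  define e where "e = e0 / 2"
  have e: "0 < e" "e < e0" using e0 by (auto simp: e_def)
  have "summable (\<lambda>k. A k (\<lambda>_. h))" if "norm h \<le> e" for h
    using e0(2)[of h] that e by (auto intro: sums_summable)
  from multilinear_series_bound[where A = A, OF A e(1) this] obtain C M where CM: "0 < C" "0 < M"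
    and bound: "\<And>k v. (\<And>j. j < k \<Longrightarrow> norm (v j) \<le> 1) \<Longrightarrow> norm (A k v) \<le> C * M ^ k" by metis
  define r where "r = min e (1 / (2 * (DIM('a) * M)))"
  have r: "0 < r" "r \<le> e" "r * (DIM('a) * M) \<le> 1/2"
  proof -
    have DM: "0 < DIM('a) * M" using CM by simp
    then show "0 < r" "r \<le> e" using e by (auto simp: r_def)
    have "r * (DIM('a) * M) \<le> 1 / (2 * (DIM('a) * M)) * (DIM('a) * M)"
      using DM by (intro mult_right_mono) (auto simp: r_def)
    then show "r * (DIM('a) * M) \<le> 1/2" using CM by simp
  qed
  show ?thesis
  proof (rule that[OF r(1)])
    fix l :: "'b \<Rightarrow> real" assume l: "bounded_linear l"
    obtain K where K: "0 < K" "\<And>x. norm (l x) \<le> norm x * K"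
      using bounded_linear.pos_bounded[OF l] by blast
    have ml: "multilinear_form k (\<lambda>v. l (A k v))" for k
      unfolding multilinear_form_def
    proof (intro conjI allI impI)
      show "l (A k v) = l (A k w)" if "\<forall>i<k. v i = w i" for v w
        using multilinear_form_cong[OF A(1), of k v w] that by simp
      show "linear (\<lambda>x. l (A k (v(i := x))))" if "i < k" for i v
        using linear_compose[OF multilinear_form_linear[OF A(1) that] bounded_linear.linear[OF l]]
        by (simp add: o_def)
    qed
    have lb: "\<bar>l (A k v)\<bar> \<le> (C * K) * M ^ k" if "\<And>j. j < k \<Longrightarrow> norm (v j) \<le> 1" for k v
    proof -
      have "\<bar>l (A k v)\<bar> \<le> norm (A k v) * K" using K(2)[of "A k v"] by simp
      also have "\<dots> \<le> (C * M ^ k) * K" using K(1) by (intro mult_right_mono bound that) auto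
      finally show ?thesis by (simp add: mult_ac)
    qed
    obtain f where f: "gateaux_holo r f" "\<And>h. norm h < r \<Longrightarrow> f (h, 0) = of_real (\<Sum>k. l (A k (\<lambda>_. h)))"
      using multilinear_series_complexify[OF ml lb _ CM(2) r(1,3)] CM K by (metis less_imp_le mult_pos_pos)
    have "(\<Sum>k. l (A k (\<lambda>_. h))) = l (F (p + h))" if "norm h < r" for h
      using bounded_linear.sums[OF l e0(2)] that r e by (simp add: sums_iff)
    then show "\<exists>f. gateaux_holo r f \<and> (\<forall>h. norm h < r \<longrightarrow> f (h, 0) = of_real (l (F (p + h))))"
      using f by auto
  qed
qed

text \<open>Applied with the projections \<open>fst\<close> and \<open>snd\<close>, this turns
  functions of \<open>p\<close> or of \<open>q\<close> alone into functions of the pair.\<close>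

lemma gateaux_holo_linear_compose:
  fixes P :: "'b::euclidean_space \<Rightarrow> 'a::euclidean_space"
  assumes f: "gateaux_holo r f" and P: "linear P" "\<And>x. norm (P x) \<le> norm x"
  shows "gateaux_holo r (\<lambda>z. f (P (fst z), P (snd z)))"
proof (rule gateaux_holoI)
  have nb: "(P (fst z), P (snd z)) \<in> ball 0 r" if "z \<in> ball 0 r" for z
  proof -
    have "norm (P (fst z), P (snd z)) \<le> norm z"
      unfolding norm_Pair norm_prod_def[of z] using P(2)[of "fst z"] P(2)[of "snd z"]
      by (intro real_sqrt_le_mono add_mono power_mono) auto
    then show ?thesis using that by simp
  qed
  have cP: "continuous_on UNIV P"
    using linear_continuous_on P(1) linear_conv_bounded_linear by blast
  show "continuous_on (ball 0 r) (\<lambda>z. f (P (fst z), P (snd z)))"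
    by (rule continuous_on_compose2[OF gateaux_holo_cont[OF f]])
       (auto intro!: continuous_intros continuous_on_compose2[OF cP] nb simp del: mem_ball_0)
  fix z :: "'b \<times> 'b" and d
  have eq: "(P (fst (z + cscale s d)), P (snd (z + cscale s d))) = (P (fst z), P (snd z)) + cscale s (P d)" for s
    by (simp add: cscale_def linear_add[OF P(1)] linear_scale[OF P(1)])
  show "(\<lambda>s. f (P (fst (z + cscale s d)), P (snd (z + cscale s d)))) holomorphic_on {s. z + cscale s d \<in> ball 0 r}"
    unfolding eq
    by (rule gateaux_holo_line[OF f]) (use nb eq in \<open>metis mem_Collect_eq\<close>)
qed

section \<open>From the local inequality to compact sets\<close>

lemma dense_range_inner_eq_0:
  fixes w :: "'y::real_inner"
  assumes "closure (range y) = UNIV" "\<And>j. w \<bullet> y j = 0"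
  shows "w = 0"
proof -
  have "closed {u. w \<bullet> u = 0}" by (intro closed_Collect_eq continuous_intros)
  then have "closure (range y) \<subseteq> {u. w \<bullet> u = 0}"
    by (rule closure_minimal[rotated]) (auto simp: assms(2))
  then have "w \<bullet> w = 0" using assms(1) by blast
  then show ?thesis by simp
qed

text \<open>Density turns a common zero of all entry differences into an equality of operators, to
  which the hypothesis on \<open>R\<close> applies.\<close>

lemma blinfun_eq_of_dense_entries:
  fixes T T' :: "'x::real_inner \<Rightarrow>\<^sub>L 'y::real_inner"
  assumes x: "closure (range x) = UNIV" and y: "closure (range y) = UNIV"
    and eq: "\<And>i j. blinfun_apply T (x i) \<bullet> y j = blinfun_apply T' (x i) \<bullet> y j"
  shows "T = T'"
proof -
  have "blinfun_apply T (x i) - blinfun_apply T' (x i) = 0" for i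
    by (rule dense_range_inner_eq_0[OF y]) (simp add: inner_diff_left eq)
  then have "range x \<subseteq> {u. blinfun_apply T u = blinfun_apply T' u}" by auto
  moreover have "closed {u. blinfun_apply T u = blinfun_apply T' u}"
    by (intro closed_Collect_eq blinfun.continuous_on continuous_on_const continuous_on_id)
  ultimately have "closure (range x) \<subseteq> {u. blinfun_apply T u = blinfun_apply T' u}"
    by (rule closure_minimal)
  then show ?thesis using x by (intro blinfun_eqI) auto
qed

lemma C1_locally_Lipschitz:
  fixes R :: "'a::euclidean_space \<Rightarrow> 'b::real_normed_vector"
  assumes "open U" "continuously_differentiable_on R U" "p \<in> U"
  obtains L d where "0 \<le> L" "0 < d" "ball p d \<subseteq> U"
    "\<And>a b. a \<in> ball p d \<Longrightarrow> b \<in> ball p d \<Longrightarrow> norm (R a - R b) \<le> L * norm (a - b)"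
proof -
  obtain R' :: "'a \<Rightarrow> 'a \<Rightarrow>\<^sub>L 'b" where R': "\<And>p. p \<in> U \<Longrightarrow> (R has_derivative blinfun_apply (R' p)) (at p)"
    "continuous_on U R'" using assms(2) unfolding continuously_differentiable_on_def by blast
  obtain e where e: "0 < e" "ball p e \<subseteq> U" using assms(1,3) open_contains_ball by blast
  obtain d' where d': "0 < d'" "\<And>a. a \<in> U \<Longrightarrow> dist a p < d' \<Longrightarrow> dist (R' a) (R' p) < 1"
    using R'(2) assms(3) unfolding continuous_on_iff by (metis zero_less_one)
  define d where "d = min e d'"
  have sub: "ball p d \<subseteq> U" using e by (auto simp: d_def)
  show ?thesis
  proof (rule that)
    show "0 \<le> norm (R' p) + 1" "0 < d" "ball p d \<subseteq> U" using e d' sub by (auto simp: d_def)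
    fix a b assume ab: "a \<in> ball p d" "b \<in> ball p d"
    show "norm (R a - R b) \<le> (norm (R' p) + 1) * norm (a - b)"
    proof (rule differentiable_bound[OF convex_ball _ _ ab])
      fix u assume u: "u \<in> ball p d"
      then have uU: "u \<in> U" using sub by blast
      show "(R has_derivative blinfun_apply (R' u)) (at u within ball p d)"
        by (rule has_derivative_at_withinI[OF R'(1)[OF uU]])
      have "dist (R' u) (R' p) < 1"
        using u by (intro d'(2) uU) (simp add: d_def dist_commute)
      then have "norm (R' u) \<le> norm (R' p) + 1"
        using norm_triangle_sub[of "R' u" "R' p"] by (simp add: dist_norm)
      then show "onorm (blinfun_apply (R' u)) \<le> norm (R' p) + 1"
        by (simp add: norm_blinfun.rep_eq)
    qed
  qed
qed

text \<open>A Hoelder estimate in terms of a scale \<open>e\<close>: with a tolerance in place of an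
  exponent, estimates on two sets combine on the union by a minimum and a maximum, even if the
  exponents differ.\<close>

definition entry_control ::
  "(nat \<Rightarrow> nat \<Rightarrow> 'p \<Rightarrow> real) \<Rightarrow> ('p \<Rightarrow> 'c::real_normed_vector) \<Rightarrow> ('p \<times> 'p) set \<Rightarrow>
    (nat \<times> nat) set \<Rightarrow> (real \<Rightarrow> real) \<Rightarrow> real \<Rightarrow> bool" where
  "entry_control m R A J \<tau> L \<longleftrightarrow> finite J \<and> tolerance \<tau> \<and> 0 \<le> L \<and>
     (\<forall>p q e. (p, q) \<in> A \<longrightarrow> 0 < e \<longrightarrow> e \<le> 1 \<longrightarrow>
        (\<forall>i j. (i, j) \<in> J \<longrightarrow> \<bar>m i j p - m i j q\<bar> \<le> \<tau> e) \<longrightarrow> norm (R p - R q) \<le> L * e)"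

lemma entry_controlD:
  assumes "entry_control m R A J \<tau> L" "(p, q) \<in> A" "0 < e" "e \<le> 1"
    "\<And>i j. (i, j) \<in> J \<Longrightarrow> \<bar>m i j p - m i j q\<bar> \<le> \<tau> e"
  shows "norm (R p - R q) \<le> L * e"
  using assms(1)[unfolded entry_control_def, THEN conjunct2, THEN conjunct2, THEN conjunct2,
      rule_format, OF assms(2-4)] assms(5) by simp

lemma entry_control_Un:
  assumes A: "entry_control m R A J \<tau> L" and B: "entry_control m R B J' \<tau>' L'"
  shows "entry_control m R (A \<union> B) (J \<union> J') (\<lambda>e. min (\<tau> e) (\<tau>' e)) (max L L')"
  unfolding entry_control_def
proof (intro conjI allI impI)
  show "finite (J \<union> J')" "tolerance (\<lambda>e. min (\<tau> e) (\<tau>' e))" "0 \<le> max L L'"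
    using A B by (auto simp: entry_control_def intro: tolerance_min)
  fix p q and e :: real
  assume pq: "(p, q) \<in> A \<union> B" and e: "0 < e" "e \<le> 1"
    and small: "\<forall>i j. (i, j) \<in> J \<union> J' \<longrightarrow> \<bar>m i j p - m i j q\<bar> \<le> min (\<tau> e) (\<tau>' e)"
  have "norm (R p - R q) \<le> L * e \<or> norm (R p - R q) \<le> L' * e"
    using pq
  proof
    assume "(p, q) \<in> A"
    then show ?thesis using small by (intro disjI1 entry_controlD[OF A _ e]) auto
  next
    assume "(p, q) \<in> B"
    then show ?thesis using small by (intro disjI2 entry_controlD[OF B _ e]) auto
  qed
  moreover have "L * e \<le> max L L' * e" "L' * e \<le> max L L' * e"
    using e by (simp_all add: mult_right_mono)
  ultimately show "norm (R p - R q) \<le> max L L' * e" by linarith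
qed

lemma entry_control_compact:
  assumes "compact S" and op: "\<And>c. c \<in> S \<Longrightarrow> open (N c)" and mem: "\<And>c. c \<in> S \<Longrightarrow> c \<in> N c"
    and loc: "\<And>c. c \<in> S \<Longrightarrow> \<exists>J \<tau> L. entry_control m R (S \<inter> N c) J \<tau> L"
  shows "\<exists>J \<tau> L. entry_control m R S J \<tau> L"
proof -
  have cover: "S \<subseteq> (\<Union>c\<in>S. N c)" using mem by blast
  obtain C where C: "C \<subseteq> S" "finite C" "S \<subseteq> (\<Union>c\<in>C. N c)"
    by (rule compactE_image[OF assms(1) op cover])
  have "\<exists>J \<tau> L. entry_control m R (\<Union>c\<in>C. S \<inter> N c) J \<tau> L"
    using C(2,1)
  proof (induction C rule: finite_induct)
    case empty
    have "entry_control m R {} {} (\<lambda>_. 1) 0"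
      by (simp add: entry_control_def tolerance_const)
    then show ?case by auto
  next
    case (insert c C)
    obtain J \<tau> L where 1: "entry_control m R (S \<inter> N c) J \<tau> L" using loc insert.prems by blast
    obtain J' \<tau>' L' where 2: "entry_control m R (\<Union>c\<in>C. S \<inter> N c) J' \<tau>' L'" using insert by blast
    show ?case using entry_control_Un[OF 1 2] by auto
  qed
  moreover have "(\<Union>c\<in>C. S \<inter> N c) = S" using C(3) by blast
  ultimately show ?thesis by simp
qed

text \<open>The scale is chosen such that \<open>c * e ^ N\<close> equals \<open>sqrt s\<close>,
  where \<open>s\<close> is the sum of squares; this produces the exponent 1 / N. When
  \<open>sqrt s\<close> exceeds \<open>c\<close>, that scale would be larger than 1, and the a
  priori bound \<open>B\<close> takes over.\<close>

lemma entry_control_imp_Hoelder: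
  assumes ctrl: "entry_control m R (K \<times> K) J \<tau> L" and B: "\<And>p q. p \<in> K \<Longrightarrow> q \<in> K \<Longrightarrow> norm (R p - R q) \<le> B"
  obtains C \<theta> where "0 < C" "0 < \<theta>" "\<theta> \<le> 1"
    "\<And>p q. p \<in> K \<Longrightarrow> q \<in> K \<Longrightarrow>
      norm (R p - R q) \<le> C * (\<Sum>(i, j)\<in>J. \<bar>m i j p - m i j q\<bar>\<^sup>2) powr (\<theta> / 2)"
proof -
  have J: "finite J" "tolerance \<tau>" "0 \<le> L" using ctrl by (auto simp: entry_control_def)
  obtain c N0 where c: "0 < c" "\<And>e. 0 < e \<Longrightarrow> e \<le> 1 \<Longrightarrow> c * e ^ N0 \<le> \<tau> e"
    using J(2) by (erule toleranceE)
  \<comment> \<open>Raising the exponent by one is harmless for e \<le> 1 and makes it positive, so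
    that 1 / N lies in (0, 1].\<close>
  define N where "N = Suc N0"
  have cN: "c * e ^ N \<le> \<tau> e" if "0 < e" "e \<le> 1" for e
  proof -
    have "c * e ^ N \<le> c * e ^ N0"
      using c(1) that by (intro mult_left_mono power_decreasing) (auto simp: N_def)
    then show ?thesis using c(2)[OF that] by linarith
  qed
  define \<theta> where "\<theta> = 1 / real N"
  have \<theta>: "0 < \<theta>" "\<theta> \<le> 1" "\<theta> * real N = 1" by (auto simp: \<theta>_def N_def)
  define B' where "B' = max B 0"
  define C where "C = (L + B' + 1) * (1 / c) powr \<theta>"
  show ?thesis
  proof (rule that[OF _ \<theta>(1,2)])
    show "0 < C" using J(3) c(1) by (simp add: C_def B'_def add_nonneg_pos)
    fix p q assume pq: "p \<in> K" "q \<in> K"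
    define s where "s = (\<Sum>(i, j)\<in>J. \<bar>m i j p - m i j q\<bar>\<^sup>2)"
    have s0: "0 \<le> s" unfolding s_def by (intro sum_nonneg) auto
    have le: "\<bar>m i j p - m i j q\<bar> \<le> sqrt s" if "(i, j) \<in> J" for i j
    proof -
      have "(\<lambda>(i, j). \<bar>m i j p - m i j q\<bar>\<^sup>2) (i, j) \<le> s"
        unfolding s_def by (rule member_le_sum[OF that]) (use J in auto)
      then show ?thesis by (intro real_le_rsqrt) simp
    qed
    have bound: "norm (R p - R q) \<le> L * e" if "0 < e" "e \<le> 1" "sqrt s \<le> c * e ^ N" for e
    proof (rule entry_controlD[OF ctrl _ that(1,2)])
      show "\<bar>m i j p - m i j q\<bar> \<le> \<tau> e" if "(i, j) \<in> J" for i j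
        using le[OF that] \<open>sqrt s \<le> c * e ^ N\<close> cN[OF \<open>0 < e\<close> \<open>e \<le> 1\<close>] by linarith
    qed (use pq in simp)
    have key: "norm (R p - R q) \<le> (L + B' + 1) * (sqrt s / c) powr \<theta>"
    proof -
      consider "s = 0" | "0 < s" "sqrt s \<le> c" | "c < sqrt s"
        using s0 by (metis less_eq_real_def not_le)
      then show ?thesis
      proof cases
        \<comment> \<open>Every scale is admissible here, and letting \<open>e\<close> tend to 0
          gives \<open>R p = R q\<close>.\<close>
        case 1
        have "norm (R p - R q) \<le> L * e" if "0 < e" "e \<le> 1" for e
          by (rule bound[OF that]) (use 1 c(1) that in simp)
        then have "norm (R p - R q) \<le> 0 + a" if "0 < a" for a
        proof -
          define e where "e = min 1 (a / (L + 1))"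
          have e: "0 < e" "e \<le> 1" using that J(3) by (auto simp: e_def)
          have "L * e \<le> (L + 1) * (a / (L + 1))"
            using J(3) e that by (intro mult_mono) (auto simp: e_def)
          also have "\<dots> = a" using J(3) by simp
          finally show ?thesis using \<open>\<And>e. 0 < e \<Longrightarrow> e \<le> 1 \<Longrightarrow> norm (R p - R q) \<le> L * e\<close>[OF e] by linarith
        qed
        then have "norm (R p - R q) \<le> 0" by (rule field_le_epsilon)
        then show ?thesis using J(3) by (simp add: B'_def)
      next
        case 2
        define e where "e = (sqrt s / c) powr \<theta>"
        have pos: "0 < sqrt s / c" using 2 c(1) by simp
        have e: "0 < e" "e \<le> 1"
          using pos 2 c(1) \<theta> by (auto simp: e_def intro!: powr_le1)
        have "e ^ N = sqrt s / c"
        proof -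
          have "e ^ N = e powr real N" using e(1) by (rule powr_realpow[symmetric])
          also have "\<dots> = (sqrt s / c) powr (\<theta> * real N)" unfolding e_def by (rule powr_powr)
          also have "\<dots> = sqrt s / c" unfolding \<theta>(3) using pos by (simp only: powr_one)
          finally show ?thesis .
        qed
        then have "norm (R p - R q) \<le> L * e" using c(1) by (intro bound[OF e]) simp
        also have "\<dots> \<le> (L + B' + 1) * e" using e by (intro mult_right_mono) (auto simp: B'_def)
        finally show ?thesis by (simp add: e_def)
      next
        case 3
        have "1 \<le> (sqrt s / c) powr \<theta>" using 3 c(1) \<theta> by (intro ge_one_powr_ge_zero) auto
        then have *: "(L + B' + 1) * 1 \<le> (L + B' + 1) * (sqrt s / c) powr \<theta>"
          using J(3) by (intro mult_left_mono) (auto simp: B'_def)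
        have "norm (R p - R q) \<le> B'" using B[OF pq] by (simp add: B'_def)
        also have "\<dots> \<le> (L + B' + 1) * 1" using J(3) by simp
        finally show ?thesis using * by (rule order_trans)
      qed
    qed
    have "(sqrt s / c) powr \<theta> = (1 / c) powr \<theta> * s powr (\<theta> / 2)"
    proof -
      have "sqrt s / c = (1 / c) * s powr (1/2)" using s0 by (simp add: powr_half_sqrt)
      then have "(sqrt s / c) powr \<theta> = (1 / c) powr \<theta> * (s powr (1/2)) powr \<theta>"
        using c(1) by (simp only: powr_mult)
      then show ?thesis by (simp only: powr_powr) simp
    qed
    then show "norm (R p - R q) \<le> C * s powr (\<theta> / 2)"
      using key unfolding C_def by (simp only: mult.assoc)
  qed
qed

section \<open>Local control near a pair of points\<close>

lemma matrix_entry_bounded_linear: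
  fixes x :: "nat \<Rightarrow> 'x::real_inner" and y :: "nat \<Rightarrow> 'y::real_inner"
  shows "bounded_linear (\<lambda>T :: 'x \<Rightarrow>\<^sub>L 'y. blinfun_apply T (x i) \<bullet> y j)"
  by (rule bounded_linear_compose[OF bounded_linear_inner_left blinfun.bounded_linear_left])

lemma matrix_entry_complex_extension:
  fixes F :: "'a::euclidean_space \<Rightarrow> 'x::real_inner \<Rightarrow>\<^sub>L 'y::real_inner"
  assumes "real_analytic_on F U" "p \<in> U"
  obtains r f where "0 < r" "\<And>i j. gateaux_holo r (f i j)"
    "\<And>i j h. norm h < r \<Longrightarrow> f i j (h, 0) = of_real (matrix_entry F x y i j (p + h))"
proof -
  obtain r where r: "0 < r" "\<And>l :: ('x \<Rightarrow>\<^sub>L 'y) \<Rightarrow> real. bounded_linear l \<Longrightarrow>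
      \<exists>f. gateaux_holo r f \<and> (\<forall>h. norm h < r \<longrightarrow> f (h, 0) = of_real (l (F (p + h))))"
    using real_analytic_complex_extension[OF assms] by metis
  have "\<exists>f. gateaux_holo r f \<and> (\<forall>h. norm h < r \<longrightarrow> f (h, 0) = of_real (matrix_entry F x y i j (p + h)))"
    for i j
    using r(2)[OF matrix_entry_bounded_linear] by (simp add: matrix_entry_def)
  then obtain f where "\<And>i j. gateaux_holo r (f i j)"
    "\<And>i j h. norm h < r \<Longrightarrow> f i j (h, 0) = of_real (matrix_entry F x y i j (p + h))" by metis
  then show ?thesis by (rule that[OF r(1)])
qed

text \<open>If some entry separates \<open>p0\<close> from \<open>q0\<close>, it still does so
  nearby, and the estimate holds vacuously with a constant tolerance. Otherwise all entry
  differences vanish at the centre, and the inequality supplies a pair within \<open>e\<close> at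
  which the operators agree; the two Lipschitz bounds for \<open>R\<close> then add up.\<close>

lemma local_entry_control:
  fixes F :: "'a::euclidean_space \<Rightarrow> 'x::real_inner \<Rightarrow>\<^sub>L 'y::real_inner"
    and R :: "'a \<Rightarrow> 'c::real_normed_vector"
  assumes "open U" and an: "real_analytic_on F U" and C1: "continuously_differentiable_on R U"
    and det: "\<And>p q. p \<in> U \<Longrightarrow> q \<in> U \<Longrightarrow> F p = F q \<Longrightarrow> R p = R q"
    and dense: "closure (range x) = UNIV" "closure (range y) = UNIV"
    and p0: "p0 \<in> U" and q0: "q0 \<in> U"
  shows "\<exists>d J \<tau> L. 0 < d \<and> entry_control (matrix_entry F x y) R (ball p0 d \<times> ball q0 d) J \<tau> L"
proof -
  let ?m = "matrix_entry F x y"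
  obtain rp fp where rp: "0 < rp" and fp: "\<And>i j. gateaux_holo rp (fp i j)"
    "\<And>i j h. norm h < rp \<Longrightarrow> fp i j (h, 0) = of_real (?m i j (p0 + h))"
    by (rule matrix_entry_complex_extension[OF an p0, of x y]) (rule that)
  obtain rq fq where rq: "0 < rq" and fq: "\<And>i j. gateaux_holo rq (fq i j)"
    "\<And>i j h. norm h < rq \<Longrightarrow> fq i j (h, 0) = of_real (?m i j (q0 + h))"
    by (rule matrix_entry_complex_extension[OF an q0, of x y]) (rule that)
  obtain Lp dp where Lp: "0 \<le> Lp" "0 < dp" "ball p0 dp \<subseteq> U"
    "\<And>a b. a \<in> ball p0 dp \<Longrightarrow> b \<in> ball p0 dp \<Longrightarrow> norm (R a - R b) \<le> Lp * norm (a - b)"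
    using C1_locally_Lipschitz[OF \<open>open U\<close> C1 p0] by metis
  obtain Lq dq where Lq: "0 \<le> Lq" "0 < dq" "ball q0 dq \<subseteq> U"
    "\<And>a b. a \<in> ball q0 dq \<Longrightarrow> b \<in> ball q0 dq \<Longrightarrow> norm (R a - R b) \<le> Lq * norm (a - b)"
    using C1_locally_Lipschitz[OF \<open>open U\<close> C1 q0] by metis
  define r where "r = min (min rp rq) (min dp dq)"
  have r: "0 < r" "r \<le> rp" "r \<le> rq" "r \<le> dp" "r \<le> dq" using rp rq Lp Lq by (auto simp: r_def)
  \<comment> \<open>The real variable is a pair of displacements, so a complexified point is a pair
    of pairs: \<open>fst (fst z)\<close> and \<open>fst (snd z)\<close> are the real and imaginary
    parts of the displacement from \<open>p0\<close>.\<close>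
  define g where "g = (\<lambda>(i, j) (z :: ('a \<times> 'a) \<times> ('a \<times> 'a)).
    fp i j (fst (fst z), fst (snd z)) - fq i j (snd (fst z), snd (snd z)))"
  have hol: "gateaux_holo r (g ij)" for ij
  proof -
    obtain i j where ij: "ij = (i, j)" by (cases ij)
    have "gateaux_holo r (\<lambda>z :: ('a \<times> 'a) \<times> ('a \<times> 'a). fp i j (fst (fst z), fst (snd z)))"
      by (rule gateaux_holo_linear_compose[OF gateaux_holo_mono[OF fp(1) r(2)]]) (auto simp: linear_fst norm_fst_le)
    moreover have "gateaux_holo r (\<lambda>z :: ('a \<times> 'a) \<times> ('a \<times> 'a). fq i j (snd (fst z), snd (snd z)))"
      by (rule gateaux_holo_linear_compose[OF gateaux_holo_mono[OF fq(1) r(3)]]) (auto simp: linear_snd norm_snd_le)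
    ultimately show ?thesis by (simp add: g_def ij gateaux_holo_diff)
  qed
  have g_real: "g (i, j) ((h, k), 0) = of_real (?m i j (p0 + h) - ?m i j (q0 + k))"
    if "norm (h, k) < r" for i j h k
  proof -
    have "norm h < rp" "norm k < rq"
      using that r norm_fst_le[of h k] norm_snd_le[of k h] by auto
    then show ?thesis by (simp add: g_def fp fq)
  qed
  show ?thesis
  proof (cases "\<exists>i j. ?m i j p0 \<noteq> ?m i j q0")
    case True
    then obtain i j where ij: "?m i j p0 \<noteq> ?m i j q0" by blast
    \<comment> \<open>The gap at the centre is 2c and changes by less than \<open>c\<close> nearby,
      so the entry difference stays above \<open>c\<close> and never meets the level
      \<open>c / 2\<close>.\<close>
    define c where "c = \<bar>?m i j p0 - ?m i j q0\<bar> / 2"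
    have c: "0 < c" using ij by (simp add: c_def)
    have "0 \<in> ball (0 :: ('a \<times> 'a) \<times> ('a \<times> 'a)) r" using r by simp
    then obtain d where d: "0 < d"
      "\<And>z. z \<in> ball 0 r \<Longrightarrow> dist z 0 < d \<Longrightarrow> dist (g (i, j) z) (g (i, j) 0) < c"
      using gateaux_holo_cont[OF hol[of "(i, j)"]] c unfolding continuous_on_iff by metis
    have "entry_control ?m R (ball p0 (min d r / 2) \<times> ball q0 (min d r / 2)) {(i, j)} (\<lambda>_. c / 2) 0"
      unfolding entry_control_def
    proof (intro conjI allI impI)
      show "finite {(i, j)}" "tolerance (\<lambda>_. c / 2)" "(0::real) \<le> 0" using c by (auto intro: tolerance_const)
      fix p q and e :: real
      assume pq: "(p, q) \<in> ball p0 (min d r / 2) \<times> ball q0 (min d r / 2)"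
        and small: "\<forall>i' j'. (i', j') \<in> {(i, j)} \<longrightarrow> \<bar>?m i' j' p - ?m i' j' q\<bar> \<le> c / 2"
      have "norm (p - p0, q - q0) \<le> norm (p - p0) + norm (q - q0)" by (rule norm_Pair_le)
      also have "\<dots> < min d r" using pq by (auto simp: dist_norm norm_minus_commute)
      finally have n: "norm (p - p0, q - q0) < min d r" .
      have "dist (g (i, j) ((p - p0, q - q0), 0)) (g (i, j) 0) < c"
        using n by (intro d(2)) (auto simp: norm_Pair)
      moreover have "g (i, j) ((p - p0, q - q0), 0) = of_real (?m i j p - ?m i j q)"
        using g_real[of "p - p0" "q - q0" i j] n by simp
      moreover have "g (i, j) 0 = of_real (?m i j p0 - ?m i j q0)"
        using g_real[of 0 0 i j] r(1) by (simp add: zero_prod_def norm_Pair)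
      ultimately have "\<bar>(?m i j p - ?m i j q) - (?m i j p0 - ?m i j q0)\<bar> < c"
        by (simp add: dist_norm flip: of_real_diff)
      moreover have "\<bar>?m i j p - ?m i j q\<bar> \<le> c / 2" using small by simp
      moreover have False if "\<bar>a - b\<bar> < c" "\<bar>a\<bar> \<le> c / 2" "\<bar>b\<bar> = 2 * c" for a b :: real
        using that c by (auto simp: abs_if split: if_split_asm)
      ultimately have False unfolding c_def by auto
      then show "norm (R p - R q) \<le> 0 * e" ..
    qed
    then show ?thesis using d r by (intro exI[of _ "min d r / 2"]) auto
  next
    case False
    have g0: "g (i, j) 0 = 0" for i j
      using g_real[of 0 0 i j] False r(1) by (simp add: zero_prod_def norm_Pair)
    have "lojasiewicz r (UNIV :: ('a \<times> 'a) set) (range g)"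
      by (rule lojasiewicz_holds) (use r hol g0 in auto)
    then obtain J \<tau> \<rho> where J: "finite J" "J \<subseteq> range g" "tolerance \<tau>" "0 < \<rho>"
      and loj: "\<forall>e w. 0 < e \<longrightarrow> e \<le> 1 \<longrightarrow> w \<in> UNIV \<longrightarrow> norm w < \<rho> \<longrightarrow> (\<forall>f\<in>J. cmod (f (w, 0)) \<le> \<tau> e) \<longrightarrow>
        (\<exists>z\<in>UNIV. norm (z - w) \<le> e \<and> norm z < r \<and> (\<forall>f\<in>range g. f (z, 0) = 0))"
      unfolding lojasiewicz_def by (elim exE conjE) (rule that)
    obtain I where I: "finite I" "J = g ` I"
      using finite_subset_image[OF J(1,2)] by blast
    \<comment> \<open>Halved because the norm of a pair is estimated by the sum of the norms of its
      components.\<close>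
    define d where "d = min \<rho> r / 2"
    have "entry_control ?m R (ball p0 d \<times> ball q0 d) I \<tau> (Lp + Lq)"
      unfolding entry_control_def
    proof (intro conjI allI impI)
      show "finite I" "tolerance \<tau>" "0 \<le> Lp + Lq" using I J Lp Lq by auto
      fix p q and e :: real
      assume pq: "(p, q) \<in> ball p0 d \<times> ball q0 d" and e: "0 < e" "e \<le> 1"
        and small: "\<forall>i j. (i, j) \<in> I \<longrightarrow> \<bar>?m i j p - ?m i j q\<bar> \<le> \<tau> e"
      have "norm (p - p0, q - q0) \<le> norm (p - p0) + norm (q - q0)" by (rule norm_Pair_le)
      also have "\<dots> < min \<rho> r" using pq by (auto simp: dist_norm norm_minus_commute d_def)
      finally have n: "norm (p - p0, q - q0) < \<rho>" "norm (p - p0, q - q0) < r" by auto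
      have "\<forall>f\<in>J. cmod (f ((p - p0, q - q0), 0)) \<le> \<tau> e"
      proof
        fix f assume "f \<in> J"
        then obtain i j where ij: "(i, j) \<in> I" "f = g (i, j)" using I by auto
        have "f ((p - p0, q - q0), 0) = of_real (?m i j p - ?m i j q)"
          using g_real[OF n(2), of i j] by (simp add: ij)
        then show "cmod (f ((p - p0, q - q0), 0)) \<le> \<tau> e"
          using small ij(1) by (simp only: norm_of_real)
      qed
      then obtain z where z: "norm (z - (p - p0, q - q0)) \<le> e" "norm z < r" "\<forall>f\<in>range g. f (z, 0) = 0"
        using loj e n(1) by blast
      obtain h k where hk: "z = (h, k)" by (cases z)
      have hr: "norm h < r" "norm k < r"
        using z(2) norm_fst_le[of h k] norm_snd_le[of k h] by (auto simp: hk)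
      have U: "p0 + h \<in> U" "q0 + k \<in> U"
        using hr r Lp(3) Lq(3) by (auto simp: subset_iff dist_norm)
      have "?m i j (p0 + h) = ?m i j (q0 + k)" for i j
      proof -
        have "g (i, j) (z, 0) = 0" using z(3) by blast
        then show ?thesis using g_real[of h k i j] z(2) by (simp add: hk flip: of_real_diff)
      qed
      then have "F (p0 + h) = F (q0 + k)"
        by (intro blinfun_eq_of_dense_entries[OF dense]) (simp add: matrix_entry_def)
      then have Req: "R (p0 + h) = R (q0 + k)" by (rule det[OF U])
      have dr: "d < r" using r by (auto simp: d_def)
      have "norm (R p - R (p0 + h)) \<le> Lp * norm (p - (p0 + h))"
        using pq hr r dr by (intro Lp(4)) (auto simp: dist_norm)
      also have "\<dots> \<le> Lp * e"
      proof (intro mult_left_mono Lp(1))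
        show "norm (p - (p0 + h)) \<le> e"
          using norm_fst_le[of "h - (p - p0)" "k - (q - q0)"] z(1)
          by (simp add: hk norm_minus_commute algebra_simps)
      qed
      finally have 1: "norm (R p - R (p0 + h)) \<le> Lp * e" .
      have "norm (R q - R (q0 + k)) \<le> Lq * norm (q - (q0 + k))"
        using pq hr r dr by (intro Lq(4)) (auto simp: dist_norm)
      also have "\<dots> \<le> Lq * e"
      proof (intro mult_left_mono Lq(1))
        show "norm (q - (q0 + k)) \<le> e"
          using norm_snd_le[of "k - (q - q0)" "h - (p - p0)"] z(1)
          by (simp add: hk norm_minus_commute algebra_simps)
      qed
      finally have 2: "norm (R q - R (q0 + k)) \<le> Lq * e" .
      have "norm (R p - R q) \<le> norm (R p - R (p0 + h)) + norm (R q - R (q0 + k))"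
        using norm_triangle_ineq4[of "R p - R (p0 + h)" "R q - R (q0 + k)"] by (simp add: Req)
      then show "norm (R p - R q) \<le> (Lp + Lq) * e"
        using 1 2 by (simp add: distrib_right)
    qed
    then show ?thesis using J r by (intro exI[of _ d]) (auto simp: d_def)
  qed
qed

theorem theoremB:
  fixes U :: "(real ^ 'm) set"
    and F :: "real ^ 'm \<Rightarrow> 'x::{real_inner, polish_space} \<Rightarrow>\<^sub>L 'y::{real_inner, polish_space}"
    and R :: "real ^ 'm \<Rightarrow> real ^ 'r"
    and x :: "nat \<Rightarrow> 'x"
    and y :: "nat \<Rightarrow> 'y"
  assumes "open U"
    and "real_analytic_on F U"
    and "continuously_differentiable_on R U"
    and "\<And>p q. p \<in> U \<Longrightarrow> q \<in> U \<Longrightarrow> F p = F q \<Longrightarrow> R p = R q"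
    and "closure (range x) = UNIV"
    and "closure (range y) = UNIV"
  shows "\<forall>K. compact K \<and> K \<subseteq> U \<longrightarrow>
    (\<exists>(M::nat) (i::nat \<Rightarrow> nat) (j::nat \<Rightarrow> nat) (C::real) (\<theta>::real).
      C > 0 \<and> 0 < \<theta> \<and> \<theta> \<le> 1 \<and>
      (\<forall>p\<in>K. \<forall>q\<in>K.
        norm (R p - R q) \<le> C *
          (\<Sum>l=1..M. \<bar>matrix_entry F x y (i l) (j l) p - matrix_entry F x y (i l) (j l) q\<bar>\<^sup>2)
            powr (\<theta> / 2)))"
proof (intro allI impI)
  fix K assume K: "compact K \<and> K \<subseteq> U"
  let ?m = "matrix_entry F x y"
  \<comment> \<open>Compactness is applied to the product of \<open>K\<close> with itself, not only
    to the diagonal: \<open>F\<close> may take the same value at points that are far apart.\<close>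
  have "\<exists>d>0. \<exists>J \<tau> L. entry_control ?m R (ball (fst c) d \<times> ball (snd c) d) J \<tau> L" if "c \<in> K \<times> K" for c
  proof -
    have c: "fst c \<in> U" "snd c \<in> U" using that K by auto
    have "\<exists>d J \<tau> L. 0 < d \<and> entry_control ?m R (ball (fst c) d \<times> ball (snd c) d) J \<tau> L"
      by (rule local_entry_control[OF assms(1-3) _ assms(5,6) c]) (rule assms(4))
    then show ?thesis by blast
  qed
  then obtain d where d: "\<And>c. c \<in> K \<times> K \<Longrightarrow> d c > 0"
    "\<And>c. c \<in> K \<times> K \<Longrightarrow> \<exists>J \<tau> L. entry_control ?m R (ball (fst c) (d c) \<times> ball (snd c) (d c)) J \<tau> L"
    by metis
  have "\<exists>J \<tau> L. entry_control ?m R (K \<times> K) J \<tau> L"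
  proof (rule entry_control_compact[where N = "\<lambda>c. ball (fst c) (d c) \<times> ball (snd c) (d c)"])
    show "compact (K \<times> K)" using K by (intro compact_Times) auto
    fix c assume c: "c \<in> K \<times> K"
    show "open (ball (fst c) (d c) \<times> ball (snd c) (d c))" by (intro open_Times open_ball)
    show "c \<in> ball (fst c) (d c) \<times> ball (snd c) (d c)" using d(1)[OF c] by (simp add: mem_Times_iff)
    show "\<exists>J \<tau> L. entry_control ?m R (K \<times> K \<inter> ball (fst c) (d c) \<times> ball (snd c) (d c)) J \<tau> L"
    proof -
      obtain J \<tau> L where "entry_control ?m R (ball (fst c) (d c) \<times> ball (snd c) (d c)) J \<tau> L"
        using d(2)[OF c] by (elim exE)
      then have "entry_control ?m R (K \<times> K \<inter> ball (fst c) (d c) \<times> ball (snd c) (d c)) J \<tau> L"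
        by (simp add: entry_control_def)
      then show ?thesis by (intro exI)
    qed
  qed
  then obtain J \<tau> L where ctrl: "entry_control ?m R (K \<times> K) J \<tau> L" by blast
  have "continuous_on K R"
  proof (rule continuous_on_subset)
    show "continuous_on U R"
      using assms(3) unfolding continuously_differentiable_on_def
      by (meson continuous_at_imp_continuous_on has_derivative_continuous)
  qed (use K in blast)
  then have "bounded (R ` K)"
    using K by (intro compact_imp_bounded compact_continuous_image) auto
  then obtain B where B: "\<And>p. p \<in> K \<Longrightarrow> norm (R p) \<le> B" by (auto simp: bounded_iff)
  have B2: "norm (R p - R q) \<le> B + B" if "p \<in> K" "q \<in> K" for p q
    using norm_triangle_ineq4[of "R p" "R q"] B[OF that(1)] B[OF that(2)] by linarith
  obtain C \<theta> where C: "0 < C" "0 < \<theta>" "\<theta> \<le> 1"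
    "\<And>p q. p \<in> K \<Longrightarrow> q \<in> K \<Longrightarrow>
      norm (R p - R q) \<le> C * (\<Sum>(i, j)\<in>J. \<bar>?m i j p - ?m i j q\<bar>\<^sup>2) powr (\<theta> / 2)"
    by (rule entry_control_imp_Hoelder[OF ctrl B2]) (assumption+, rule that)
  have "finite J" using ctrl by (simp add: entry_control_def)
  then obtain h where h: "bij_betw h {1..card J} J"
    using ex_bij_betw_nat_finite_1 by blast
  have sum: "(\<Sum>(i, j)\<in>J. \<bar>?m i j p - ?m i j q\<bar>\<^sup>2) =
      (\<Sum>l=1..card J. \<bar>?m (fst (h l)) (snd (h l)) p - ?m (fst (h l)) (snd (h l)) q\<bar>\<^sup>2)" for p q
    using sum.reindex_bij_betw[OF h, of "\<lambda>(i, j). \<bar>?m i j p - ?m i j q\<bar>\<^sup>2"]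
    by (simp add: case_prod_unfold)
  show "\<exists>(M::nat) (i::nat \<Rightarrow> nat) (j::nat \<Rightarrow> nat) (C::real) (\<theta>::real).
      C > 0 \<and> 0 < \<theta> \<and> \<theta> \<le> 1 \<and>
      (\<forall>p\<in>K. \<forall>q\<in>K.
        norm (R p - R q) \<le> C *
          (\<Sum>l=1..M. \<bar>matrix_entry F x y (i l) (j l) p - matrix_entry F x y (i l) (j l) q\<bar>\<^sup>2)
            powr (\<theta> / 2))"
    by (rule exI[of _ "card J"], rule exI[of _ "\<lambda>l. fst (h l)"], rule exI[of _ "\<lambda>l. snd (h l)"],
        rule exI[of _ C], rule exI[of _ \<theta>])
       (use C sum in auto)
qed

end
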